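(* Let $a>0$, $\Omega_{\mathbf x}=(0,a)\times(0,a)$, $\Omega=\Omega_{\mathbf x}\times(0,\infty)$ and $\Gamma=\{(\mathbf x,z)\;|\;\mathbf x\in\Omega_{\mathbf x},\ z=0\}$. Assume that $u_0\in H^2(\Omega)$, $u_0|_{\partial\Omega}=0$, $u_0>0$ in $\Omega$, and that $\psi_0\in H^3(\Omega)$ satisfies $$\psi|_{\partial\Omega\setminus\Gamma}=0,\qquad\psi_z|_\Gamma=0. \qquad(\ast)$$ Let $(u,\psi)$ be the solution of $$u_t=2u\psi_z,\qquad-\Delta\psi_t=(u^2)_z\qquad\text{in }\Omega,$$ with $\psi$ satisfying the boundary condition $(\ast)$ and with initial data $u|_{t=0}=u_0$, $\psi|_{t=0}=\psi_0$. Let $$\phi(\mathbf x,z)=e^{-\alpha z}\sin\frac{\pi x_1}{a}\sin\frac{\pi x_2}{a},\qquad\alpha=\frac\pi a,$$ and $$A=\int_\Omega(\log u_0)\phi\,d\mathbf x\,dz,\qquad B=2\int_\Omega\psi_{0z}\phi\,d\mathbf x\,dz,$$ $$r(t)=\frac{4\left(\frac\pi a\right)^2}{2\left(\frac\pi a\right)^2-\alpha^2}\int_{\Omega_{\mathbf x}}(\psi-\psi_0)|_{z=0}\sin\frac{\pi x_1}{a}\sin\frac{\pi x_2}{a}\,d\mathbf x.$$ If $A>0$, $B>0$ and $r(t)\le\frac B2$ as long as $u,\psi$ remain regular, then the solution $(u,\psi)$ develops a finite time singularity in the $H^2$ norm.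
   Context: Here $\mathbf x=(x_1,x_2)$, $\Delta=\partial_{x_1}^2+\partial_{x_2}^2+\partial_z^2$, and subscripts $t,z$ denote partial derivatives ($\psi_{0z}=\partial_z\psi_0$). "Regular" refers to the class $u\in C^1([0,T);H^2(\Omega))$, $\psi\in C^1([0,T);H^3(\Omega))$. "Develops a finite time singularity in the $H^2$ norm" means that the largest time $T_b$ for which there is a solution in this class on $[0,T_b)$ is finite. *)

theory Defs
  imports "HOL-Analysis.Analysis"
begin

text \<open>
  A point of three-dimensional space is x :: real^3, with x$1, x$2 the horizontal coordinates
  \<open>x\<^sub>1\<close>, \<open>x\<^sub>2\<close> and x$3 the vertical coordinate z.  Elements of the Lebesgue and Sobolev spaces
  are represented by functions, and every notion below depends only on their class modulo
  equality almost everywhere on the domain.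
\<close>

type_synonym multi_index = "3 \<Rightarrow> nat"

definition mi_order :: "multi_index \<Rightarrow> nat" where
  "mi_order \<beta> = (\<Sum>i\<in>UNIV. \<beta> i)"

definition mi_unit :: "3 \<Rightarrow> multi_index" where
  "mi_unit i = (\<lambda>j. if j = i then 1 else 0)"

definition partial :: "3 \<Rightarrow> (real^3 \<Rightarrow> real) \<Rightarrow> (real^3 \<Rightarrow> real)" where
  "partial i f = (\<lambda>x. deriv (\<lambda>s. f (x + s *\<^sub>R axis i 1)) 0)"

definition partials :: "multi_index \<Rightarrow> (real^3 \<Rightarrow> real) \<Rightarrow> (real^3 \<Rightarrow> real)" where
  "partials \<beta> f = (partial 1 ^^ \<beta> 1) ((partial 2 ^^ \<beta> 2) ((partial 3 ^^ \<beta> 3) f))"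

text \<open>
  A function on the whole space is smooth iff all its iterated partial derivatives, in any order
  of the directions, are (Frechet) differentiable everywhere.
\<close>

definition smooth :: "(real^3 \<Rightarrow> real) \<Rightarrow> bool" where
  "smooth f \<longleftrightarrow> (\<forall>is. foldr partial is f differentiable_on UNIV)"

definition test_function :: "(real^3) set \<Rightarrow> (real^3 \<Rightarrow> real) \<Rightarrow> bool" where
  "test_function S \<eta> \<longleftrightarrow>
     smooth \<eta> \<and> (\<exists>K. compact K \<and> K \<subseteq> S \<and> (\<forall>x. x \<notin> K \<longrightarrow> \<eta> x = 0))"

definition locally_integrable :: "(real^3) set \<Rightarrow> (real^3 \<Rightarrow> real) \<Rightarrow> bool" where
  "locally_integrable S f \<longleftrightarrow> (\<forall>K. compact K \<and> K \<subseteq> S \<longrightarrow> set_integrable lebesgue K f)"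

definition has_weak_deriv ::
    "(real^3) set \<Rightarrow> multi_index \<Rightarrow> (real^3 \<Rightarrow> real) \<Rightarrow> (real^3 \<Rightarrow> real) \<Rightarrow> bool" where
  "has_weak_deriv S \<beta> f g \<longleftrightarrow>
     locally_integrable S f \<and> locally_integrable S g \<and>
     (\<forall>\<eta>. test_function S \<eta> \<longrightarrow>
        (LINT x:S|lebesgue. f x * partials \<beta> \<eta> x)
          = (-1) ^ mi_order \<beta> * (LINT x:S|lebesgue. g x * \<eta> x))"

text \<open>
  On an open set the weak derivative is unique up to equality almost everywhere, so the choice
  below is immaterial whenever a weak derivative exists.
\<close>

definition weak_deriv ::
    "(real^3) set \<Rightarrow> multi_index \<Rightarrow> (real^3 \<Rightarrow> real) \<Rightarrow> (real^3 \<Rightarrow> real)" where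
  "weak_deriv S \<beta> f = (SOME g. has_weak_deriv S \<beta> f g)"

definition weak_laplacian :: "(real^3) set \<Rightarrow> (real^3 \<Rightarrow> real) \<Rightarrow> (real^3 \<Rightarrow> real)" where
  "weak_laplacian S f = (\<lambda>x. \<Sum>i\<in>UNIV. weak_deriv S (\<lambda>j. 2 * mi_unit i j) f x)"

definition L2_on :: "(real^3) set \<Rightarrow> (real^3 \<Rightarrow> real) set" where
  "L2_on S = {f. set_borel_measurable lebesgue S f \<and> set_integrable lebesgue S (\<lambda>x. (f x)\<^sup>2)}"

definition sobolev :: "nat \<Rightarrow> (real^3) set \<Rightarrow> (real^3 \<Rightarrow> real) set" where
  "sobolev k S = {f \<in> L2_on S. \<forall>\<beta>. mi_order \<beta> \<le> k \<longrightarrow> (\<exists>g \<in> L2_on S. has_weak_deriv S \<beta> f g)}"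

definition sobolev_norm :: "nat \<Rightarrow> (real^3) set \<Rightarrow> (real^3 \<Rightarrow> real) \<Rightarrow> real" where
  "sobolev_norm k S f =
     sqrt (\<Sum>\<beta> | mi_order \<beta> \<le> k. (LINT x:S|lebesgue. (weak_deriv S \<beta> f x)\<^sup>2))"

definition time_interval :: "ereal \<Rightarrow> real set" where
  "time_interval T = {t. 0 \<le> t \<and> ereal t < T}"

text \<open>
  v belongs to \<open>C\<^sup>1([0,T); H\<^sup>k(S))\<close> and v' is its time derivative: difference quotients converge
  in the \<open>H\<^sup>k\<close> norm (one-sidedly at t = 0).  The case T = \<open>\<infinity>\<close> is included.
\<close>

definition C1_sobolev ::
    "nat \<Rightarrow> (real^3) set \<Rightarrow> ereal \<Rightarrow> (real \<Rightarrow> real^3 \<Rightarrow> real) \<Rightarrow> (real \<Rightarrow> real^3 \<Rightarrow> real) \<Rightarrow> bool" where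
  "C1_sobolev k S T v v' \<longleftrightarrow>
     (\<forall>t \<in> time_interval T.
        v t \<in> sobolev k S \<and> v' t \<in> sobolev k S \<and>
        ((\<lambda>s. sobolev_norm k S (\<lambda>x. (v s x - v t x) / (s - t) - v' t x)) \<longlongrightarrow> 0)
          (at t within time_interval T) \<and>
        ((\<lambda>s. sobolev_norm k S (\<lambda>x. v' s x - v' t x)) \<longlongrightarrow> 0)
          (at t within time_interval T))"

text \<open>
  Pointwise values, in the domain and on its boundary, of the Sobolev functions concerned.  They
  are needed only for functions in \<open>H\<^sup>2\<close> of a three-dimensional domain with Lipschitz boundary
  (namely u, \<open>\<psi>\<close> and \<open>\<psi>\<^sub>z\<close>); by the Sobolev embedding such a function has a representative that
  is continuous up to the boundary, unique on the closure, and its trace is the restriction of that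
  representative.
\<close>

definition is_cont_rep :: "(real^3) set \<Rightarrow> (real^3 \<Rightarrow> real) \<Rightarrow> (real^3 \<Rightarrow> real) \<Rightarrow> bool" where
  "is_cont_rep S f g \<longleftrightarrow>
     continuous_on (closure S) g \<and> (AE x in lebesgue. x \<in> S \<longrightarrow> g x = f x)"

definition cont_rep :: "(real^3) set \<Rightarrow> (real^3 \<Rightarrow> real) \<Rightarrow> (real^3 \<Rightarrow> real)" where
  "cont_rep S f = (SOME g. is_cont_rep S f g)"

definition vanishes_on :: "(real^3) set \<Rightarrow> (real^3 \<Rightarrow> real) \<Rightarrow> (real^3) set \<Rightarrow> bool" where
  "vanishes_on S f P \<longleftrightarrow> (\<exists>g. is_cont_rep S f g \<and> (\<forall>x\<in>P. g x = 0))"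

definition positive_on :: "(real^3) set \<Rightarrow> (real^3 \<Rightarrow> real) \<Rightarrow> (real^3) set \<Rightarrow> bool" where
  "positive_on S f P \<longleftrightarrow> (\<exists>g. is_cont_rep S f g \<and> (\<forall>x\<in>P. g x > 0))"

definition dom_x :: "real \<Rightarrow> (real^2) set" where
  "dom_x a = {y. 0 < y$1 \<and> y$1 < a \<and> 0 < y$2 \<and> y$2 < a}"

definition box_dom :: "real \<Rightarrow> (real^3) set" where
  "box_dom a = {x. 0 < x$1 \<and> x$1 < a \<and> 0 < x$2 \<and> x$2 < a \<and> 0 < x$3}"

definition bottom :: "real \<Rightarrow> (real^3) set" where
  "bottom a = {x. 0 < x$1 \<and> x$1 < a \<and> 0 < x$2 \<and> x$2 < a \<and> x$3 = 0}"

definition boundary_cond :: "real \<Rightarrow> (real^3 \<Rightarrow> real) \<Rightarrow> bool" where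
  "boundary_cond a p \<longleftrightarrow>
     vanishes_on (box_dom a) p (frontier (box_dom a) - bottom a) \<and>
     vanishes_on (box_dom a) (weak_deriv (box_dom a) (mi_unit 3) p) (bottom a)"

text \<open>
  The second equation \<open>- \<Delta> \<psi>\<^sub>t = (u\<^sup>2)\<^sub>z\<close> is expressed by saying that \<open>- \<Delta> \<psi>\<^sub>t\<close> is the weak
  z-derivative of \<open>u\<^sup>2\<close>.
\<close>

definition solution_on ::
    "real \<Rightarrow> (real^3 \<Rightarrow> real) \<Rightarrow> (real^3 \<Rightarrow> real) \<Rightarrow> ereal \<Rightarrow>
     (real \<Rightarrow> real^3 \<Rightarrow> real) \<Rightarrow> (real \<Rightarrow> real^3 \<Rightarrow> real) \<Rightarrow> bool" where
  "solution_on a u0 \<psi>0 T u \<psi> \<longleftrightarrow>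
     0 < T \<and>
     (\<exists>ut \<psi>t.
        C1_sobolev 2 (box_dom a) T u ut \<and>
        C1_sobolev 3 (box_dom a) T \<psi> \<psi>t \<and>
        (\<forall>t \<in> time_interval T.
           (AE x in lebesgue. x \<in> box_dom a \<longrightarrow>
              ut t x = 2 * u t x * weak_deriv (box_dom a) (mi_unit 3) (\<psi> t) x) \<and>
           has_weak_deriv (box_dom a) (mi_unit 3)
              (\<lambda>x. (u t x)\<^sup>2) (\<lambda>x. - weak_laplacian (box_dom a) (\<psi>t t) x) \<and>
           boundary_cond a (\<psi> t))) \<and>
     (AE x in lebesgue. x \<in> box_dom a \<longrightarrow> u 0 x = u0 x) \<and>
     (AE x in lebesgue. x \<in> box_dom a \<longrightarrow> \<psi> 0 x = \<psi>0 x)"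

definition largest_time :: "real \<Rightarrow> (real^3 \<Rightarrow> real) \<Rightarrow> (real^3 \<Rightarrow> real) \<Rightarrow> ereal \<Rightarrow> bool" where
  "largest_time a u0 \<psi>0 T \<longleftrightarrow>
     (\<exists>u \<psi>. solution_on a u0 \<psi>0 T u \<psi>) \<and>
     (\<forall>T' u \<psi>. solution_on a u0 \<psi>0 T' u \<psi> \<longrightarrow> T' \<le> T)"

definition finite_time_singularity :: "real \<Rightarrow> (real^3 \<Rightarrow> real) \<Rightarrow> (real^3 \<Rightarrow> real) \<Rightarrow> bool" where
  "finite_time_singularity a u0 \<psi>0 \<longleftrightarrow> (\<exists>T. largest_time a u0 \<psi>0 T \<and> T < \<infinity>)"

definition weight :: "real \<Rightarrow> real \<Rightarrow> real^3 \<Rightarrow> real" where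
  "weight a \<alpha> x = exp (- \<alpha> * x$3) * sin (pi * x$1 / a) * sin (pi * x$2 / a)"

end

(*
  Suppose the solution were global. By the Sobolev embedding psi_z is bounded on bounded time
  intervals, so u_t = 2 u psi_z keeps u comparable with u_0: the log of u stays under control and
  u^2 keeps a vanishing trace. Put c = int phi, X(t) = int u^2 phi, F(t) = 2 int psi_z phi and
  P(t) = - int (Laplacian psi) phi. Since phi_z = - kappa phi with kappa = pi/a, testing
  the second equation with phi gives P' = kappa X. Integrating by parts in P - P(0), where the
  boundary conditions leave only a bottom term, gives F = B + (2/kappa)(P - P(0)) - r.
  The hypothesis on r turns this into F >= Z := B/2 + (2/kappa)(P - P(0)), with Z' = 2 X.
  The first equation gives int (log u) phi = A + int_0^t F =: G, and Jensen's inequality gives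
  X >= c exp(2G/c). So G' >= Z, Z' >= 2 c exp(2G/c), which has no global solution with G, Z > 0.
*)

theory Submission
  imports Defs
begin

section \<open>Smooth cut-off functions\<close>

text \<open>The first equation holds at each time only outside a null set that may depend on the
  time, so \<open>u\<close> is never followed along a fixed point. Its comparison with
  \<open>u0\<close> is a Gronwall estimate for int u^2 m with bounded m >= 0: m = phi times a thin
  bottom layer keeps the trace zero, m = the indicator of a bad set gives a pointwise lower bound.
  As \<open>u0\<close> vanishes on the boundary, int (log u) phi is not a smooth functional of
  \<open>u\<close>; ln (u^2 + e) / 2 takes its place, and the lower bound by a multiple of u0^2
  makes the error vanish with e. Jensen's inequality enters as ln s <= s - 1 with a free point of
  tangency. The weight has no compact support in the box, so every integration by parts is a limit
  of smooth cut-offs in product form. At the bottom the cut-off leaves a layer of unit mass, hence a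
  trace. At the side faces its second derivative, multiplied by the small sine, has size m on strips
  of width 1/m, and the boundary values 0 of psi absorb it. The bound on psi_z must hold up to the
  edges with one constant; it comes from averages over boxes that point into the domain.\<close>

primrec C_diff :: "nat \<Rightarrow> (real \<Rightarrow> real) \<Rightarrow> bool" where
  "C_diff 0 f = True"
| "C_diff (Suc n) f = (\<exists>f'. (\<forall>x. (f has_real_derivative f' x) (at x)) \<and> C_diff n f')"

text \<open>All finite orders instead of one infinite chain of derivatives: closure under sums,
  products and affine substitutions then becomes an induction on the order, with the function left
  arbitrary.\<close>

definition smooth1 :: "(real \<Rightarrow> real) \<Rightarrow> bool" where
  "smooth1 f \<longleftrightarrow> (\<forall>n. C_diff n f)"

lemma C_diff_SucI:
  "(\<And>x. (f has_real_derivative f' x) (at x)) \<Longrightarrow> C_diff n f' \<Longrightarrow> C_diff (Suc n) f"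
  by auto

lemma C_diff_mono: "C_diff (Suc n) f \<Longrightarrow> C_diff n f"
  by (induction n arbitrary: f) auto

lemma smooth1_deriv: "smooth1 f \<Longrightarrow> (f has_real_derivative deriv f x) (at x)"
proof -
  assume "smooth1 f"
  then have "C_diff (Suc 0) f" by (simp only: smooth1_def)
  then obtain f' where "\<And>x. (f has_real_derivative f' x) (at x)" by auto
  then show ?thesis using DERIV_imp_deriv by metis
qed

lemma smooth1_smooth_deriv:
  assumes "smooth1 f" shows "smooth1 (deriv f)"
  unfolding smooth1_def
proof
  fix n
  from assms have "C_diff (Suc n) f" by (simp add: smooth1_def)
  then obtain f' where f': "\<And>x. (f has_real_derivative f' x) (at x)" "C_diff n f'" by auto
  have "deriv f = f'" using f'(1) by (auto simp: fun_eq_iff intro!: DERIV_imp_deriv)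
  with f' show "C_diff n (deriv f)" by simp
qed

lemma smooth1_higher_deriv: "smooth1 f \<Longrightarrow> smooth1 ((deriv ^^ n) f)"
  by (induction n) (auto intro: smooth1_smooth_deriv)

text \<open>For functions whose derivatives stay in an explicit family, such as the multiples of an
  exponential: each order follows from the previous one inside the family.\<close>

lemma smooth1_coinduct:
  assumes "f \<in> P" and step: "\<And>f. f \<in> P \<Longrightarrow> \<exists>f'\<in>P. \<forall>x. (f has_real_derivative f' x) (at x)"
  shows "smooth1 f"
proof -
  have "C_diff n f" if "f \<in> P" for n f
    using that
  proof (induction n arbitrary: f)
    case (Suc n) then show ?case using step[of f] by auto
  qed simp
  with assms(1) show ?thesis by (simp add: smooth1_def)
qed

lemma smooth1_continuous: "smooth1 f \<Longrightarrow> continuous_on S f"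
  by (intro continuous_at_imp_continuous_on ballI DERIV_isCont[OF smooth1_deriv])

lemma smooth1_measurable: "smooth1 f \<Longrightarrow> f \<in> borel_measurable borel"
  by (rule borel_measurable_continuous_onI[OF smooth1_continuous])

lemma C_diff_add: "C_diff n f \<Longrightarrow> C_diff n g \<Longrightarrow> C_diff n (\<lambda>x. f x + g x)"
proof (induction n arbitrary: f g)
  case (Suc n)
  then obtain f' g' where *: "\<And>x. (f has_real_derivative f' x) (at x)" "C_diff n f'"
    "\<And>x. (g has_real_derivative g' x) (at x)" "C_diff n g'" by auto
  show ?case by (rule C_diff_SucI[OF DERIV_add[OF *(1) *(3)] Suc.IH[OF *(2) *(4)]])
qed simp

lemma C_diff_mult: "C_diff n f \<Longrightarrow> C_diff n g \<Longrightarrow> C_diff n (\<lambda>x. f x * g x)"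
proof (induction n arbitrary: f g)
  case (Suc n)
  then obtain f' g' where *: "\<And>x. (f has_real_derivative f' x) (at x)" "C_diff n f'"
    "\<And>x. (g has_real_derivative g' x) (at x)" "C_diff n g'" by auto
  have "C_diff n (\<lambda>x. f' x * g x + g' x * f x)"
    by (intro C_diff_add Suc.IH * C_diff_mono[OF Suc.prems(1)] C_diff_mono[OF Suc.prems(2)])
  moreover have "((\<lambda>x. f x * g x) has_real_derivative f' x * g x + g' x * f x) (at x)" for x
    by (rule DERIV_mult[OF *(1) *(3)])
  ultimately show ?case by (intro C_diff_SucI)
qed simp

lemma smooth1_const [intro]: "smooth1 (\<lambda>x. c)"
proof -
  have "C_diff n (\<lambda>x. c)" for n
  proof (induction n arbitrary: c)
    case (Suc n) show ?case by (rule C_diff_SucI[OF DERIV_const Suc])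
  qed simp
  then show ?thesis by (simp add: smooth1_def)
qed

lemma smooth1_id [intro]: "smooth1 (\<lambda>x. x)"
  unfolding smooth1_def
proof
  fix n show "C_diff n (\<lambda>x. x)"
    by (rule C_diff_mono[OF C_diff_SucI[OF DERIV_ident]]) (use smooth1_const[of 1] in \<open>simp add: smooth1_def\<close>)
qed

lemma smooth1_add [intro]: "smooth1 f \<Longrightarrow> smooth1 g \<Longrightarrow> smooth1 (\<lambda>x. f x + g x)"
  by (simp add: smooth1_def C_diff_add)

lemma smooth1_mult [intro]: "smooth1 f \<Longrightarrow> smooth1 g \<Longrightarrow> smooth1 (\<lambda>x. f x * g x)"
  by (simp add: smooth1_def C_diff_mult)

lemma C_diff_affine: "C_diff n f \<Longrightarrow> C_diff n (\<lambda>x. f (c * x + d))"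
proof (induction n arbitrary: f)
  case (Suc n)
  then obtain f' where *: "\<And>x. (f has_real_derivative f' x) (at x)" "C_diff n f'" by auto
  have "((\<lambda>x. f (c * x + d)) has_real_derivative c * f' (c * x + d)) (at x)" for x
  proof -
    have "((\<lambda>x. c * x + d) has_real_derivative c) (at x)"
      by (auto intro!: derivative_eq_intros)
    from DERIV_chain2[OF *(1) this] show ?thesis by (simp add: mult.commute)
  qed
  moreover have "C_diff n (\<lambda>x. c * f' (c * x + d))"
    using smooth1_const[of c] by (intro C_diff_mult Suc.IH[OF *(2)]) (simp add: smooth1_def)
  ultimately show ?case by (intro C_diff_SucI)
qed simp

lemma smooth1_affine: "smooth1 f \<Longrightarrow> smooth1 (\<lambda>x. f (c * x + d))"
  by (simp add: smooth1_def C_diff_affine)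

lemma smooth1_divide:
  assumes f: "smooth1 f" and g: "smooth1 g" and pos: "\<And>x. g x \<noteq> 0"
  shows "smooth1 (\<lambda>x. f x / g x)"
proof -
  have "C_diff n (\<lambda>x. 1 / g x)" for n
  proof (induction n)
    case (Suc n)
    \<comment> \<open>The derivative of 1/g is written with 1/g itself, so the induction hypothesis
      at order n yields order n + 1.\<close>
    have "((\<lambda>x. 1 / g x) has_real_derivative (- 1) * (deriv g x * ((1 / g x) * (1 / g x)))) (at x)" for x
      using DERIV_inverse_fun[OF smooth1_deriv[OF g] pos] by (simp add: divide_inverse power2_eq_square)
    moreover have "C_diff n (\<lambda>x. (- 1) * (deriv g x * ((1 / g x) * (1 / g x))))"
      using smooth1_smooth_deriv[OF g] smooth1_const[of "- 1"] unfolding smooth1_def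
      by (intro C_diff_mult Suc) auto
    ultimately show ?case by (intro C_diff_SucI)
  qed simp
  then have "smooth1 (\<lambda>x. 1 / g x)" by (simp add: smooth1_def)
  from smooth1_mult[OF f this] show ?thesis by simp
qed

lemma smooth1_exp: "smooth1 (\<lambda>x. exp (c * x))"
  by (rule smooth1_coinduct[of _ "range (\<lambda>k x. k * exp (c * x))"])
     (auto intro!: derivative_eq_intros image_eqI[of _ _ 1])

lemma smooth1_sin: "smooth1 (\<lambda>x. sin (c * x))"
proof -
  \<comment> \<open>The sine alone is not reproduced by differentiation; the span of sine and cosine
    is.\<close>
  have "C_diff n (\<lambda>x. k * sin (c * x) + l * cos (c * x))" for n k l
  proof (induction n arbitrary: k l)
    case (Suc n)
    have "((\<lambda>x. k * sin (c * x) + l * cos (c * x)) has_real_derivative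
        (- l * c) * sin (c * x) + (k * c) * cos (c * x)) (at x)" for x
      by (auto intro!: derivative_eq_intros)
    then show ?case by (rule C_diff_SucI[OF _ Suc])
  qed simp
  from this[of _ 1 0] show ?thesis by (simp add: smooth1_def)
qed

text \<open>The factor \<open>x\<^sup>-\<^sup>k\<close> makes the family closed under differentiation, up to linear combinations.\<close>

definition flat :: "nat \<Rightarrow> real \<Rightarrow> real" where
  "flat k x = (if x > 0 then (1 / x) ^ k * exp (- 1 / x) else 0)"

lemma flat_nonneg: "flat k x \<ge> 0"
  by (simp add: flat_def)

lemma flat_pos: "x > 0 \<Longrightarrow> flat k x > 0"
  by (simp add: flat_def)

lemma flat_zero: "x \<le> 0 \<Longrightarrow> flat k x = 0"
  by (simp add: flat_def)

text \<open>A single term of the exponential series, (1/x)^(k + 2) / (k + 2)! \<le> exp (1/x),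
  yields quadratic decay at 0. The power beyond the first makes the difference quotient at 0 vanish
  in the limit.\<close>

lemma flat_le: "\<bar>flat k x\<bar> \<le> fact (k + 2) * x\<^sup>2"
proof (cases "x > 0")
  case True
  have "(1 / x) ^ (k + 2) / fact (k + 2) \<le> exp (1 / x)"
  proof -
    have "(\<Sum>n\<in>{k+2}. inverse (fact n) * (1 / x) ^ n) \<le> (\<Sum>n. inverse (fact n) * (1 / x) ^ n)"
      using True by (intro sum_le_suminf) (auto intro: summable_exp)
    then show ?thesis by (simp add: exp_def divide_inverse mult.commute)
  qed
  then have "(1 / x) ^ (k + 2) \<le> exp (1 / x) * fact (k + 2)"
    by (simp add: pos_divide_le_eq del: fact_Suc power_Suc add_2_eq_Suc')
  then have "(1 / x) ^ (k + 2) / exp (1 / x) \<le> fact (k + 2)"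
    by (simp add: pos_divide_le_eq mult.commute del: fact_Suc power_Suc add_2_eq_Suc')
  then have "(1 / x) ^ (k + 2) * exp (- (1 / x)) \<le> fact (k + 2)"
    by (simp only: exp_minus divide_inverse)
  then have "x\<^sup>2 * ((1 / x) ^ (k + 2) * exp (- (1 / x))) \<le> x\<^sup>2 * fact (k + 2)"
    by (intro mult_left_mono) auto
  moreover have "x\<^sup>2 * ((1 / x) ^ (k + 2) * exp (- (1 / x))) = flat k x"
    using True by (simp add: flat_def power_add power2_eq_square)
  ultimately show ?thesis using flat_nonneg[of k x] by (simp add: mult.commute)
qed (simp add: flat_def)

lemma flat_deriv:
  "(flat k has_real_derivative (- real k) * flat (k + 1) x + flat (k + 2) x) (at x)"
proof -
  consider "x > 0" | "x < 0" | "x = 0" by linarith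
  then show ?thesis
  proof cases
    case 1
    have y: "((\<lambda>x. 1 / x) has_real_derivative - ((1 / x) * (1 / x))) (at x)"
      using 1 by (auto intro!: derivative_eq_intros)
    have e: "((\<lambda>x. exp (- 1 / x)) has_real_derivative exp (- 1 / x) * ((1 / x) * (1 / x))) (at x)"
      using 1 by (auto intro!: derivative_eq_intros)
    have "real k * (- (v * v) * v ^ (k - Suc 0)) * E + E * (v * v) * v ^ k
        = - real k * (v ^ (k + 1) * E) + v ^ (k + 2) * E" for v E :: real
      by (cases k) (simp_all add: algebra_simps)
    then have "((\<lambda>x. (1 / x) ^ k * exp (- 1 / x)) has_real_derivative
        (- real k) * flat (k + 1) x + flat (k + 2) x) (at x)"
      using DERIV_mult[OF DERIV_power[OF y, of k] e] 1 by (simp only: flat_def if_True)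
    from has_field_derivative_transform_within_open[OF this, of "{0<..}" "flat k"]
    show ?thesis using 1 by (auto simp: flat_def)
  next
    case 2
    have "((\<lambda>x. 0) has_real_derivative (- real k) * flat (k + 1) x + flat (k + 2) x) (at x)"
      using 2 by (auto simp: flat_def)
    from has_field_derivative_transform_within_open[OF this, of "{..<0}" "flat k"]
    show ?thesis using 2 by (auto simp: flat_def)
  next
    case 3
    \<comment> \<open>At 0 the quotient is at most \<open>fact (k + 2) * \<bar>h\<bar>\<close> by
      \<open>flat_le\<close>. All functions \<open>flat j\<close> are 0 there, so the claimed
      formula gives the derivative 0 too.\<close>
    have "(\<lambda>h. flat k h / h) \<midarrow>0\<rightarrow> 0"
    proof (rule Lim_null_comparison)
      show "\<forall>\<^sub>F h in at 0. norm (flat k h / h) \<le> fact (k + 2) * \<bar>h\<bar>"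
      proof (rule always_eventually, rule allI)
        fix h :: real
        show "norm (flat k h / h) \<le> fact (k + 2) * \<bar>h\<bar>"
          using flat_le[of k h] by (cases "h = 0")
            (auto simp: abs_divide divide_le_eq power2_eq_square abs_mult_self_eq mult.assoc)
      qed
      show "((\<lambda>h::real. fact (k + 2) * \<bar>h\<bar>) \<longlongrightarrow> 0) (at 0)"
        using tendsto_mult_right_zero[OF tendsto_rabs_zero[OF tendsto_ident_at]] .
    qed
    then show ?thesis using 3 by (simp add: DERIV_def flat_def)
  qed
qed

lemma smooth1_flat: "smooth1 (flat k)"
proof -
  have "C_diff n (flat k)" for n
  proof (induction n arbitrary: k)
    case (Suc n)
    have "C_diff n (\<lambda>x. (- real k) * flat (k + 1) x + flat (k + 2) x)"
      using smooth1_const[of "- real k"] by (intro C_diff_add C_diff_mult Suc) (simp add: smooth1_def)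
    then show ?case by (rule C_diff_SucI[OF flat_deriv])
  qed simp
  then show ?thesis by (simp add: smooth1_def)
qed

text \<open>The standard smooth transition, 0 up to 1 and 1 from 2 on. As it starts at 1 and not at
  0, \<open>step (n * y)\<close> vanishes for all y \<le> 1/n, so cut-offs built from it have their
  support at a positive distance from the boundary.\<close>

definition step :: "real \<Rightarrow> real" where
  "step x = flat 0 (x - 1) / (flat 0 (x - 1) + flat 0 (2 - x))"

lemma step_denom: "flat 0 (x - 1) + flat 0 (2 - x) > 0"
  using flat_nonneg[of 0 "x - 1"] flat_nonneg[of 0 "2 - x"] flat_pos[of "x - 1" 0] flat_pos[of "2 - x" 0]
  by (cases "x > 1") (auto intro: add_pos_nonneg add_nonneg_pos)

lemma smooth1_step: "smooth1 step"
proof -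
  have "smooth1 (\<lambda>x. flat 0 (1 * x + (- 1)))" "smooth1 (\<lambda>x. flat 0 ((- 1) * x + 2))"
    by (intro smooth1_affine smooth1_flat)+
  then have "smooth1 (\<lambda>x. flat 0 (1 * x + (- 1)) / (flat 0 (1 * x + (- 1)) + flat 0 ((- 1) * x + 2)))"
    using step_denom by (intro smooth1_divide smooth1_add) (simp_all add: less_imp_neq[symmetric])
  moreover have "step = (\<lambda>x. flat 0 (1 * x + (- 1)) / (flat 0 (1 * x + (- 1)) + flat 0 ((- 1) * x + 2)))"
    by (simp add: step_def fun_eq_iff)
  ultimately show ?thesis by simp
qed

lemma step_0: "x \<le> 1 \<Longrightarrow> step x = 0"
  by (simp add: step_def flat_zero)

lemma step_1: "x \<ge> 2 \<Longrightarrow> step x = 1"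
  using flat_pos[of "x - 1" 0] by (simp add: step_def flat_zero)

lemma step_ge_0: "0 \<le> step x" and step_le_1: "step x \<le> 1"
  using flat_nonneg[of 0 "x - 1"] flat_nonneg[of 0 "2 - x"] step_denom[of x]
  by (auto simp: step_def divide_le_eq)

text \<open>The closed form shows the sign of the derivative and that it vanishes outside (1, 2).
  The derivative of \<open>flat 0\<close> is \<open>flat 2\<close>, because the first term of
  \<open>flat_deriv\<close> has the factor k = 0.\<close>

lemma deriv_step_eq:
  "deriv step x = (flat 2 (x - 1) * flat 0 (2 - x) + flat 0 (x - 1) * flat 2 (2 - x))
     / (flat 0 (x - 1) + flat 0 (2 - x))\<^sup>2"
proof -
  have 1: "((\<lambda>x. flat 0 (x - 1)) has_real_derivative flat 2 (x - 1)) (at x)"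
    using DERIV_shift[of "flat 0" "flat 2 (x - 1)" x "- 1"] flat_deriv[of 0 "x - 1"]
    by (simp add: numeral_2_eq_2)
  have 2: "((\<lambda>x. flat 0 (2 - x)) has_real_derivative - flat 2 (2 - x)) (at x)"
  proof -
    have a: "(flat 0 has_real_derivative flat 2 (2 - x)) (at (2 - x))"
      using flat_deriv[of 0 "2 - x"] by (simp add: numeral_2_eq_2)
    have b: "((\<lambda>x. 2 - x) has_real_derivative - 1) (at x)"
      by (auto intro!: derivative_eq_intros)
    show ?thesis using DERIV_chain2[OF a b] by simp
  qed
  show ?thesis
    using DERIV_imp_deriv[OF DERIV_divide[OF 1 DERIV_add[OF 1 2]]] step_denom[of x]
    unfolding step_def[abs_def] by (simp add: algebra_simps power2_eq_square)
qed

lemma deriv_step_nonneg: "deriv step x \<ge> 0"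
  by (simp add: deriv_step_eq flat_nonneg)

lemma deriv_step_0: "x \<le> 1 \<or> x \<ge> 2 \<Longrightarrow> deriv step x = 0"
  by (auto simp: deriv_step_eq flat_zero)

lemma deriv2_step_0: "x < 1 \<or> x > 2 \<Longrightarrow> deriv (deriv step) x = 0"
proof -
  assume "x < 1 \<or> x > 2"
  moreover have "deriv (deriv step) x = 0" if "x \<in> S" "open S" "\<And>y. y \<in> S \<Longrightarrow> deriv step y = 0" for S
  proof (rule DERIV_imp_deriv)
    show "(deriv step has_real_derivative 0) (at x)"
      by (rule has_field_derivative_transform_within_open[of "\<lambda>x. 0" _ _ S]) (use that in auto)
  qed
  from this[of "{..<1}"] this[of "{2<..}"] 
  have "x < 1 \<Longrightarrow> deriv (deriv step) x = 0" "x > 2 \<Longrightarrow> deriv (deriv step) x = 0"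
    using deriv_step_0 by auto
  ultimately show ?thesis by blast
qed

lemma smooth1_bounded_support:
  assumes "smooth1 f" and "\<And>x. x \<notin> {p..q} \<Longrightarrow> f x = 0"
  obtains C where "C > 0" "\<And>x. \<bar>f x\<bar> \<le> C"
proof -
  have "compact (f ` {p..q})"
    by (intro compact_continuous_image smooth1_continuous assms(1)) auto
  then obtain C where "C > 0" "\<forall>y \<in> f ` {p..q}. norm y \<le> C"
    using compact_imp_bounded bounded_pos by metis
  then show ?thesis using assms(2) by (intro that[of C]) force+
qed

lemma step_derivs_bounded:
  obtains C where "C > 0" "\<And>x. \<bar>deriv step x\<bar> \<le> C" "\<And>x. \<bar>deriv (deriv step) x\<bar> \<le> C"
proof -
  obtain C where C: "C > 0" "\<And>x. \<bar>deriv step x\<bar> \<le> C"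
    by (rule smooth1_bounded_support[of "deriv step" 1 2])
       (auto intro: smooth1_smooth_deriv smooth1_step deriv_step_0)
  obtain D where D: "D > 0" "\<And>x. \<bar>deriv (deriv step) x\<bar> \<le> D"
    by (rule smooth1_bounded_support[of "deriv (deriv step)" 1 2])
       (auto intro: smooth1_smooth_deriv smooth1_step deriv2_step_0)
  show ?thesis using C D by (intro that[of "max C D"]) (auto simp: le_max_iff_disj)
qed

section \<open>Test functions of product form\<close>

text \<open>A partial derivative acts on one factor only, so iterated partial derivatives of such
  products are again products, and \<open>smooth\<close> reduces to smoothness in one
  variable.\<close>

definition tensor :: "(3 \<Rightarrow> real \<Rightarrow> real) \<Rightarrow> real^3 \<Rightarrow> real" where
  "tensor F x = (\<Prod>i\<in>UNIV. F i (x $ i))"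

lemma tensor_split: "tensor F x = F i (x $ i) * (\<Prod>j\<in>-{i}. F j (x $ j))"
proof -
  have "tensor F x = (\<Prod>j\<in>insert i (-{i}). F j (x $ j))"
    unfolding tensor_def by (rule prod.cong) auto
  then show ?thesis by simp
qed

lemma tensor_upd: "tensor (F(i := g)) x = g (x $ i) * (\<Prod>j\<in>-{i}. F j (x $ j))"
  by (subst tensor_split[of _ _ i]) (auto intro!: prod.cong)

lemma partial_tensor:
  assumes "smooth1 (F i)"
  shows "partial i (tensor F) = tensor (F(i := deriv (F i)))"
proof
  fix x
  have *: "tensor F (x + s *\<^sub>R axis i 1) = F i (x $ i + s) * (\<Prod>j\<in>-{i}. F j (x $ j))" for s
    by (subst tensor_split[of _ _ i]) (auto intro!: prod.cong simp: axis_def)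
  have "((\<lambda>s. F i (x $ i + s)) has_real_derivative deriv (F i) (x $ i)) (at 0)"
    using DERIV_shift[of "F i" "deriv (F i) (x $ i)" 0 "x $ i"] smooth1_deriv[OF assms]
    by (simp add: add.commute)
  then have "((\<lambda>s. F i (x $ i + s) * (\<Prod>j\<in>-{i}. F j (x $ j))) has_real_derivative
      deriv (F i) (x $ i) * (\<Prod>j\<in>-{i}. F j (x $ j))) (at 0)"
    by (rule DERIV_cmult_right)
  then show "partial i (tensor F) x = tensor (F(i := deriv (F i))) x"
    unfolding partial_def * by (simp add: DERIV_imp_deriv tensor_upd)
qed

lemma tensor_differentiable:
  assumes "\<And>i. smooth1 (F i)"
  shows "tensor F differentiable_on UNIV"
proof -
  have c: "((\<lambda>x::real^3. F i (x $ i)) has_derivative (\<lambda>h. h $ i * deriv (F i) (x $ i))) (at x)" for i x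
  proof -
    have "(F i has_derivative (\<lambda>h. h * deriv (F i) (x $ i))) (at (x $ i))"
      using smooth1_deriv[OF assms, of i "x $ i"] by (simp only: has_field_derivative_def mult_commute_abs)
    from has_derivative_compose[OF bounded_linear.has_derivative[OF bounded_linear_vec_nth has_derivative_ident] this]
    show ?thesis by simp
  qed
  have "(\<lambda>x. \<Prod>i\<in>I. F i (x $ i)) differentiable at x" if "finite I" for I x
    using that
  proof (induction I)
    case (insert i I)
    have "(\<lambda>x. F i (x $ i)) differentiable at x" using c unfolding differentiable_def by blast
    from differentiable_mult[OF this insert.IH] insert.hyps show ?case by simp
  qed auto
  then show ?thesis
    unfolding tensor_def[abs_def] differentiable_on_def by simp
qed

lemma foldr_partial_tensor:
  assumes "\<And>i. smooth1 (F i)"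
  shows "\<exists>G. (\<forall>i. smooth1 (G i)) \<and> foldr partial is (tensor F) = tensor G"
proof (induction "is")
  case Nil then show ?case using assms by auto
next
  case (Cons i "is")
  then obtain G where G: "\<forall>i. smooth1 (G i)" "foldr partial is (tensor F) = tensor G" by blast
  have "foldr partial (i # is) (tensor F) = tensor (G(i := deriv (G i)))"
    using G by (simp add: partial_tensor)
  moreover have "\<forall>j. smooth1 ((G(i := deriv (G i))) j)"
    using G by (simp add: smooth1_smooth_deriv)
  ultimately show ?case by blast
qed

lemma smooth_tensor: "(\<And>i. smooth1 (F i)) \<Longrightarrow> smooth (tensor F)"
  unfolding smooth_def
proof
  fix "is" assume "\<And>i. smooth1 (F i)"
  from foldr_partial_tensor[of F "is", OF this] obtain G
    where "\<forall>i. smooth1 (G i)" "foldr partial is (tensor F) = tensor G" by blast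
  then show "foldr partial is (tensor F) differentiable_on UNIV" using tensor_differentiable[of G] by simp
qed

lemma partial_power_tensor:
  assumes "\<And>i. smooth1 (F i)"
  shows "(partial i ^^ n) (tensor F) = tensor (F(i := (deriv ^^ n) (F i)))"
proof (induction n)
  case (Suc n)
  have "smooth1 ((F(i := (deriv ^^ n) (F i))) i)" using assms by (simp add: smooth1_higher_deriv)
  from partial_tensor[of "F(i := (deriv ^^ n) (F i))" i, OF this] show ?case
    by (simp only: funpow.simps o_apply Suc fun_upd_same fun_upd_upd)
qed simp

lemma partials_tensor:
  assumes "\<And>i. smooth1 (F i)"
  shows "partials \<beta> (tensor F) = tensor (\<lambda>i. (deriv ^^ \<beta> i) (F i))"
proof -
  let ?G = "F(3 := (deriv ^^ \<beta> 3) (F 3))"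
  let ?H = "?G(2 := (deriv ^^ \<beta> 2) (?G 2))"
  have G: "smooth1 (?G i)" for i using assms by (simp add: smooth1_higher_deriv)
  have H: "smooth1 (?H i)" for i using G[of i] smooth1_higher_deriv[OF G[of 2]] by simp
  have "partials \<beta> (tensor F) = tensor (?H(1 := (deriv ^^ \<beta> 1) (?H 1)))"
    unfolding partials_def partial_power_tensor[OF assms] partial_power_tensor[OF G]
      partial_power_tensor[OF H] ..
  also have "?H(1 := (deriv ^^ \<beta> 1) (?H 1)) = (\<lambda>i. (deriv ^^ \<beta> i) (F i))"
    using exhaust_3 by (auto simp: fun_eq_iff)
  finally show ?thesis .
qed

text \<open>One box inside \<open>S\<close> serves all factors, which makes the product a test
  function. The vanishing is required of each factor separately, so that the class survives
  replacing a factor by its derivative.\<close>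

definition tensor_test :: "(real^3) set \<Rightarrow> (3 \<Rightarrow> real \<Rightarrow> real) \<Rightarrow> bool" where
  "tensor_test S F \<longleftrightarrow> (\<forall>i. smooth1 (F i)) \<and>
     (\<exists>p q. cbox p q \<subseteq> S \<and> (\<forall>i x. x \<notin> {p$i..q$i} \<longrightarrow> F i x = 0))"

lemma tensor_test_test_function:
  assumes "tensor_test S F"
  shows "test_function S (tensor F)"
proof -
  obtain p q where F: "\<And>i. smooth1 (F i)" "cbox p q \<subseteq> S" "\<And>i x. x \<notin> {p$i..q$i} \<Longrightarrow> F i x = 0"
    using assms unfolding tensor_test_def by blast
  have "tensor F x = 0" if x: "x \<notin> cbox p q" for x
  proof -
    obtain i where "x $ i \<notin> {p$i..q$i}" using x by (auto simp: mem_box_cart)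
    then show ?thesis using F(3) by (auto simp: tensor_split[of _ _ i])
  qed
  with F show ?thesis unfolding test_function_def
    by (intro conjI smooth_tensor exI[of _ "cbox p q"]) auto
qed

lemma deriv_support:
  assumes "\<And>x. x \<notin> {p..q} \<Longrightarrow> f x = 0" "x \<notin> {p..q::real}"
  shows "deriv f x = (0::real)"
proof (rule DERIV_imp_deriv)
  show "(f has_real_derivative 0) (at x)"
    by (rule has_field_derivative_transform_within_open[of "\<lambda>x. 0" _ _ "- {p..q}"]) (use assms in auto)
qed

lemma tensor_test_deriv:
  assumes "tensor_test S F"
  shows "tensor_test S (F(i := deriv (F i)))"
proof -
  obtain p q where F: "\<And>i. smooth1 (F i)" "cbox p q \<subseteq> S" "\<And>i x. x \<notin> {p$i..q$i} \<Longrightarrow> F i x = 0"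
    using assms unfolding tensor_test_def by blast
  have "(F(i := deriv (F i))) j x = 0" if "x \<notin> {p$j..q$j}" for j x
    using deriv_support[of "p$j" "q$j" "F j" x] F(3)[of _ j] that by (cases "j = i") auto
  with F show ?thesis unfolding tensor_test_def
    by (intro conjI exI[of _ p] exI[of _ q]) (auto intro: smooth1_smooth_deriv)
qed

lemma tensor_continuous:
  assumes "\<And>i. smooth1 (F i)" shows "continuous_on S (tensor F)"
  by (rule continuous_on_subset[OF differentiable_imp_continuous_on[OF tensor_differentiable[OF assms]] subset_UNIV])

lemma tensor_measurable [measurable]:
  assumes "\<And>i. smooth1 (F i)" shows "tensor F \<in> borel_measurable borel"
  by (intro borel_measurable_continuous_onI tensor_continuous assms)

lemma tensor_test_bounded:
  assumes "tensor_test S F"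
  obtains C p q where "C > 0" "cbox p q \<subseteq> S" "\<And>x. \<bar>tensor F x\<bar> \<le> C * indicator (cbox p q) x"
proof -
  obtain p q where F: "\<And>i. smooth1 (F i)" "cbox p q \<subseteq> S" "\<And>i x. x \<notin> {p$i..q$i} \<Longrightarrow> F i x = 0"
    using assms unfolding tensor_test_def by blast
  have "compact (tensor F ` cbox p q)"
    by (intro compact_continuous_image tensor_continuous F) auto
  then obtain C where C: "C > 0" "\<forall>y \<in> tensor F ` cbox p q. norm y \<le> C"
    using compact_imp_bounded bounded_pos by metis
  have "tensor F x = 0" if x: "x \<notin> cbox p q" for x
  proof -
    obtain i where "x $ i \<notin> {p$i..q$i}" using x by (auto simp: mem_box_cart)
    then show ?thesis using F(3) by (auto simp: tensor_split[of _ _ i])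
  qed
  with C F(2) show ?thesis by (intro that[of C p q]) (auto simp: indicator_def)
qed

section \<open>Square integrable functions and their time derivatives\<close>

definition L2 :: "'a measure \<Rightarrow> ('a \<Rightarrow> real) set" where
  "L2 M = {f \<in> borel_measurable M. integrable M (\<lambda>x. (f x)\<^sup>2)}"

definition L2norm :: "'a measure \<Rightarrow> ('a \<Rightarrow> real) \<Rightarrow> real" where
  "L2norm M f = sqrt (\<integral>x. (f x)\<^sup>2 \<partial>M)"

lemma L2_measurable [measurable_dest]: "f \<in> L2 M \<Longrightarrow> f \<in> borel_measurable M"
  by (simp add: L2_def)

lemma L2_integrable_power2: "f \<in> L2 M \<Longrightarrow> integrable M (\<lambda>x. (f x)\<^sup>2)"
  by (simp add: L2_def)

lemma L2norm_nonneg: "L2norm M f \<ge> 0"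
  by (simp add: L2norm_def)

lemma L2norm_power2: "(L2norm M f)\<^sup>2 = (\<integral>x. (f x)\<^sup>2 \<partial>M)"
  by (simp add: L2norm_def)

lemma L2_mult_integrable:
  assumes f: "f \<in> L2 M" and g: "g \<in> L2 M"
  shows "integrable M (\<lambda>x. f x * g x)"
proof (rule Bochner_Integration.integrable_bound)
  show "integrable M (\<lambda>x. (f x)\<^sup>2 + (g x)\<^sup>2)"
    using assms by (intro Bochner_Integration.integrable_add L2_integrable_power2)
  show "(\<lambda>x. f x * g x) \<in> borel_measurable M" using f g by measurable
  have "\<bar>a * b\<bar> \<le> a\<^sup>2 + b\<^sup>2" for a b :: real
  proof -
    have "2 * (\<bar>a\<bar> * \<bar>b\<bar>) \<le> a\<^sup>2 + b\<^sup>2"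
      using sum_squares_bound[of "\<bar>a\<bar>" "\<bar>b\<bar>"] by (simp add: mult.assoc)
    moreover have "0 \<le> \<bar>a\<bar> * \<bar>b\<bar>" by simp
    ultimately show ?thesis unfolding abs_mult by linarith
  qed
  then show "AE x in M. norm (f x * g x) \<le> norm ((f x)\<^sup>2 + (g x)\<^sup>2)"
    by (auto intro!: AE_I2)
qed

lemma L2_cmult: "f \<in> L2 M \<Longrightarrow> (\<lambda>x. c * f x) \<in> L2 M"
  by (auto simp: L2_def power_mult_distrib)

lemma L2_add:
  assumes f: "f \<in> L2 M" and g: "g \<in> L2 M"
  shows "(\<lambda>x. f x + g x) \<in> L2 M"
proof -
  have "integrable M (\<lambda>x. (f x)\<^sup>2 + (g x)\<^sup>2 + 2 * (f x * g x))"
    using L2_mult_integrable[OF assms] assms by (auto simp: L2_def)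
  then show ?thesis using assms by (auto simp: L2_def power2_sum mult.assoc)
qed

lemma L2_diff: "f \<in> L2 M \<Longrightarrow> g \<in> L2 M \<Longrightarrow> (\<lambda>x. f x - g x) \<in> L2 M"
  using L2_add[OF _ L2_cmult[of g M "-1"]] by simp

lemma L2_bounded_mult:
  assumes f: "f \<in> L2 M" and m: "m \<in> borel_measurable M" and b: "\<And>x. x \<in> space M \<Longrightarrow> \<bar>m x\<bar> \<le> B"
  shows "(\<lambda>x. f x * m x) \<in> L2 M"
proof -
  have "integrable M (\<lambda>x. (f x * m x)\<^sup>2)"
  proof (rule Bochner_Integration.integrable_bound)
    show "integrable M (\<lambda>x. B\<^sup>2 * (f x)\<^sup>2)" using f by (auto simp: L2_def)
    show "(\<lambda>x. (f x * m x)\<^sup>2) \<in> borel_measurable M" using f m by measurable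
    show "AE x in M. norm ((f x * m x)\<^sup>2) \<le> norm (B\<^sup>2 * (f x)\<^sup>2)"
    proof (rule AE_I2)
      fix x assume "x \<in> space M"
      then have "(m x)\<^sup>2 \<le> B\<^sup>2" using b[of x] by (metis abs_ge_zero power_mono power2_abs)
      from mult_left_mono[OF this, of "(f x)\<^sup>2"]
      show "norm ((f x * m x)\<^sup>2) \<le> norm (B\<^sup>2 * (f x)\<^sup>2)"
        by (simp add: power_mult_distrib mult.commute)
    qed
  qed
  then show ?thesis using f m by (auto simp: L2_def)
qed

lemma L2_cong_AE:
  assumes "f \<in> L2 M" "g \<in> borel_measurable M" "AE x in M. f x = g x"
  shows "g \<in> L2 M"
proof -
  have "integrable M (\<lambda>x. (f x)\<^sup>2) \<longleftrightarrow> integrable M (\<lambda>x. (g x)\<^sup>2)"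
    using assms by (intro integrable_cong_AE) auto
  then show ?thesis using assms by (auto simp: L2_def)
qed

lemma L2norm_cong_AE:
  assumes "f \<in> borel_measurable M" "g \<in> borel_measurable M" "AE x in M. f x = g x"
  shows "L2norm M f = L2norm M g"
  unfolding L2norm_def using assms by (intro arg_cong[of _ _ sqrt] integral_cong_AE) auto

text \<open>The quadratic a - 2 k c + k^2 b in k is the integral of (f - k g)^2 and hence
  nonnegative; its value at the minimum k = c / b gives c^2 \<le> a b.\<close>

lemma L2_Cauchy_Schwarz:
  assumes f: "f \<in> L2 M" and g: "g \<in> L2 M"
  shows "\<bar>\<integral>x. f x * g x \<partial>M\<bar> \<le> L2norm M f * L2norm M g"
proof -
  define a b c where "a = (\<integral>x. (f x)\<^sup>2 \<partial>M)" "b = (\<integral>x. (g x)\<^sup>2 \<partial>M)" "c = (\<integral>x. f x * g x \<partial>M)"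
  have ab: "a \<ge> 0" "b \<ge> 0" by (auto simp: a_b_c_def)
  have "0 \<le> a - 2 * k * c + k\<^sup>2 * b" for k
  proof -
    have "0 \<le> (\<integral>x. (f x - k * g x)\<^sup>2 \<partial>M)" by simp
    also have "\<dots> = (\<integral>x. (f x)\<^sup>2 - 2 * k * (f x * g x) + k\<^sup>2 * (g x)\<^sup>2 \<partial>M)"
      by (intro Bochner_Integration.integral_cong) (auto simp: power2_eq_square algebra_simps)
    also have "\<dots> = a - 2 * k * c + k\<^sup>2 * b"
      using L2_mult_integrable[OF assms] f g by (simp add: a_b_c_def L2_def)
    finally show ?thesis .
  qed
  note q = this
  have "c\<^sup>2 \<le> a * b"
  proof (cases "b = 0")
    case True
    have "c = 0"
    proof (rule ccontr)
      assume "c \<noteq> 0"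
      \<comment> \<open>With b = 0 the quadratic is affine in k, and this k gives it the value a -
        (a + 1) = -1.\<close>
      then have "2 * ((a + 1) / (2 * c)) * c = a + 1" by simp
      with q[of "(a + 1) / (2 * c)"] True show False by simp
    qed
    with True show ?thesis by simp
  next
    case False
    with ab have "b > 0" by simp
    then have "2 * (c / b) * c = 2 * (c\<^sup>2 / b)" "(c / b)\<^sup>2 * b = c\<^sup>2 / b"
      by (simp_all add: power2_eq_square)
    with q[of "c / b"] have "c\<^sup>2 / b \<le> a" by linarith
    with \<open>b > 0\<close> show ?thesis by (simp add: pos_divide_le_eq)
  qed
  then have "sqrt (c\<^sup>2) \<le> sqrt (a * b)" by (rule real_sqrt_le_mono)
  then show ?thesis by (simp add: a_b_c_def L2norm_def real_sqrt_mult)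
qed

lemma L2norm_triangle:
  assumes f: "f \<in> L2 M" and g: "g \<in> L2 M"
  shows "L2norm M (\<lambda>x. f x + g x) \<le> L2norm M f + L2norm M g"
proof (rule power2_le_imp_le)
  have "(L2norm M (\<lambda>x. f x + g x))\<^sup>2 = (\<integral>x. (f x)\<^sup>2 + (g x)\<^sup>2 + 2 * (f x * g x) \<partial>M)"
    by (simp add: L2norm_power2 power2_sum mult.assoc)
  also have "\<dots> = (L2norm M f)\<^sup>2 + (L2norm M g)\<^sup>2 + 2 * (\<integral>x. f x * g x \<partial>M)"
    using L2_mult_integrable[OF assms] f g by (simp add: L2norm_power2 L2_def)
  also have "\<dots> \<le> (L2norm M f + L2norm M g)\<^sup>2"
    using L2_Cauchy_Schwarz[OF assms] by (simp add: power2_sum)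
  finally show "(L2norm M (\<lambda>x. f x + g x))\<^sup>2 \<le> (L2norm M f + L2norm M g)\<^sup>2" .
  show "0 \<le> L2norm M f + L2norm M g" by (simp add: L2norm_nonneg)
qed

text \<open>Differentiability in norm on [0, \<infinity>), one-sided at 0. This is what every weak
  derivative of a solution that is global in time provides.\<close>

definition C1_L2 :: "'a measure \<Rightarrow> (real \<Rightarrow> 'a \<Rightarrow> real) \<Rightarrow> (real \<Rightarrow> 'a \<Rightarrow> real) \<Rightarrow> bool" where
  "C1_L2 M V V' \<longleftrightarrow> (\<forall>t\<ge>0. V t \<in> L2 M \<and> V' t \<in> L2 M \<and>
     ((\<lambda>s. L2norm M (\<lambda>x. (V s x - V t x) / (s - t) - V' t x)) \<longlongrightarrow> 0) (at t within {0..}))"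

lemma C1_L2_quotient:
  assumes "C1_L2 M V V'" "t \<ge> 0" "s \<ge> 0"
  shows "(\<lambda>x. (V s x - V t x) / (s - t) - V' t x) \<in> L2 M"
proof -
  have "(\<lambda>x. inverse (s - t) * (V s x - V t x) - V' t x) \<in> L2 M"
    using assms by (intro L2_diff L2_cmult) (auto simp: C1_L2_def)
  then show ?thesis by (simp add: divide_inverse mult.commute)
qed

text \<open>Pairing with a fixed \<open>p\<close> is a continuous linear functional: by
  Cauchy-Schwarz the error of its difference quotient is at most \<open>L2norm M p\<close> times
  that of \<open>V\<close>.\<close>

lemma C1_L2_pairing_deriv:
  assumes V: "C1_L2 M V V'" and p: "p \<in> L2 M" and t: "t \<ge> 0"
  shows "((\<lambda>t. \<integral>x. V t x * p x \<partial>M) has_real_derivative (\<integral>x. V' t x * p x \<partial>M)) (at t within {0..})"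
proof -
  define q where "q s = (\<lambda>x. (V s x - V t x) / (s - t) - V' t x)" for s
  have q0: "((\<lambda>s. L2norm M (q s)) \<longlongrightarrow> 0) (at t within {0..})"
    using V t by (simp add: C1_L2_def q_def)
  have V2: "V s \<in> L2 M" "V' s \<in> L2 M" if "s \<ge> 0" for s using V that by (auto simp: C1_L2_def)
  have eq: "((\<integral>x. V s x * p x \<partial>M) - (\<integral>x. V t x * p x \<partial>M)) / (s - t) - (\<integral>x. V' t x * p x \<partial>M)
      = (\<integral>x. q s x * p x \<partial>M)" if "s \<ge> 0" for s
  proof -
    have "(\<integral>x. q s x * p x \<partial>M) = (\<integral>x. inverse (s - t) * (V s x * p x - V t x * p x) - V' t x * p x \<partial>M)"
      by (simp add: q_def divide_inverse algebra_simps)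
    also have "\<dots> = inverse (s - t) * ((\<integral>x. V s x * p x \<partial>M) - (\<integral>x. V t x * p x \<partial>M)) - (\<integral>x. V' t x * p x \<partial>M)"
      using V2[OF that] V2[OF t] p by (simp add: L2_mult_integrable)
    finally show ?thesis by (simp add: divide_inverse mult.commute)
  qed
  have "((\<lambda>s. ((\<integral>x. V s x * p x \<partial>M) - (\<integral>x. V t x * p x \<partial>M)) / (s - t) - (\<integral>x. V' t x * p x \<partial>M)) \<longlongrightarrow> 0)
      (at t within {0..})"
  proof (rule Lim_null_comparison)
    show "\<forall>\<^sub>F s in at t within {0..}. norm (((\<integral>x. V s x * p x \<partial>M) - (\<integral>x. V t x * p x \<partial>M)) / (s - t)
        - (\<integral>x. V' t x * p x \<partial>M)) \<le> L2norm M (q s) * L2norm M p"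
      unfolding eventually_at_filter
    proof (rule always_eventually, intro allI impI)
      fix s :: real assume "s \<in> {0..}"
      then have "s \<ge> 0" by simp
      then show "norm (((\<integral>x. V s x * p x \<partial>M) - (\<integral>x. V t x * p x \<partial>M)) / (s - t)
        - (\<integral>x. V' t x * p x \<partial>M)) \<le> L2norm M (q s) * L2norm M p"
        unfolding eq[OF \<open>s \<ge> 0\<close>] real_norm_def
        by (intro L2_Cauchy_Schwarz p) (use C1_L2_quotient[OF V t] in \<open>simp add: q_def\<close>)
    qed
    show "((\<lambda>s. L2norm M (q s) * L2norm M p) \<longlongrightarrow> 0) (at t within {0..})"
      by (rule tendsto_mult_left_zero[OF q0])
  qed
  then show ?thesis unfolding has_field_derivative_iff by (subst Lim_null)
qed

text \<open>The mean value theorem writes the increment with the slope at a point z no farther from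
  a than b is; the Lipschitz bound compares that slope with the one at a. No second derivative is
  involved.\<close>

lemma Lipschitz_deriv_remainder:
  fixes F F' :: "real \<Rightarrow> real"
  assumes F: "\<And>y. (F has_real_derivative F' y) (at y)" and L: "\<And>y z. \<bar>F' y - F' z\<bar> \<le> L * \<bar>y - z\<bar>"
  shows "\<bar>F b - F a - F' a * (b - a)\<bar> \<le> L * (b - a)\<^sup>2"
proof -
  have L0: "L \<ge> 0" using L[of 1 0] by simp
  have "\<exists>z. \<bar>z - a\<bar> \<le> \<bar>b - a\<bar> \<and> F b - F a = F' z * (b - a)"
  proof -
    consider "a < b" | "b < a" | "a = b" by linarith
    then show ?thesis
    proof cases
      case 1
      from MVT2[OF this, of F F'] F obtain z where "a < z" "z < b" "F b - F a = (b - a) * F' z" by auto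
      then show ?thesis by (intro exI[of _ z]) (auto simp: algebra_simps)
    next
      case 2
      from MVT2[OF this, of F F'] F obtain z where "b < z" "z < a" "F a - F b = (a - b) * F' z" by auto
      then show ?thesis by (intro exI[of _ z]) (auto simp: algebra_simps)
    qed auto
  qed
  then obtain z where z: "\<bar>z - a\<bar> \<le> \<bar>b - a\<bar>" "F b - F a = F' z * (b - a)" by blast
  have "\<bar>F b - F a - F' a * (b - a)\<bar> = \<bar>F' z - F' a\<bar> * \<bar>b - a\<bar>"
    using z(2) by (simp add: abs_mult[symmetric] algebra_simps)
  also have "\<dots> \<le> (L * \<bar>b - a\<bar>) * \<bar>b - a\<bar>"
    using L[of z a] mult_left_mono[OF z(1) L0] by (intro mult_right_mono) auto
  finally show ?thesis by (simp add: power2_eq_square mult.assoc abs_mult_self_eq)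
qed

text \<open>Chain rule for an integral functional along an L2-valued curve. Since F' is Lipschitz,
  the Taylor remainder is quadratic in the increment, and after division by s - t its integral is of
  order |s - t|. The assumption \<open>F0\<close> gives |F' y| \<le> L |y|, which puts
  \<open>F' (V t x)\<close> into L2; F itself may be nonzero at 0, so the integrability of the
  functional is an assumption of its own. It serves for the square and for the regularised
  logarithm.\<close>

lemma C1_L2_chain_deriv:
  assumes V: "C1_L2 M V V'" and t: "t \<ge> 0"
    and F: "\<And>y. (F has_real_derivative F' y) (at y)" and L: "\<And>y z. \<bar>F' y - F' z\<bar> \<le> L * \<bar>y - z\<bar>"
    and F0: "F' 0 = 0"
    and m: "m \<in> borel_measurable M" "\<And>x. x \<in> space M \<Longrightarrow> \<bar>m x\<bar> \<le> B"
    and int: "\<And>t. t \<ge> 0 \<Longrightarrow> integrable M (\<lambda>x. F (V t x) * m x)"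
  shows "((\<lambda>t. \<integral>x. F (V t x) * m x \<partial>M) has_real_derivative (\<integral>x. F' (V t x) * V' t x * m x \<partial>M))
    (at t within {0..})"
proof -
  have V2: "V s \<in> L2 M" "V' s \<in> L2 M" if "s \<ge> 0" for s using V that by (auto simp: C1_L2_def)
  note [measurable] = V2(1)[THEN L2_measurable] V2(2)[THEN L2_measurable] m(1)
  have F'c: "continuous_on UNIV F'"
  proof (rule continuous_at_imp_continuous_on, rule ballI)
    fix y show "isCont F' y" unfolding isCont_def
    proof (subst Lim_null, rule Lim_null_comparison)
      show "\<forall>\<^sub>F z in at y. norm (F' z - F' y) \<le> L * \<bar>z - y\<bar>" using L by simp
      show "(\<lambda>z. L * \<bar>z - y\<bar>) \<midarrow>y\<rightarrow> 0" by (auto intro!: tendsto_eq_intros)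
    qed
  qed
  have Fc: "continuous_on UNIV F" using F DERIV_isCont by (blast intro: continuous_at_imp_continuous_on)
  note [measurable] = borel_measurable_continuous_onI[OF F'c] borel_measurable_continuous_onI[OF Fc]
  have L0: "L \<ge> 0" using L[of 1 0] by simp
  define D where "D x = F' (V t x) * m x" for x
  have D: "D \<in> L2 M"
  proof -
    have "(\<lambda>x. F' (V t x)) \<in> L2 M"
    proof -
      have "integrable M (\<lambda>x. (F' (V t x))\<^sup>2)"
      proof (rule Bochner_Integration.integrable_bound)
        show "integrable M (\<lambda>x. L\<^sup>2 * (V t x)\<^sup>2)" using V2(1)[OF t] by (auto simp: L2_def)
        show "(\<lambda>x. (F' (V t x))\<^sup>2) \<in> borel_measurable M" using t by measurable
        have "(F' y)\<^sup>2 \<le> L\<^sup>2 * y\<^sup>2" for y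
        proof -
          have "\<bar>F' y\<bar> \<le> L * \<bar>y\<bar>" using L[of y 0] F0 by simp
          then have "\<bar>F' y\<bar>\<^sup>2 \<le> (L * \<bar>y\<bar>)\<^sup>2" by (intro power_mono) auto
          then show ?thesis by (simp add: power_mult_distrib)
        qed
        then show "AE x in M. norm ((F' (V t x))\<^sup>2) \<le> norm (L\<^sup>2 * (V t x)\<^sup>2)" by (auto intro!: AE_I2)
      qed
      then show ?thesis using t by (auto simp: L2_def)
    qed
    then show ?thesis unfolding D_def by (rule L2_bounded_mult[OF _ m]) auto
  qed
  define q where "q s = (\<lambda>x. (V s x - V t x) / (s - t) - V' t x)" for s
  have q2: "q s \<in> L2 M" if "s \<ge> 0" for s using C1_L2_quotient[OF V t that] by (simp add: q_def)
  have q0: "((\<lambda>s. L2norm M (q s)) \<longlongrightarrow> 0) (at t within {0..})"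
    using V t by (simp add: C1_L2_def q_def)
  define J where "J s = (\<integral>x. F (V s x) * m x \<partial>M)" for s
  define N where "N = L2norm M (V' t)"
  \<comment> \<open>The first summand bounds the Taylor remainder, since V s - V t is s - t times
    \<open>q s\<close> + V' t; the second one bounds the linear part by Cauchy-Schwarz.\<close>
  define E where "E s = \<bar>s - t\<bar> * (L * B * (L2norm M (q s) + N)\<^sup>2) + L2norm M (q s) * L2norm M D" for s
  have main: "\<bar>(J s - J t) / (s - t) - (\<integral>x. D x * V' t x \<partial>M)\<bar> \<le> E s" if s: "s \<ge> 0" "s \<noteq> t" for s
  proof -
    define R where "R x = (F (V s x) - F (V t x) - F' (V t x) * (V s x - V t x)) * m x / (s - t)" for x
    have dV: "(\<lambda>x. V s x - V t x) \<in> L2 M" using V2 s t by (intro L2_diff) auto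
    have DV: "integrable M (\<lambda>x. D x * (V s x - V t x))" by (rule L2_mult_integrable[OF D dV])
    have Ri: "integrable M R"
    proof -
      have "integrable M (\<lambda>x. (F (V s x) * m x - F (V t x) * m x - D x * (V s x - V t x)) / (s - t))"
        using int s t DV by (intro integrable_divide_zero Bochner_Integration.integrable_diff) auto
      then show ?thesis by (simp add: R_def[abs_def] D_def algebra_simps)
    qed
    have eq: "(F (V s x) * m x - F (V t x) * m x) / (s - t) - D x * V' t x = R x + D x * q s x" for x
      by (simp add: R_def D_def q_def divide_inverse algebra_simps)
    have "(J s - J t) / (s - t) - (\<integral>x. D x * V' t x \<partial>M)
        = (\<integral>x. (F (V s x) * m x - F (V t x) * m x) / (s - t) - D x * V' t x \<partial>M)"
      using int s t L2_mult_integrable[OF D V2(2)[OF t]] by (simp add: J_def)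
    also have "\<dots> = (\<integral>x. R x \<partial>M) + (\<integral>x. D x * q s x \<partial>M)"
      unfolding eq using Ri L2_mult_integrable[OF D q2] s by simp
    finally have "\<bar>(J s - J t) / (s - t) - (\<integral>x. D x * V' t x \<partial>M)\<bar>
        \<le> \<bar>\<integral>x. R x \<partial>M\<bar> + \<bar>\<integral>x. D x * q s x \<partial>M\<bar>" by linarith
    moreover have "\<bar>\<integral>x. D x * q s x \<partial>M\<bar> \<le> L2norm M (q s) * L2norm M D"
      using L2_Cauchy_Schwarz[OF D q2] s by (simp add: mult.commute)
    moreover have "\<bar>\<integral>x. R x \<partial>M\<bar> \<le> \<bar>s - t\<bar> * (L * B * (L2norm M (q s) + N)\<^sup>2)"
    proof -
      define c where "c = L * B / \<bar>s - t\<bar>"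
      have "\<bar>\<integral>x. R x \<partial>M\<bar> \<le> (\<integral>x. \<bar>R x\<bar> \<partial>M)" by (rule integral_abs_bound)
      also have "\<dots> \<le> (\<integral>x. c * (V s x - V t x)\<^sup>2 \<partial>M)"
      proof (rule integral_mono)
        fix x assume x: "x \<in> space M"
        have "\<bar>F (V s x) - F (V t x) - F' (V t x) * (V s x - V t x)\<bar> * \<bar>m x\<bar>
            \<le> (L * (V s x - V t x)\<^sup>2) * B"
          using Lipschitz_deriv_remainder[OF F L] m(2)[OF x] L0 by (intro mult_mono) auto
        then show "\<bar>R x\<bar> \<le> c * (V s x - V t x)\<^sup>2"
          by (simp add: R_def c_def abs_mult divide_right_mono mult.commute mult.left_commute)
      qed (use Ri dV in \<open>auto simp: L2_def\<close>)
      also have "\<dots> = c * (L2norm M (\<lambda>x. (s - t) * (q s x + V' t x)))\<^sup>2"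
        using s by (simp add: L2norm_power2 q_def)
      also have "\<dots> = c * ((s - t)\<^sup>2 * (L2norm M (\<lambda>x. q s x + V' t x))\<^sup>2)"
        by (simp add: L2norm_power2 power_mult_distrib)
      also have "\<dots> = \<bar>s - t\<bar> * (L * B * (L2norm M (\<lambda>x. q s x + V' t x))\<^sup>2)"
      proof -
        have "(s - t)\<^sup>2 = \<bar>s - t\<bar> * \<bar>s - t\<bar>" by (simp add: power2_eq_square)
        moreover have "(L * B / e) * ((e * e) * X) = e * (L * B * X)" if "e \<noteq> 0" for e X :: real
          using that by simp
        ultimately show ?thesis using s by (simp only: c_def)
      qed
      also have "\<dots> \<le> \<bar>s - t\<bar> * (L * B * (L2norm M (q s) + N)\<^sup>2)"
      \<comment> \<open>That B \<ge> 0 can be read off the bound on \<open>m\<close> only where the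
        space has a point; over an empty space all norms are 0.\<close>
      proof (cases "space M = {}")
        case True
        have "L2norm M f = 0" for f using True by (simp add: L2norm_def Bochner_Integration.integral_empty)
        then show ?thesis by (simp add: N_def)
      next
        case False
        then have "B \<ge> 0" using m(2) by (meson abs_ge_zero equals0I order_trans)
        then show ?thesis using L0 L2norm_triangle[OF q2 V2(2)[OF t]] s L2norm_nonneg
          by (intro mult_left_mono power_mono) (auto simp: N_def)
      qed
      finally show ?thesis .
    qed
    ultimately show ?thesis by (simp add: E_def)
  qed
  have "((\<lambda>s. (J s - J t) / (s - t) - (\<integral>x. D x * V' t x \<partial>M)) \<longlongrightarrow> 0) (at t within {0..})"
  proof (rule Lim_null_comparison)
    show "\<forall>\<^sub>F s in at t within {0..}. norm ((J s - J t) / (s - t) - (\<integral>x. D x * V' t x \<partial>M)) \<le> E s"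
      unfolding eventually_at_filter using main by (intro always_eventually) auto
    have "((\<lambda>s. \<bar>s - t\<bar>) \<longlongrightarrow> \<bar>t - t\<bar>) (at t within {0..})" by (intro tendsto_intros)
    then have "(E \<longlongrightarrow> \<bar>t - t\<bar> * (L * B * (0 + N)\<^sup>2) + 0 * L2norm M D) (at t within {0..})"
      unfolding E_def by (intro tendsto_intros q0)
    then show "(E \<longlongrightarrow> 0) (at t within {0..})" by simp
  qed
  moreover have "(\<integral>x. D x * V' t x \<partial>M) = (\<integral>x. F' (V t x) * V' t x * m x \<partial>M)"
    by (simp add: D_def mult_ac)
  ultimately show ?thesis
    unfolding has_field_derivative_iff J_def by (subst Lim_null) simp
qed

lemma C1_L2_square_deriv:
  assumes V: "C1_L2 M V V'" and t: "t \<ge> 0"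
    and m: "m \<in> borel_measurable M" "\<And>x. x \<in> space M \<Longrightarrow> \<bar>m x\<bar> \<le> B"
  shows "((\<lambda>t. \<integral>x. (V t x)\<^sup>2 * m x \<partial>M) has_real_derivative (\<integral>x. 2 * V t x * V' t x * m x \<partial>M))
    (at t within {0..})"
proof (rule C1_L2_chain_deriv[OF V t _ _ _ m, of "\<lambda>y. y\<^sup>2" "\<lambda>y. 2 * y" 2])
  show "\<bar>2 * y - 2 * z\<bar> \<le> 2 * \<bar>y - z\<bar>" for y z :: real
    using abs_mult[of 2 "y - z"] by (simp add: right_diff_distrib)
  show "integrable M (\<lambda>x. (V t x)\<^sup>2 * m x)" if "t \<ge> 0" for t
  proof -
    have *: "V t \<in> L2 M" using V that by (simp add: C1_L2_def)
    from L2_mult_integrable[OF * L2_bounded_mult[OF * m]] show ?thesis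
      by (simp add: power2_eq_square mult.assoc)
  qed
qed (auto intro!: derivative_eq_intros)

text \<open>The squared norm is differentiable in time, by the chain rule with weight 1, hence
  continuous, hence bounded on the compact interval [0, T].\<close>

lemma C1_L2_bounded:
  assumes V: "C1_L2 M V V'"
  obtains K where "K \<ge> 0" "\<And>t. 0 \<le> t \<Longrightarrow> t \<le> T \<Longrightarrow> L2norm M (V t) \<le> K"
proof -
  have "continuous_on {0..T} (\<lambda>t. \<integral>x. (V t x)\<^sup>2 * 1 \<partial>M)"
  proof (rule continuous_on_subset[of "{0..}"])
    show "continuous_on {0..} (\<lambda>t. \<integral>x. (V t x)\<^sup>2 * 1 \<partial>M)"
      using C1_L2_square_deriv[OF V, of _ "\<lambda>_. 1" 1] by (intro DERIV_continuous_on) auto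
  qed auto
  then have "compact ((\<lambda>t. \<integral>x. (V t x)\<^sup>2 * 1 \<partial>M) ` {0..T})"
    by (rule compact_continuous_image) auto
  then obtain b where b: "b > 0" "\<forall>y \<in> (\<lambda>t. \<integral>x. (V t x)\<^sup>2 * 1 \<partial>M) ` {0..T}. norm y \<le> b"
    using compact_imp_bounded bounded_pos by metis
  show ?thesis
  proof (rule that[of "sqrt b"])
    show "L2norm M (V t) \<le> sqrt b" if "0 \<le> t" "t \<le> T" for t
      unfolding L2norm_def using b(2) that by (intro real_sqrt_le_mono) force
  qed (use b in auto)
qed

section \<open>The fundamental lemma of the calculus of variations\<close>

lemma borel_measurable_lebesgueI:
  "f \<in> borel_measurable borel \<Longrightarrow> f \<in> borel_measurable lebesgue"
  by (rule measurable_completion) simp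

lemma set_integral_lebesgue_on:
  fixes f :: "'a::euclidean_space \<Rightarrow> real"
  assumes "S \<in> sets lebesgue"
  shows "(LINT x:S|lebesgue. f x) = (\<integral>x. f x \<partial>lebesgue_on S)"
  using assms by (simp add: set_lebesgue_integral_def integral_restrict_space)

lemma set_integrable_lebesgue_on:
  fixes f :: "'a::euclidean_space \<Rightarrow> real"
  assumes "S \<in> sets lebesgue"
  shows "set_integrable lebesgue S f \<longleftrightarrow> integrable (lebesgue_on S) f"
  using assms by (simp add: set_integrable_def integrable_restrict_space)

lemma AE_lebesgue_on_iff:
  assumes "S \<in> sets lebesgue"
  shows "(AE x in lebesgue_on S. P x) \<longleftrightarrow> (AE x in lebesgue. x \<in> S \<longrightarrow> P x)"
  using assms by (subst AE_restrict_space_iff) auto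

lemma L2_on_eq:
  assumes "S \<in> sets lebesgue"
  shows "L2_on S = L2 (lebesgue_on S)"
  using assms unfolding L2_on_def L2_def set_borel_measurable_def
  by (subst borel_measurable_restrict_space_iff) (auto simp: set_integrable_lebesgue_on)

text \<open>Lebesgue measure is complete. This is what makes an arbitrarily chosen weak derivative
  measurable as soon as one measurable weak derivative exists.\<close>

lemma borel_measurable_lebesgue_on_AE:
  fixes f g :: "'a::euclidean_space \<Rightarrow> real"
  assumes S: "S \<in> sets lebesgue" and f: "f \<in> borel_measurable (lebesgue_on S)"
    and ae: "AE x in lebesgue_on S. f x = g x"
  shows "g \<in> borel_measurable (lebesgue_on S)"
proof -
  have "(\<lambda>x. indicator S x *\<^sub>R f x) \<in> borel_measurable lebesgue"
    using f S by (subst (asm) borel_measurable_restrict_space_iff) auto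
  moreover have "AE x in lebesgue. indicator S x *\<^sub>R f x = indicator S x *\<^sub>R g x"
    using ae unfolding AE_lebesgue_on_iff[OF S] by eventually_elim (auto simp: indicator_def)
  ultimately have "(\<lambda>x. indicator S x *\<^sub>R g x) \<in> borel_measurable lebesgue"
    by (rule borel_measurable_AE)
  then show ?thesis using S by (subst borel_measurable_restrict_space_iff) auto
qed

text \<open>Boxes generate the Borel sets and are stable under intersection, so vanishing integrals
  over boxes spread to all Borel sets; the sets where a representative is positive or negative then
  show that it is 0.\<close>

lemma lebesgue_on_eq_0:
  fixes h :: "'a::euclidean_space \<Rightarrow> real"
  assumes h: "integrable lebesgue h" and z: "\<And>p q. (\<integral>x. indicator (box p q) x * h x \<partial>lebesgue) = 0"
    and supp: "\<And>x. x \<notin> box P Q \<Longrightarrow> h x = 0"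
  shows "AE x in lebesgue. h x = 0"
proof -
  have int: "integrable lebesgue (\<lambda>x. indicator A x * h x)" if "A \<in> sets lebesgue" for A
    using integrable_mult_indicator[OF that h] by simp
  have zA: "(\<integral>x. indicator A x * h x \<partial>lebesgue) = 0" if "A \<in> sets borel" for A
  proof -
    let ?G = "range (\<lambda>(a, b). box a b :: 'a set)"
    have A: "A \<in> sigma_sets UNIV ?G" using that by (subst (asm) borel_eq_box) (simp add: sets_measure_of)
    have I: "Int_stable ?G"
      unfolding Int_stable_def by (auto simp: image_iff) (intro exI, rule box_Int_box)
    have "?G \<subseteq> Pow UNIV" by simp
    have sG: "sigma_sets UNIV ?G = sets (borel :: 'a measure)"
      by (subst borel_eq_box) (simp add: sets_measure_of)
    from I \<open>?G \<subseteq> Pow UNIV\<close> A show ?thesis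
    proof (induction rule: sigma_sets_induct_disjoint)
      case (basic A) then show ?case using z by auto
    next
      case (compl A)
      then have A: "A \<in> sets lebesgue" using sG by (simp add: sets_completionI_sets)
      \<comment> \<open>Passing to complements needs the integral over the whole space to vanish; by
        the support condition it is an integral over one box.\<close>
      have "(\<integral>x. h x \<partial>lebesgue) = (\<integral>x. indicator (box P Q) x * h x \<partial>lebesgue)"
        using supp by (intro Bochner_Integration.integral_cong) (auto simp: indicator_def)
      then have "(\<integral>x. h x \<partial>lebesgue) = 0" using z by simp
      moreover have "(\<integral>x. indicator (UNIV - A) x * h x \<partial>lebesgue)
          = (\<integral>x. h x - indicator A x * h x \<partial>lebesgue)"
        by (intro Bochner_Integration.integral_cong) (auto simp: indicator_def)
      ultimately show ?case using compl int[OF A] h by simp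
    next
      case (union A)
      have A: "A i \<in> sets lebesgue" for i
        using union(2) sG by (auto intro!: sets_completionI_sets)
      have "set_integrable lebesgue (\<Union>i. A i) h"
        unfolding set_integrable_def using int[of "\<Union>i. A i"] A by auto
      from lebesgue_integral_countable_add[OF A _ this] union(1,3)
      show ?case by (auto simp: set_lebesgue_integral_def disjoint_family_on_def)
    qed auto
  qed
  \<comment> \<open>\<open>zA\<close> speaks about Borel sets, so the sets of positivity and
    negativity are taken from a Borel representative.\<close>
  from h have "h \<in> borel_measurable (completion lborel)" by simp
  from completion_ex_borel_measurable_real[OF this] obtain h' where h'm: "h' \<in> borel_measurable borel"
    and ae: "AE x in lborel. h x = h' x" by auto
  have h'm': "h' \<in> borel_measurable lebesgue" using h'm by (rule borel_measurable_lebesgueI)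
  have ae: "AE x in lebesgue. h x = h' x" using ae by (rule AE_completion)
  have *: "AE x in lebesgue. indicator {x. c * h' x > 0} x * (c * h' x) = 0" for c :: real
  proof -
    let ?A = "{x. c * h' x > 0}"
    have A: "?A \<in> sets borel" using h'm by measurable
    have i: "integrable lebesgue (\<lambda>x. indicator ?A x * (c * h' x))"
    proof -
      have "integrable lebesgue (\<lambda>x. c * (indicator ?A x * h x))"
        by (rule integrable_mult_right[OF int]) (use A in auto)
      moreover have "AE x in lebesgue. c * (indicator ?A x * h x) = indicator ?A x * (c * h' x)"
        using ae by eventually_elim auto
      moreover have "(\<lambda>x. indicator ?A x * (c * h' x)) \<in> borel_measurable lebesgue"
        by (intro borel_measurable_lebesgueI borel_measurable_times borel_measurable_indicator A
            borel_measurable_const h'm)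
      ultimately show ?thesis
        by - (rule integrable_cong_AE_imp)
    qed
    have "(\<integral>x. indicator ?A x * (c * h' x) \<partial>lebesgue) = (\<integral>x. c * (indicator ?A x * h x) \<partial>lebesgue)"
    proof (rule integral_cong_AE)
      show "(\<lambda>x. c * (indicator ?A x * h x)) \<in> borel_measurable lebesgue"
        by (rule borel_measurable_integrable, rule integrable_mult_right[OF int]) (use A in auto)
      show "AE x in lebesgue. indicator ?A x * (c * h' x) = c * (indicator ?A x * h x)"
        using ae by eventually_elim auto
    qed (use i in auto)
    also have "\<dots> = 0" using zA[OF A] by simp
    finally show ?thesis using i
      by (subst (asm) integral_nonneg_eq_0_iff_AE) (auto simp: indicator_def)
  qed
  from *[of 1] *[of "-1"] ae show ?thesis
    by eventually_elim (auto simp: indicator_def split: if_splits)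
qed

lemma tensor_test_bump:
  assumes "cbox p q \<subseteq> S"
  shows "tensor_test S (\<lambda>i y. step (real n * (y - p$i)) * step (real n * (q$i - y)))"
proof -
  have 1: "smooth1 (\<lambda>y. step (real n * y + (- real n * p$i)) * step ((- real n) * y + real n * q$i))" for i
    by (intro smooth1_mult smooth1_affine smooth1_step)
  have 2: "step (real n * (y - p$i)) * step (real n * (q$i - y)) = 0" if "y \<notin> {p$i..q$i}" for y i
  proof -
    from that have "real n * (y - p$i) \<le> 0 \<or> real n * (q$i - y) \<le> 0"
    by (auto simp: mult_le_0_iff)
    then show ?thesis by (auto simp: step_0)
  qed
  show ?thesis unfolding tensor_test_def
    by (intro conjI allI exI[of _ p] exI[of _ q] impI assms 2) (use 1 in \<open>auto simp: algebra_simps\<close>)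
qed

lemma step_scaled_tendsto: "(\<lambda>n. step (real n * y)) \<longlonglongrightarrow> (if y > 0 then 1 else 0)"
proof (cases "y > 0")
  case True
  have "eventually (\<lambda>n. step (real n * y) = 1) sequentially"
  proof (rule eventually_sequentiallyI[of "nat \<lceil>2 / y\<rceil>"])
    fix n assume "nat \<lceil>2 / y\<rceil> \<le> n"
    then have "2 / y \<le> real n" by linarith
    then show "step (real n * y) = 1" using True by (intro step_1) (simp add: pos_divide_le_eq)
  qed
  then show ?thesis using True by (simp add: tendsto_eventually)
next
  case False
  then have "step (real n * y) = 0" for n by (intro step_0) (simp add: mult_le_0_iff order_trans[of _ 0 1])
  then show ?thesis using False by simp
qed

lemma bump_tendsto:
  "(\<lambda>n. tensor (\<lambda>i y. step (real n * (y - p$i)) * step (real n * (q$i - y))) x) \<longlonglongrightarrow> indicator (box p q) x"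
proof -
  have "(\<lambda>n. tensor (\<lambda>i y. step (real n * (y - p$i)) * step (real n * (q$i - y))) x)
      \<longlonglongrightarrow> (\<Prod>i\<in>UNIV. (if x$i - p$i > 0 then 1 else 0) * (if q$i - x$i > 0 then 1 else 0))"
    unfolding tensor_def by (intro tendsto_prod tendsto_mult step_scaled_tendsto)
  also have "(\<Prod>i\<in>UNIV. (if x$i - p$i > 0 then 1 else 0) * (if q$i - x$i > 0 then 1 else 0)) = (indicator (box p q) x :: real)"
  proof (cases "x \<in> box p q")
    case True then show ?thesis by (auto simp: mem_box_cart)
  next
    case False
    then obtain i where "\<not> (p$i < x$i \<and> x$i < q$i)" by (auto simp: mem_box_cart)
    then show ?thesis using False by (auto intro!: prod_zero bexI[of _ i] simp: )
  qed
  finally show ?thesis .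
qed

lemma bump_bounds:
  "0 \<le> tensor (\<lambda>i y. step (c * (y - p$i)) * step (c * (q$i - y))) x"
  "tensor (\<lambda>i y. step (c * (y - p$i)) * step (c * (q$i - y))) x \<le> 1"
  unfolding tensor_def using step_ge_0 step_le_1
  by (auto intro!: prod_nonneg prod_le_1 mult_le_one mult_nonneg_nonneg)

lemma locally_integrable_cbox:
  assumes "locally_integrable S f" "cbox p q \<subseteq> S"
  shows "integrable lebesgue (\<lambda>x. indicator (cbox p q) x * f x)"
  using assms unfolding locally_integrable_def set_integrable_def by auto

lemma locally_integrable_test:
  assumes f: "locally_integrable S f" and K: "compact K" "K \<subseteq> S" and S: "S \<in> sets lebesgue"
    and m: "m \<in> borel_measurable borel" "\<And>x. \<bar>m x\<bar> \<le> C * indicator K x"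
  shows "integrable (lebesgue_on S) (\<lambda>x. f x * m x)"
proof -
  have z: "m x = 0" if "x \<notin> K" for x using m(2)[of x] that by simp
  have fK: "integrable lebesgue (\<lambda>x. indicator K x * f x)"
    using f K unfolding locally_integrable_def set_integrable_def by auto
  have mL: "m \<in> borel_measurable lebesgue" using m(1) by (rule borel_measurable_lebesgueI)
  have "integrable lebesgue (\<lambda>x. (indicator K x * f x) * m x)"
  proof (rule Bochner_Integration.integrable_bound)
    show "integrable lebesgue (\<lambda>x. C * (indicator K x * f x))" using fK by auto
    show "(\<lambda>x. (indicator K x * f x) * m x) \<in> borel_measurable lebesgue"
      using borel_measurable_integrable[OF fK] mL by (rule borel_measurable_times)
    have "\<bar>(indicator K x * f x) * m x\<bar> \<le> \<bar>C * (indicator K x * f x)\<bar>" for x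
      using m(2)[of x] by (auto simp: indicator_def abs_mult mult.commute[of C] intro!: mult_left_mono)
    then show "AE x in lebesgue. norm ((indicator K x * f x) * m x) \<le> norm (C * (indicator K x * f x))"
      by simp
  qed
  moreover have "(\<lambda>x. (indicator K x * f x) * m x) = (\<lambda>x. indicator S x *\<^sub>R (f x * m x))"
    using z K by (auto simp: fun_eq_iff indicator_def)
  ultimately show ?thesis using S by (simp add: integrable_restrict_space)
qed

lemma locally_integrable_tensor:
  assumes f: "locally_integrable S f" and S: "S \<in> sets lebesgue" and F: "tensor_test S F"
  shows "integrable (lebesgue_on S) (\<lambda>x. f x * tensor F x)"
proof -
  obtain C p q where "cbox p q \<subseteq> S" "\<And>x. \<bar>tensor F x\<bar> \<le> C * indicator (cbox p q) x"
    by (rule tensor_test_bounded[OF F]) auto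
  then show ?thesis using f S F
    by (intro locally_integrable_test[of S f "cbox p q" _ C] tensor_measurable) (auto simp: tensor_test_def)
qed

text \<open>Products are enough as test functions, because smooth bumps of product form converge
  boundedly to the indicator of a box. All later work with weak derivatives therefore tests with
  products only.\<close>

lemma fundamental_lemma:
  assumes S: "open S" and f: "locally_integrable S f"
    and z: "\<And>F. tensor_test S F \<Longrightarrow> (\<integral>x. f x * tensor F x \<partial>lebesgue_on S) = 0"
  shows "AE x in lebesgue_on S. f x = 0"
proof -
  have SL: "S \<in> sets lebesgue" using S by auto
  have box0: "(\<integral>x. indicator (box p q) x * f x \<partial>lebesgue) = 0" if pq: "cbox p q \<subseteq> S" for p q
  proof -
    define b where "b n x = tensor (\<lambda>i y. step (real n * (y - p$i)) * step (real n * (q$i - y))) x" for n x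
    have b0: "b n x = 0" if x: "x \<notin> cbox p q" for n x
    proof -
      obtain i where i: "x $ i \<notin> {p$i..q$i}" using x by (auto simp: mem_box_cart)
      then have "real n * (x$i - p$i) \<le> 0 \<or> real n * (q$i - x$i) \<le> 0"
        by (auto simp: mult_le_0_iff)
      then show ?thesis unfolding b_def by (subst tensor_split[of _ _ i]) (auto simp: step_0)
    qed
    have bm: "b n \<in> borel_measurable lebesgue" for n
    proof -
      have "b n \<in> borel_measurable borel" unfolding b_def[abs_def]
        using tensor_test_bump[OF order_refl] by (intro tensor_measurable) (auto simp: tensor_test_def)
      then show ?thesis by (rule borel_measurable_lebesgueI)
    qed
    have fb: "(\<integral>x. (indicator (cbox p q) x * f x) * b n x \<partial>lebesgue) = 0" for n
    proof -
      have "(\<integral>x. (indicator (cbox p q) x * f x) * b n x \<partial>lebesgue) = (\<integral>x. indicator S x *\<^sub>R (f x * b n x) \<partial>lebesgue)"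
        using b0 pq by (intro Bochner_Integration.integral_cong) (auto simp: indicator_def)
      also have "\<dots> = (\<integral>x. f x * b n x \<partial>lebesgue_on S)" using SL by (simp add: integral_restrict_space)
      also have "\<dots> = 0" unfolding b_def using z[OF tensor_test_bump[OF pq]] by simp
      finally show ?thesis .
    qed
    have "(\<lambda>n. \<integral>x. (indicator (cbox p q) x * f x) * b n x \<partial>lebesgue)
        \<longlonglongrightarrow> (\<integral>x. (indicator (cbox p q) x * f x) * indicator (box p q) x \<partial>lebesgue)"
    proof (rule integral_dominated_convergence)
      note fi = locally_integrable_cbox[OF f pq]
      show "integrable lebesgue (\<lambda>x. \<bar>indicator (cbox p q) x * f x\<bar>)" using fi by (rule integrable_abs)
      show "(\<lambda>x. (indicator (cbox p q) x * f x) * b n x) \<in> borel_measurable lebesgue" for n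
        using borel_measurable_integrable[OF fi] bm by (rule borel_measurable_times)
      show "(\<lambda>x. (indicator (cbox p q) x * f x) * indicator (box p q) x) \<in> borel_measurable lebesgue"
        by (rule borel_measurable_times[OF borel_measurable_integrable[OF fi]])
           (auto intro!: borel_measurable_lebesgueI)
      show "AE x in lebesgue. (\<lambda>n. (indicator (cbox p q) x * f x) * b n x)
          \<longlonglongrightarrow> (indicator (cbox p q) x * f x) * indicator (box p q) x"
        unfolding b_def by (intro AE_I2 tendsto_mult_left bump_tendsto)
      have "\<bar>b n x\<bar> \<le> 1" for n x unfolding b_def
        using bump_bounds[where c = "real n" and p = p and q = q and x = x] by (simp only: abs_of_nonneg)
      then have "\<bar>(indicator (cbox p q) x * f x) * b n x\<bar> \<le> \<bar>indicator (cbox p q) x * f x\<bar>" for n x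
        unfolding abs_mult[of _ "b n x"] by (rule mult_left_le) auto
      then show "AE x in lebesgue. norm ((indicator (cbox p q) x * f x) * b n x) \<le> \<bar>indicator (cbox p q) x * f x\<bar>" for n
        by simp
    qed
    moreover have "(\<lambda>x. (indicator (cbox p q) x * f x) * indicator (box p q) x) = (\<lambda>x. indicator (box p q) x * f x)"
      using box_subset_cbox by (auto simp: fun_eq_iff indicator_def)
    ultimately show ?thesis using fb by (simp add: LIMSEQ_const_iff)
  qed
  have ae: "AE x in lebesgue. x \<in> box P Q \<longrightarrow> f x = 0" if PQ: "cbox P Q \<subseteq> S" for P Q
  proof -
    have "AE x in lebesgue. indicator (box P Q) x * f x = 0"
    proof (rule lebesgue_on_eq_0[where P = P and Q = Q])
      have "integrable lebesgue (\<lambda>x. indicator (box P Q) x *\<^sub>R (indicator (cbox P Q) x * f x))"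
        by (rule integrable_mult_indicator[OF _ locally_integrable_cbox[OF f PQ]]) auto
      moreover have "(\<lambda>x. indicator (box P Q) x *\<^sub>R (indicator (cbox P Q) x * f x)) = (\<lambda>x. indicator (box P Q) x * f x)"
        using box_subset_cbox by (auto simp: fun_eq_iff indicator_def)
      ultimately show "integrable lebesgue (\<lambda>x. indicator (box P Q) x * f x)" by simp
      fix p q
      \<comment> \<open>The corners of the intersection of the two boxes. Its closed box lies in
        \<open>cbox P Q\<close> and so in S, as \<open>box0\<close> demands.\<close>
      define p' q' where "p' = (\<chi> i. max (p$i) (P$i))" "q' = (\<chi> i. min (q$i) (Q$i))"
      have i: "box p q \<inter> box P Q = box p' q'" by (auto simp: p'_q'_def mem_box_cart)
      have "cbox p' q' \<subseteq> cbox P Q" by (auto simp: p'_q'_def mem_box_cart)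
      with PQ have "(\<integral>x. indicator (box p' q') x * f x \<partial>lebesgue) = 0" by (intro box0) auto
      then show "(\<integral>x. indicator (box p q) x * (indicator (box P Q) x * f x) \<partial>lebesgue) = 0"
        unfolding i[symmetric] indicator_inter_arith by (simp add: mult.assoc)
    qed (auto simp: indicator_def)
    then show ?thesis by eventually_elim (auto simp: indicator_def)
  qed
  \<comment> \<open>Countably many closed boxes exhaust S, and each differs from its open box by a
    null set.\<close>
  obtain D where D: "countable D" "D \<subseteq> Pow S" "\<And>X. X \<in> D \<Longrightarrow> \<exists>a b. X = cbox a b" "\<Union>D = S"
    using open_countable_Union_open_cbox[OF S] by metis
  have "AE x in lebesgue. \<forall>X\<in>D. x \<in> X \<longrightarrow> f x = 0"
  proof (subst AE_ball_countable[OF D(1)], rule ballI)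
    fix X assume X: "X \<in> D"
    then obtain a b where ab: "X = cbox a b" "cbox a b \<subseteq> S" using D by blast
    have "cbox a b - box a b \<in> null_sets lebesgue"
      using negligible_frontier_interval by (simp add: negligible_iff_null_sets)
    from AE_not_in[OF this] ae[OF ab(2)] show "AE x in lebesgue. x \<in> X \<longrightarrow> f x = 0"
      by eventually_elim (auto simp: ab(1))
  qed
  then show ?thesis unfolding AE_lebesgue_on_iff[OF SL]
    by eventually_elim (use D(4) in auto)
qed

section \<open>Weak derivatives\<close>

lemma partials_foldr:
  "partials \<beta> f = foldr partial (replicate (\<beta> 1) 1 @ replicate (\<beta> 2) 2 @ replicate (\<beta> 3) 3) f"
  by (simp add: partials_def foldr_replicate)

lemma partial_support:
  assumes "closed K" "\<And>x. x \<notin> K \<Longrightarrow> f x = 0" "x \<notin> K"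
  shows "partial i f x = 0"
proof -
  let ?T = "(\<lambda>s. x + s *\<^sub>R axis i 1) -` (- K)"
  have "open ?T"
    using assms(1) by (intro continuous_open_vimage) (auto intro!: continuous_intros)
  then have "((\<lambda>s. f (x + s *\<^sub>R axis i 1)) has_real_derivative 0) (at 0)"
    by (rule has_field_derivative_transform_within_open[OF DERIV_const]) (use assms in auto)
  then show ?thesis unfolding partial_def by (rule DERIV_imp_deriv)
qed

lemma foldr_partial_support:
  fixes f :: "real^3 \<Rightarrow> real"
  assumes "closed K" "\<And>x. x \<notin> K \<Longrightarrow> f x = 0"
  shows "x \<notin> K \<Longrightarrow> foldr partial is f x = 0"
  by (induction "is" arbitrary: x) (auto intro: partial_support assms)

lemma test_function_partials:
  assumes "test_function S \<eta>"
  obtains C K where "compact K" "K \<subseteq> S" "\<And>x. \<bar>partials \<beta> \<eta> x\<bar> \<le> C * indicator K x"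
    "partials \<beta> \<eta> \<in> borel_measurable borel"
proof -
  obtain K where K: "compact K" "K \<subseteq> S" "\<And>x. x \<notin> K \<Longrightarrow> \<eta> x = 0" and sm: "smooth \<eta>"
    using assms unfolding test_function_def by blast
  have c: "continuous_on UNIV (partials \<beta> \<eta>)"
    unfolding partials_foldr using sm unfolding smooth_def by (blast intro: differentiable_imp_continuous_on)
  have "compact (partials \<beta> \<eta> ` K)"
    using continuous_on_subset[OF c] K by (intro compact_continuous_image) auto
  then obtain C where C: "C > 0" "\<forall>y \<in> partials \<beta> \<eta> ` K. norm y \<le> C"
    using compact_imp_bounded bounded_pos by metis
  show ?thesis
  proof (rule that[OF K(1,2)])
    have "partials \<beta> \<eta> x = 0" if "x \<notin> K" for x
      unfolding partials_foldr by (rule foldr_partial_support[OF compact_imp_closed[OF K(1)] K(3) that])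
    then show "\<bar>partials \<beta> \<eta> x\<bar> \<le> C * indicator K x" for x
      using C(2) by (cases "x \<in> K") auto
    show "partials \<beta> \<eta> \<in> borel_measurable borel"
      by (rule borel_measurable_continuous_onI[OF c])
  qed
qed

lemma partials_0: "partials (\<lambda>_. 0) f = f"
  by (simp add: partials_def)

lemma locally_integrable_partials:
  assumes "locally_integrable S f" "S \<in> sets lebesgue" "test_function S \<eta>"
  shows "integrable (lebesgue_on S) (\<lambda>x. f x * partials \<beta> \<eta> x)"
  by (rule test_function_partials[OF assms(3), of \<beta>]) (rule locally_integrable_test[OF assms(1) _ _ assms(2)])

lemma locally_integrable_linear:
  assumes "locally_integrable S f" "locally_integrable S g"
  shows "locally_integrable S (\<lambda>x. c * f x + d * g x)"
  using assms unfolding locally_integrable_def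
  by (auto intro!: set_integral_add set_integrable_mult_right)

lemma has_weak_deriv_linear:
  assumes S: "S \<in> sets lebesgue" and f: "has_weak_deriv S \<beta> f f'" and g: "has_weak_deriv S \<beta> g g'"
  shows "has_weak_deriv S \<beta> (\<lambda>x. c * f x + d * g x) (\<lambda>x. c * f' x + d * g' x)"
proof -
  have li: "locally_integrable S f" "locally_integrable S f'" "locally_integrable S g" "locally_integrable S g'"
    using f g by (auto simp: has_weak_deriv_def)
  have "(LINT x:S|lebesgue. (c * f x + d * g x) * partials \<beta> \<eta> x)
      = (-1) ^ mi_order \<beta> * (LINT x:S|lebesgue. (c * f' x + d * g' x) * \<eta> x)"
    if \<eta>: "test_function S \<eta>" for \<eta>
  proof -
    have 1: "(\<integral>x. h x * partials \<beta> \<eta> x \<partial>lebesgue_on S) = (-1) ^ mi_order \<beta> * (\<integral>x. h' x * \<eta> x \<partial>lebesgue_on S)"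
      if "has_weak_deriv S \<beta> h h'" for h h'
      using that[unfolded has_weak_deriv_def set_integral_lebesgue_on[OF S], THEN conjunct2, THEN conjunct2, rule_format, OF \<eta>] .
    have i: "integrable (lebesgue_on S) (\<lambda>x. h x * partials \<gamma> \<eta> x)" if "locally_integrable S h" for h \<gamma>
      by (rule locally_integrable_partials[OF that S \<eta>])
    have "(\<integral>x. (c * f x + d * g x) * partials \<beta> \<eta> x \<partial>lebesgue_on S)
        = (\<integral>x. c * (f x * partials \<beta> \<eta> x) + d * (g x * partials \<beta> \<eta> x) \<partial>lebesgue_on S)"
      by (intro Bochner_Integration.integral_cong) (auto simp: algebra_simps)
    also have "\<dots> = c * (\<integral>x. f x * partials \<beta> \<eta> x \<partial>lebesgue_on S) + d * (\<integral>x. g x * partials \<beta> \<eta> x \<partial>lebesgue_on S)"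
      using i li by simp
    also have "\<dots> = (-1) ^ mi_order \<beta> *
        (c * (\<integral>x. f' x * \<eta> x \<partial>lebesgue_on S) + d * (\<integral>x. g' x * \<eta> x \<partial>lebesgue_on S))"
      unfolding 1[OF f] 1[OF g] by (simp add: distrib_left mult.left_commute)
    also have "c * (\<integral>x. f' x * \<eta> x \<partial>lebesgue_on S) + d * (\<integral>x. g' x * \<eta> x \<partial>lebesgue_on S)
        = (\<integral>x. c * (f' x * \<eta> x) + d * (g' x * \<eta> x) \<partial>lebesgue_on S)"
      using i[OF li(2), of "\<lambda>_. 0"] i[OF li(4), of "\<lambda>_. 0"] by (simp add: partials_0)
    also have "\<dots> = (\<integral>x. (c * f' x + d * g' x) * \<eta> x \<partial>lebesgue_on S)"
      by (intro Bochner_Integration.integral_cong) (auto simp: algebra_simps)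
    finally show ?thesis unfolding set_integral_lebesgue_on[OF S] .
  qed
  then show ?thesis using li by (auto simp: has_weak_deriv_def intro: locally_integrable_linear)
qed

lemma has_weak_deriv_tensor:
  assumes S: "S \<in> sets lebesgue" and f: "has_weak_deriv S \<beta> f g" and F: "tensor_test S F"
  shows "(\<integral>x. f x * tensor (\<lambda>i. (deriv ^^ \<beta> i) (F i)) x \<partial>lebesgue_on S)
    = (-1) ^ mi_order \<beta> * (\<integral>x. g x * tensor F x \<partial>lebesgue_on S)"
proof -
  have "partials \<beta> (tensor F) = tensor (\<lambda>i. (deriv ^^ \<beta> i) (F i))"
    using F by (intro partials_tensor) (simp add: tensor_test_def)
  with f[unfolded has_weak_deriv_def set_integral_lebesgue_on[OF S], THEN conjunct2, THEN conjunct2, rule_format,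
      OF tensor_test_test_function[OF F]]
  show ?thesis by (simp only:)
qed

text \<open>Both candidates have the same integrals against products, so
  \<open>fundamental_lemma\<close> applies to their difference. With f and f' agreeing only almost
  everywhere, the result makes the choice in \<open>weak_deriv\<close> harmless for classes of
  functions.\<close>

lemma has_weak_deriv_unique:
  assumes S: "open S" and f: "has_weak_deriv S \<beta> f g" and f': "has_weak_deriv S \<beta> f' g'"
    and eq: "AE x in lebesgue_on S. f x = f' x"
  shows "AE x in lebesgue_on S. g x = g' x"
proof -
  have SL: "S \<in> sets lebesgue" using S by auto
  have li: "locally_integrable S g" "locally_integrable S g'" "locally_integrable S f" "locally_integrable S f'"
    using f f' by (auto simp: has_weak_deriv_def)
  have "AE x in lebesgue_on S. 1 * g x + (- 1) * g' x = 0"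
  proof (rule fundamental_lemma[OF S locally_integrable_linear[OF li(1,2)]])
    fix F assume F: "tensor_test S F"
    let ?D = "tensor (\<lambda>i. (deriv ^^ \<beta> i) (F i))"
    have D: "partials \<beta> (tensor F) = ?D"
      using F by (intro partials_tensor) (simp add: tensor_test_def)
    note i = locally_integrable_partials[OF _ SL tensor_test_test_function[OF F], of _ \<beta>, unfolded D]
    have "(\<integral>x. f x * ?D x \<partial>lebesgue_on S) = (\<integral>x. f' x * ?D x \<partial>lebesgue_on S)"
    proof (rule integral_cong_AE)
      show "AE x in lebesgue_on S. f x * ?D x = f' x * ?D x" using eq by eventually_elim simp
    qed (rule borel_measurable_integrable[OF i[OF li(3)]] borel_measurable_integrable[OF i[OF li(4)]])+
    then have "(\<integral>x. g x * tensor F x \<partial>lebesgue_on S) = (\<integral>x. g' x * tensor F x \<partial>lebesgue_on S)"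
      unfolding has_weak_deriv_tensor[OF SL f F] has_weak_deriv_tensor[OF SL f' F] by simp
    moreover have "(\<integral>x. (1 * g x + (- 1) * g' x) * tensor F x \<partial>lebesgue_on S)
        = (\<integral>x. g x * tensor F x - g' x * tensor F x \<partial>lebesgue_on S)"
      by (intro Bochner_Integration.integral_cong) (auto simp: left_diff_distrib)
    ultimately show "(\<integral>x. (1 * g x + (- 1) * g' x) * tensor F x \<partial>lebesgue_on S) = 0"
      using locally_integrable_tensor[OF li(1) SL F] locally_integrable_tensor[OF li(2) SL F] by simp
  qed
  then show ?thesis by eventually_elim simp
qed

lemma has_weak_deriv_weak_deriv:
  "has_weak_deriv S \<beta> f g \<Longrightarrow> has_weak_deriv S \<beta> f (weak_deriv S \<beta> f)"
  unfolding weak_deriv_def by (rule someI[of "has_weak_deriv S \<beta> f" g])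

lemma L2_locally_integrable:
  assumes S: "open S" and f: "f \<in> L2 (lebesgue_on S)"
  shows "locally_integrable S f"
  unfolding locally_integrable_def
proof (intro allI impI)
  fix K assume K: "compact K \<and> K \<subseteq> S"
  have SL: "S \<in> sets lebesgue" using S by auto
  have KL: "K \<in> sets lebesgue" using K lmeasurable_compact[of K] by (simp add: fmeasurableD)
  have fm: "(\<lambda>x. indicator S x *\<^sub>R f x) \<in> borel_measurable lebesgue"
    using L2_measurable[OF f] SL borel_measurable_restrict_space_iff[of S lebesgue f] by simp
  have f2: "integrable lebesgue (\<lambda>x. indicator S x * (f x)\<^sup>2)"
    using f SL by (simp add: L2_def integrable_restrict_space)
  have k1: "integrable lebesgue (indicat_real K)"
    using lmeasurable_compact[of K] K by (simp only: lmeasurable_iff_integrable)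
  have "integrable lebesgue (\<lambda>x. indicator K x *\<^sub>R f x)"
  proof (rule Bochner_Integration.integrable_bound[OF Bochner_Integration.integrable_add[OF k1 f2]])
    have "(\<lambda>x. indicator K x * (indicator S x *\<^sub>R f x)) \<in> borel_measurable lebesgue"
      using KL by (intro borel_measurable_times[OF _ fm]) auto
    moreover have "(\<lambda>x. indicator K x * (indicator S x *\<^sub>R f x)) = (\<lambda>x. indicator K x *\<^sub>R f x)"
      using K by (auto simp: fun_eq_iff indicator_def)
    ultimately show "(\<lambda>x. indicator K x *\<^sub>R f x) \<in> borel_measurable lebesgue" by simp
    \<comment> \<open>On a compact set, where constants are integrable, square integrability implies
      integrability.\<close>
    have "\<bar>y\<bar> \<le> 1 + y\<^sup>2" for y :: real
      using sum_squares_bound[of 1 "\<bar>y\<bar>"] by simp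
    then show "AE x in lebesgue. norm (indicator K x *\<^sub>R f x) \<le> norm (indicator K x + indicator S x * (f x)\<^sup>2)"
      using K by (intro AE_I2) (auto simp: indicator_def)
  qed
  then show "set_integrable lebesgue K f" by (simp add: set_integrable_def)
qed

lemma mi_order_0 [simp]: "mi_order (\<lambda>_. 0) = 0"
  by (simp add: mi_order_def)

lemma sobolev_L2: "S \<in> sets lebesgue \<Longrightarrow> f \<in> sobolev k S \<Longrightarrow> f \<in> L2 (lebesgue_on S)"
  by (simp add: sobolev_def L2_on_eq)

text \<open>The chosen derivative agrees almost everywhere with the square integrable one supplied
  by \<open>sobolev\<close> and inherits its integrability.\<close>

lemma sobolev_weak_deriv:
  assumes S: "open S" and f: "f \<in> sobolev k S" and b: "mi_order \<beta> \<le> k"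
  shows "has_weak_deriv S \<beta> f (weak_deriv S \<beta> f)" "weak_deriv S \<beta> f \<in> L2 (lebesgue_on S)"
proof -
  have SL: "S \<in> sets lebesgue" using S by auto
  obtain g where g: "g \<in> L2 (lebesgue_on S)" "has_weak_deriv S \<beta> f g"
    using f b unfolding sobolev_def L2_on_eq[OF SL] by blast
  show w: "has_weak_deriv S \<beta> f (weak_deriv S \<beta> f)" by (rule has_weak_deriv_weak_deriv[OF g(2)])
  have ae: "AE x in lebesgue_on S. g x = weak_deriv S \<beta> f x"
    by (rule has_weak_deriv_unique[OF S g(2) w]) simp
  show "weak_deriv S \<beta> f \<in> L2 (lebesgue_on S)"
    using L2_cong_AE[OF g(1) borel_measurable_lebesgue_on_AE[OF SL L2_measurable[OF g(1)] ae] ae] .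
qed

lemma weak_deriv_0:
  assumes S: "open S" and f: "f \<in> sobolev k S"
  shows "AE x in lebesgue_on S. weak_deriv S (\<lambda>_. 0) f x = f x"
proof (rule has_weak_deriv_unique[OF S sobolev_weak_deriv(1)[OF S f]])
  have "locally_integrable S f" using S f by (intro L2_locally_integrable sobolev_L2[of S f k]) auto
  then show "has_weak_deriv S (\<lambda>_. 0) f f" by (simp add: has_weak_deriv_def partials_0)
qed auto

lemma weak_deriv_diff:
  assumes S: "open S" and f: "f \<in> sobolev k S" and g: "g \<in> sobolev k S" and b: "mi_order \<beta> \<le> k"
  shows "AE x in lebesgue_on S. weak_deriv S \<beta> (\<lambda>x. f x - g x) x = weak_deriv S \<beta> f x - weak_deriv S \<beta> g x"
    "(\<lambda>x. f x - g x) \<in> sobolev k S"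
proof -
  have SL: "S \<in> sets lebesgue" using S by auto
  have *: "has_weak_deriv S \<beta> (\<lambda>x. f x - g x) (\<lambda>x. weak_deriv S \<beta> f x - weak_deriv S \<beta> g x)"
    if "mi_order \<beta> \<le> k" for \<beta>
    using has_weak_deriv_linear[OF SL sobolev_weak_deriv(1)[OF S f that] sobolev_weak_deriv(1)[OF S g that], of 1 "- 1"]
    by simp
  show "AE x in lebesgue_on S. weak_deriv S \<beta> (\<lambda>x. f x - g x) x = weak_deriv S \<beta> f x - weak_deriv S \<beta> g x"
    by (rule has_weak_deriv_unique[OF S has_weak_deriv_weak_deriv[OF *[OF b]] *[OF b]]) simp
  show "(\<lambda>x. f x - g x) \<in> sobolev k S"
    using * sobolev_L2[OF SL f] sobolev_L2[OF SL g] sobolev_weak_deriv(2)[OF S f] sobolev_weak_deriv(2)[OF S g] L2_diff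
    unfolding sobolev_def L2_on_eq[OF SL] by blast
qed

lemma finite_mi_order: "finite {\<beta>. mi_order \<beta> \<le> k}"
proof (rule finite_subset)
  show "{\<beta>. mi_order \<beta> \<le> k} \<subseteq> PiE UNIV (\<lambda>_. {..k})"
  proof
    fix \<beta> assume "\<beta> \<in> {\<beta>. mi_order \<beta> \<le> k}"
    then have "\<beta> i \<le> k" for i
      using member_le_sum[of i UNIV \<beta>] by (auto simp: mi_order_def)
    then show "\<beta> \<in> PiE UNIV (\<lambda>_. {..k})" by auto
  qed
qed (auto intro: finite_PiE)

lemma L2norm_weak_deriv_le:
  assumes "S \<in> sets lebesgue" "mi_order \<beta> \<le> k"
  shows "L2norm (lebesgue_on S) (weak_deriv S \<beta> f) \<le> sobolev_norm k S f"
  unfolding L2norm_def sobolev_norm_def set_integral_lebesgue_on[OF assms(1)]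
  using assms(2) finite_mi_order by (intro real_sqrt_le_mono member_le_sum[of \<beta>]) auto

text \<open>By linearity and uniqueness the difference quotient of weak derivatives is almost
  everywhere the weak derivative of the difference quotient, and its squared L2 norm is one summand
  of the squared Sobolev norm.\<close>

lemma C1_sobolev_weak_deriv:
  assumes S: "open S" and v: "C1_sobolev k S \<infinity> v v'" and b: "mi_order \<beta> \<le> k"
  shows "C1_L2 (lebesgue_on S) (\<lambda>t. weak_deriv S \<beta> (v t)) (\<lambda>t. weak_deriv S \<beta> (v' t))"
  unfolding C1_L2_def
proof (intro allI impI conjI)
  fix t :: real assume t: "0 \<le> t"
  have SL: "S \<in> sets lebesgue" using S by auto
  have T: "time_interval \<infinity> = {0..}" by (auto simp: time_interval_def)
  have vs: "v s \<in> sobolev k S" "v' s \<in> sobolev k S" if "s \<ge> 0" for s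
    using v that unfolding C1_sobolev_def T by auto
  show "weak_deriv S \<beta> (v t) \<in> L2 (lebesgue_on S)" "weak_deriv S \<beta> (v' t) \<in> L2 (lebesgue_on S)"
    using vs[OF t] by (auto intro: sobolev_weak_deriv(2)[OF S _ b])
  show "((\<lambda>s. L2norm (lebesgue_on S) (\<lambda>x. (weak_deriv S \<beta> (v s) x - weak_deriv S \<beta> (v t) x) / (s - t) - weak_deriv S \<beta> (v' t) x))
      \<longlongrightarrow> 0) (at t within {0..})"
  proof (rule Lim_null_comparison)
    show "((\<lambda>s. sobolev_norm k S (\<lambda>x. (v s x - v t x) / (s - t) - v' t x)) \<longlongrightarrow> 0) (at t within {0..})"
      using v t unfolding C1_sobolev_def T by auto
    have "L2norm (lebesgue_on S) (\<lambda>x. (weak_deriv S \<beta> (v s) x - weak_deriv S \<beta> (v t) x) / (s - t) - weak_deriv S \<beta> (v' t) x)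
        \<le> sobolev_norm k S (\<lambda>x. (v s x - v t x) / (s - t) - v' t x)" if s: "s \<ge> 0" for s
    proof -
      let ?W = "\<lambda>x. (weak_deriv S \<beta> (v s) x - weak_deriv S \<beta> (v t) x) / (s - t) - weak_deriv S \<beta> (v' t) x"
      let ?q = "\<lambda>x. (v s x - v t x) / (s - t) - v' t x"
      note w = sobolev_weak_deriv(1)[OF S _ b]
      \<comment> \<open>At s = t the coefficients are 0 by the convention for division by 0, in
        agreement with the quotient on the left, so this case is not singled out.\<close>
      have W: "has_weak_deriv S \<beta> ?q ?W"
        using has_weak_deriv_linear[OF SL has_weak_deriv_linear[OF SL w[OF vs(1)[OF s]] w[OF vs(1)[OF t]],
              of "inverse (s - t)" "- inverse (s - t)"] w[OF vs(2)[OF t]], of 1 "- 1"]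
        by (simp add: divide_inverse algebra_simps)
      have ae: "AE x in lebesgue_on S. ?W x = weak_deriv S \<beta> ?q x"
        by (rule has_weak_deriv_unique[OF S W has_weak_deriv_weak_deriv[OF W]]) simp
      note l = sobolev_weak_deriv(2)[OF S _ b, THEN L2_measurable]
      have m: "?W \<in> borel_measurable (lebesgue_on S)"
        using l[OF vs(1)[OF s]] l[OF vs(1)[OF t]] l[OF vs(2)[OF t]] by measurable
      have "L2norm (lebesgue_on S) ?W = L2norm (lebesgue_on S) (weak_deriv S \<beta> ?q)"
        by (rule L2norm_cong_AE[OF m borel_measurable_lebesgue_on_AE[OF SL m ae] ae])
      also have "\<dots> \<le> sobolev_norm k S ?q" by (rule L2norm_weak_deriv_le[OF SL b])
      finally show ?thesis .
    qed
    then show "\<forall>\<^sub>F s in at t within {0..}. norm (L2norm (lebesgue_on S) (\<lambda>x. (weak_deriv S \<beta> (v s) x - weak_deriv S \<beta> (v t) x) / (s - t) - weak_deriv S \<beta> (v' t) x))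
        \<le> sobolev_norm k S (\<lambda>x. (v s x - v t x) / (s - t) - v' t x)"
      unfolding eventually_at_filter by (intro always_eventually) (auto simp: L2norm_nonneg)
  qed
qed

section \<open>Sobolev embedding\<close>

text \<open>Dominated convergence along sequences. Convexity of U lets the mean value inequality
  turn the bound g on the derivative into a bound on the difference quotients.\<close>

lemma DERIV_integral_parameter:
  fixes k :: "real \<Rightarrow> 'a \<Rightarrow> real"
  assumes U: "open U" "convex U" "m0 \<in> U"
    and int: "\<And>m. m \<in> U \<Longrightarrow> integrable M (k m)"
    and der: "\<And>m z. m \<in> U \<Longrightarrow> z \<in> space M \<Longrightarrow> ((\<lambda>m. k m z) has_real_derivative k' m z) (at m)"
    and bd: "\<And>m z. m \<in> U \<Longrightarrow> z \<in> space M \<Longrightarrow> \<bar>k' m z\<bar> \<le> g z"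
    and g: "integrable M g" and k'm: "k' m0 \<in> borel_measurable M"
  shows "((\<lambda>m. \<integral>z. k m z \<partial>M) has_real_derivative (\<integral>z. k' m0 z \<partial>M)) (at m0)"
proof -
  have "((\<lambda>m. ((\<integral>z. k m z \<partial>M) - (\<integral>z. k m0 z \<partial>M)) / (m - m0)) \<longlongrightarrow> (\<integral>z. k' m0 z \<partial>M)) (at m0 within U)"
    unfolding tendsto_at_iff_sequentially o_def
  proof (intro allI impI)
    fix X assume X: "\<forall>i. X i \<in> U - {m0}" "X \<longlonglongrightarrow> m0"
    have "(\<lambda>n. \<integral>z. (k (X n) z - k m0 z) / (X n - m0) \<partial>M) \<longlonglongrightarrow> (\<integral>z. k' m0 z \<partial>M)"
    proof (rule integral_dominated_convergence[OF k'm _ g])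
      show "(\<lambda>z. (k (X n) z - k m0 z) / (X n - m0)) \<in> borel_measurable M" for n
        using borel_measurable_integrable[OF int[of "X n"]] borel_measurable_integrable[OF int[OF U(3)]] X(1)
        by auto
      show "AE z in M. (\<lambda>n. (k (X n) z - k m0 z) / (X n - m0)) \<longlonglongrightarrow> k' m0 z"
      proof (rule AE_I2)
        fix z assume "z \<in> space M"
        from der[OF U(3) this] have "(\<lambda>m. (k m z - k m0 z) / (m - m0)) \<midarrow>m0\<rightarrow> k' m0 z"
          unfolding has_field_derivative_iff .
        then show "(\<lambda>n. (k (X n) z - k m0 z) / (X n - m0)) \<longlonglongrightarrow> k' m0 z"
          using X unfolding tendsto_at_iff_sequentially o_def by auto
      qed
      show "AE z in M. norm ((k (X n) z - k m0 z) / (X n - m0)) \<le> g z" for n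
      proof (rule AE_I2)
        fix z assume z: "z \<in> space M"
        have "norm (k (X n) z - k m0 z) \<le> g z * norm (X n - m0)"
          by (rule field_differentiable_bound[OF U(2), of "\<lambda>m. k m z" "\<lambda>m. k' m z"])
             (use der[OF _ z] bd[OF _ z] X(1) U(3) in \<open>auto intro: has_field_derivative_at_within\<close>)
        moreover have "X n \<noteq> m0" using X(1) by auto
        ultimately show "norm ((k (X n) z - k m0 z) / (X n - m0)) \<le> g z"
          by (simp add: abs_divide pos_divide_le_eq)
      qed
    qed
    moreover have "(\<integral>z. (k (X n) z - k m0 z) / (X n - m0) \<partial>M) = ((\<integral>z. k (X n) z \<partial>M) - (\<integral>z. k m0 z \<partial>M)) / (X n - m0)" for n
      using int[of "X n"] int[OF U(3)] X(1) by simp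
    ultimately show "(\<lambda>n. ((\<integral>z. k (X n) z \<partial>M) - (\<integral>z. k m0 z \<partial>M)) / (X n - m0)) \<longlonglongrightarrow> (\<integral>z. k' m0 z \<partial>M)"
      by (simp only:)
  qed
  then show ?thesis
    unfolding has_field_derivative_iff at_within_open[OF U(3,1)] .
qed

section \<open>Averages over shrinking boxes and their dependence on the scale\<close>

definition tensor_deriv :: "(real^3) set \<Rightarrow> 3 \<Rightarrow> (real^3 \<Rightarrow> real) \<Rightarrow> (real^3 \<Rightarrow> real) \<Rightarrow> bool" where
  "tensor_deriv S i f g \<longleftrightarrow> f \<in> L2 (lebesgue_on S) \<and> g \<in> L2 (lebesgue_on S) \<and>
     (\<forall>F. tensor_test S F \<longrightarrow>
       (\<integral>x. f x * tensor (F(i := deriv (F i))) x \<partial>lebesgue_on S) = - (\<integral>x. g x * tensor F x \<partial>lebesgue_on S))"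

definition rescale :: "real^3 \<Rightarrow> real \<Rightarrow> (3 \<Rightarrow> real \<Rightarrow> real) \<Rightarrow> 3 \<Rightarrow> real \<Rightarrow> real" where
  "rescale x l F = (\<lambda>i y. F i ((y - x$i) / l))"

text \<open>The dilates \<open>x + l *\<^sub>R cbox p q\<close> of the support shrink to x inside S.  This needs no
  ball around x, so the averages below reach up to the corners of the box with constants that do not
  depend on x.\<close>

definition inward :: "(real^3) set \<Rightarrow> real^3 \<Rightarrow> real^3 \<Rightarrow> real^3 \<Rightarrow> (3 \<Rightarrow> real \<Rightarrow> real) \<Rightarrow> bool" where
  "inward S x p q F \<longleftrightarrow> (\<forall>i. smooth1 (F i)) \<and> (\<forall>i y. y \<notin> {p$i..q$i} \<longrightarrow> F i y = 0) \<and>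
     (\<forall>l y. 0 < l \<longrightarrow> l \<le> 1 \<longrightarrow> y \<in> cbox p q \<longrightarrow> x + l *\<^sub>R y \<in> S)"

lemma rescale_support:
  assumes F: "\<And>i y. y \<notin> {p$i..q$i} \<Longrightarrow> F i y = 0" and l: "l > 0"
    and y: "y \<notin> {x$i + l * p$i .. x$i + l * q$i}"
  shows "rescale x l F i y = 0"
proof -
  have "(y - x$i) / l \<notin> {p$i..q$i}"
    using l y by (auto simp: pos_le_divide_eq pos_divide_le_eq mult.commute)
  then show ?thesis using F by (simp add: rescale_def)
qed

lemma smooth1_rescale:
  assumes "smooth1 (F i)" shows "smooth1 (rescale x l F i)"
proof -
  have "smooth1 (\<lambda>y. F i (inverse l * y + (- x$i / l)))" by (rule smooth1_affine[OF assms])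
  then show ?thesis by (simp add: rescale_def divide_inverse algebra_simps)
qed

lemma rescale_test:
  assumes "inward S x p q F" "0 < l" "l \<le> 1"
  shows "tensor_test S (rescale x l F)"
  unfolding tensor_test_def
proof (intro conjI allI exI impI)
  show "smooth1 (rescale x l F i)" for i
    using assms by (intro smooth1_rescale) (simp add: inward_def)
  show "cbox (x + l *\<^sub>R p) (x + l *\<^sub>R q) \<subseteq> S"
  proof
    fix z assume z: "z \<in> cbox (x + l *\<^sub>R p) (x + l *\<^sub>R q)"
    have "inverse l *\<^sub>R (z - x) \<in> cbox p q"
      using z \<open>0 < l\<close> by (auto simp: mem_box_cart field_simps)
    then have "x + l *\<^sub>R (inverse l *\<^sub>R (z - x)) \<in> S" using assms unfolding inward_def by blast
    then show "z \<in> S" using \<open>0 < l\<close> by simp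
  qed
  show "rescale x l F i y = 0" if "y \<notin> {(x + l *\<^sub>R p)$i..(x + l *\<^sub>R q)$i}" for i y
    using assms that by (intro rescale_support[of p q]) (auto simp: inward_def)
qed

lemma rescale_bounded:
  assumes "inward S x p q F" and l: "0 < l"
    and C: "\<And>y. \<bar>tensor F y\<bar> \<le> C"
  shows "\<bar>tensor (rescale x l F) z\<bar> \<le> C * indicator (cbox (x + l *\<^sub>R p) (x + l *\<^sub>R q)) z"
proof (cases "z \<in> cbox (x + l *\<^sub>R p) (x + l *\<^sub>R q)")
  case True
  have "tensor (rescale x l F) z = tensor F (\<chi> i. (z$i - x$i) / l)"
    by (simp add: tensor_def rescale_def)
  then show ?thesis using C True by simp
next
  case False
  then obtain i where "z$i \<notin> {x$i + l * p$i .. x$i + l * q$i}" by (auto simp: mem_box_cart)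
  then have "rescale x l F i (z$i) = 0"
    using assms by (intro rescale_support[of p q]) (auto simp: inward_def)
  then show ?thesis using False by (auto simp: tensor_split[of _ z i])
qed

lemma inward_bounded:
  assumes "inward S x p q F"
  obtains C where "C > 0" "\<And>y. \<bar>tensor F y\<bar> \<le> C"
proof -
  have "tensor_test UNIV F" using assms unfolding inward_def tensor_test_def by blast
  from tensor_test_bounded[OF this] obtain C p q where "C > 0" "\<And>x. \<bar>tensor F x\<bar> \<le> C * indicator (cbox p q) x"
    by metis
  moreover have "C * indicator (cbox p q) x \<le> C" for x :: "real^3" using \<open>C > 0\<close> by (simp add: indicator_def)
  ultimately show ?thesis using order_trans by (intro that[of C]) blast+
qed

lemma inward_upd:
  assumes "inward S x p q F" "smooth1 h" "\<And>y. y \<notin> {p$i..q$i} \<Longrightarrow> h y = 0"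
  shows "inward S x p q (F(i := h))"
  using assms unfolding inward_def by auto

lemma inward_mult_id:
  assumes "inward S x p q F"
  shows "inward S x p q (F(i := (\<lambda>y. y * F i y)))"
  by (rule inward_upd[OF assms]) (use assms in \<open>auto simp: inward_def\<close>)

lemma inward_deriv:
  assumes "inward S x p q F"
  shows "inward S x p q (F(i := deriv (F i)))"
  by (rule inward_upd[OF assms])
     (use assms deriv_support[of "p$i" "q$i" "F i"] in \<open>auto simp: inward_def smooth1_smooth_deriv\<close>)

text \<open>The integral of f (x + l y) against \<open>tensor F\<close> over y, written after the
  substitution z = x + l y, so that the class f is never composed with a map.\<close>

definition avg :: "(real^3) set \<Rightarrow> real^3 \<Rightarrow> (real^3 \<Rightarrow> real) \<Rightarrow> (3 \<Rightarrow> real \<Rightarrow> real) \<Rightarrow> real \<Rightarrow> real" where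
  "avg S x f F l = inverse (l ^ 3) * (\<integral>z. f z * tensor (rescale x l F) z \<partial>lebesgue_on S)"

text \<open>The derivative in m of F((z - x)/m)/m, for one coordinate, is -(y F)'/m^2 at y = (z -
  x)/m. The derivative of the whole kernel is thus a divergence, which \<open>avg_deriv\<close> can
  move onto f.\<close>

lemma rescale_deriv:
  assumes F: "inward S x p q F" and l: "l > 0"
  shows "((\<lambda>l. inverse (l ^ 3) * tensor (rescale x l F) z) has_real_derivative
     - inverse (l ^ 4) * (\<Sum>i\<in>UNIV. tensor (rescale x l (F(i := deriv (\<lambda>y. y * F i y)))) z)) (at l)"
proof -
  have sm: "smooth1 (F i)" "smooth1 (\<lambda>y. y * F i y)" for i using F by (auto simp: inward_def)
  define u where "u i m = inverse m * F i ((z$i - x$i) / m)" for i m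
  define u' where "u' i m = - inverse (m ^ 2) * deriv (\<lambda>y. y * F i y) ((z$i - x$i) / m)" for i m
  have du: "((\<lambda>m. u i m) has_real_derivative u' i l) (at l)" for i
  proof -
    let ?y = "(z$i - x$i) / l"
    have d: "deriv (\<lambda>y. y * F i y) ?y = F i ?y + ?y * deriv (F i) ?y"
      by (rule DERIV_imp_deriv) (auto intro!: derivative_eq_intros smooth1_deriv sm)
    have q: "((\<lambda>m. (z$i - x$i) / m) has_real_derivative - (z$i - x$i) / l\<^sup>2) (at l)"
      using l by (auto intro!: derivative_eq_intros simp: power2_eq_square)
    have i: "(inverse has_real_derivative - inverse (l\<^sup>2)) (at l)"
      using DERIV_inverse[of l] l by (simp add: numeral_2_eq_2)
    from DERIV_mult[OF i DERIV_chain2[OF smooth1_deriv[OF sm(1)] q]]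
    show ?thesis unfolding u_def u'_def d
      by (rule DERIV_cong) (use l in \<open>simp add: field_simps power2_eq_square\<close>)
  qed
  have eq: "inverse (m ^ 3) * tensor (rescale x m F) z = (\<Prod>i\<in>UNIV. u i m)" for m
    unfolding u_def prod.distrib tensor_def rescale_def by (simp add: power_inverse)
  have "((\<lambda>m. \<Prod>i\<in>UNIV. u i m) has_real_derivative (\<Sum>i\<in>UNIV. u' i l * (\<Prod>j\<in>UNIV-{i}. u j l))) (at l)"
    by (rule has_field_derivative_prod) (rule du)
  moreover have "u' i l * (\<Prod>j\<in>UNIV-{i}. u j l)
      = - inverse (l ^ 4) * tensor (rescale x l (F(i := deriv (\<lambda>y. y * F i y)))) z" for i
  proof -
    have "tensor (rescale x l (F(i := deriv (\<lambda>y. y * F i y)))) z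
        = deriv (\<lambda>y. y * F i y) ((z$i - x$i) / l) * (\<Prod>j\<in>UNIV-{i}. F j ((z$j - x$j) / l))"
      by (subst tensor_split[of _ _ i]) (auto simp: rescale_def Compl_eq_Diff_UNIV intro!: prod.cong)
    moreover have "(\<Prod>j\<in>UNIV-{i}. u j l) = inverse l ^ 2 * (\<Prod>j\<in>UNIV-{i}. F j ((z$j - x$j) / l))"
      unfolding u_def prod.distrib by (simp add: card_Diff_singleton)
    ultimately show ?thesis
      by (simp add: u'_def power_inverse field_simps power2_eq_square power4_eq_xxxx)
  qed
  ultimately show ?thesis unfolding eq by (simp add: sum_distrib_left)
qed

text \<open>Formally the derivative of f (x + l y) in l is the sum of y_i times the i-th partial
  derivative of f. The coordinate y_i is absorbed into the i-th factor, so the outcome consists of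
  averages of the same kind and the step can be repeated.\<close>

lemma avg_deriv:
  assumes S: "open S" and F: "inward S x p q F" and l: "0 < l" "l < 1"
    and f: "\<And>i. tensor_deriv S i f (d i)"
  shows "((\<lambda>l. avg S x f F l) has_real_derivative
    (\<Sum>i\<in>UNIV. avg S x (d i) (F(i := (\<lambda>y. y * F i y))) l)) (at l)"
proof -
  have SL: "S \<in> sets lebesgue" using S by auto
  define M where "M = lebesgue_on S"
  have fL: "f \<in> L2 M" using f[of 1] by (simp add: tensor_deriv_def M_def)
  have fli: "locally_integrable S f" using L2_locally_integrable[OF S] fL by (simp add: M_def)
  define G where "G i = F(i := deriv (\<lambda>y. y * F i y))" for i
  have G: "inward S x p q (G i)" for i
    using inward_deriv[OF inward_mult_id[OF F, of i], of i] by (simp add: G_def)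
  have "\<exists>C>0. \<forall>y. \<bar>tensor (G i) y\<bar> \<le> C" for i using inward_bounded[OF G[of i]] by metis
  then obtain C where C: "\<And>i. C i > 0" "\<And>i y. \<bar>tensor (G i) y\<bar> \<le> C i" by metis
  \<comment> \<open>A compact subset of S containing the supports of all kernels with scale in (l/2,
    1]; it carries the dominating function.\<close>
  define B where "B = (\<lambda>(m, y). x + m *\<^sub>R y) ` ({l/2..1} \<times> cbox p q)"
  have Bc: "compact B" unfolding B_def
    by (intro compact_continuous_image compact_Times) (auto intro!: continuous_intros simp: split_def)
  have BS: "B \<subseteq> S" using F l by (auto simp: B_def inward_def)
  have BI: "z \<in> B" if "z \<in> cbox (x + m *\<^sub>R p) (x + m *\<^sub>R q)" "l/2 < m" "m \<le> 1" for m z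
  proof -
    have m: "m > 0" using that l by simp
    have "inverse m *\<^sub>R (z - x) \<in> cbox p q"
      using that(1) m by (auto simp: mem_box_cart field_simps)
    moreover have "z = x + m *\<^sub>R (inverse m *\<^sub>R (z - x))" using m by simp
    ultimately show ?thesis unfolding B_def using that by (intro image_eqI[of _ _ "(m, inverse m *\<^sub>R (z - x))"]) auto
  qed
  define k where "k m z = f z * (inverse (m ^ 3) * tensor (rescale x m F) z)" for m z
  define k' where "k' m z = f z * (- inverse (m ^ 4) * (\<Sum>i\<in>UNIV. tensor (rescale x m (G i)) z))" for m z
  define K where "K = inverse ((l/2) ^ 4) * (\<Sum>i\<in>UNIV. C i)"
  have ti: "integrable M (\<lambda>z. f z * tensor (rescale x m H) z)" if "inward S x p q H" "0 < m" "m \<le> 1" for m H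
    unfolding M_def by (rule locally_integrable_tensor[OF fli SL rescale_test[OF that]])
  have "((\<lambda>m. \<integral>z. k m z \<partial>M) has_real_derivative (\<integral>z. k' l z \<partial>M)) (at l)"
  proof (rule DERIV_integral_parameter[where U = "{l/2<..<1}" and g = "\<lambda>z. \<bar>f z\<bar> * (K * indicator B z)"])
    show "integrable M (k m)" if "m \<in> {l/2<..<1}" for m
    proof -
      have "integrable M (\<lambda>z. inverse (m ^ 3) * (f z * tensor (rescale x m F) z))"
        using that l by (intro integrable_mult_right ti[OF F]) auto
      then show ?thesis unfolding k_def[abs_def] by (simp only: mult.left_commute)
    qed
    show "((\<lambda>m. k m z) has_real_derivative k' m z) (at m)" if "m \<in> {l/2<..<1}" for m z
      unfolding k_def k'_def G_def
      using that l by (intro DERIV_cmult rescale_deriv[OF F]) auto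
    show "\<bar>k' m z\<bar> \<le> \<bar>f z\<bar> * (K * indicator B z)" if "m \<in> {l/2<..<1}" for m z
    proof -
      have m: "l/2 < m" "m \<le> 1" "m > 0" using that l by auto
      have "\<bar>tensor (rescale x m (G i)) z\<bar> \<le> C i * indicator B z" for i
      proof -
        let ?Q = "cbox (x + m *\<^sub>R p) (x + m *\<^sub>R q)"
        have "indicator ?Q z \<le> (indicator B z :: real)" using BI[of z m] m by (auto simp: indicator_def)
        from mult_left_mono[OF this less_imp_le[OF C(1)[of i]]] rescale_bounded[OF G m(3) C(2), of i z]
        show ?thesis by (rule order_trans[rotated])
      qed
      then have "\<bar>\<Sum>i\<in>UNIV. tensor (rescale x m (G i)) z\<bar> \<le> (\<Sum>i\<in>UNIV. C i * indicator B z)"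
        by (intro order_trans[OF sum_abs] sum_mono)
      also have "\<dots> = (\<Sum>i\<in>UNIV. C i) * indicator B z" by (simp add: sum_distrib_right)
      finally have "\<bar>\<Sum>i\<in>UNIV. tensor (rescale x m (G i)) z\<bar> \<le> (\<Sum>i\<in>UNIV. C i) * indicator B z" .
      moreover have "inverse (m ^ 4) \<le> inverse ((l/2) ^ 4)"
        using m l by (intro le_imp_inverse_le power_mono) auto
      ultimately have "inverse (m ^ 4) * \<bar>\<Sum>i\<in>UNIV. tensor (rescale x m (G i)) z\<bar> \<le> K * indicator B z"
        unfolding K_def mult.assoc using m l by (intro mult_mono) auto
      then have "\<bar>f z\<bar> * (inverse (m ^ 4) * \<bar>\<Sum>i\<in>UNIV. tensor (rescale x m (G i)) z\<bar>) \<le> \<bar>f z\<bar> * (K * indicator B z)"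
        by (intro mult_left_mono) auto
      then show ?thesis using m by (simp add: k'_def abs_mult)
    qed
    have "integrable M (\<lambda>z. f z * (K * indicator B z))"
      unfolding M_def
      by (rule locally_integrable_test[OF fli Bc BS SL, of _ "\<bar>K\<bar>"])
         (use Bc in \<open>auto intro!: borel_measurable_indicator borel_measurable_times simp: compact_imp_closed borel_closed simp del: indicator_def, auto simp: indicator_def\<close>)
    from integrable_abs[OF this] show "integrable M (\<lambda>z. \<bar>f z\<bar> * (K * indicator B z))"
    proof (rule Bochner_Integration.integrable_cong[THEN iffD1, rotated -1])
      have "K \<ge> 0" unfolding K_def using l C(1) by (intro mult_nonneg_nonneg sum_nonneg) (auto intro: less_imp_le)
      then show "\<bar>f z * (K * indicator B z)\<bar> = \<bar>f z\<bar> * (K * indicator B z)" for z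
        by (simp add: abs_mult)
    qed auto
    show "k' l \<in> borel_measurable M"
    proof -
      have "smooth1 (rescale x l (G i) j)" for i j
        using G by (intro smooth1_rescale) (auto simp: inward_def)
      then have "tensor (rescale x l (G i)) \<in> borel_measurable M" for i
        unfolding M_def
        by (intro measurable_restrict_space1 borel_measurable_lebesgueI tensor_measurable)
      then show ?thesis unfolding k'_def[abs_def] using fL L2_measurable by measurable
    qed
  qed (use l in auto)
  moreover have "(\<integral>z. k m z \<partial>M) = avg S x f F m" for m
    unfolding k_def avg_def M_def
    by (subst integral_mult_right_zero[symmetric]) (simp only: mult.left_commute)
  moreover have "(\<integral>z. k' l z \<partial>M) = (\<Sum>i\<in>UNIV. avg S x (d i) (F(i := (\<lambda>y. y * F i y))) l)"
  proof -
    define H where "H i = rescale x l (F(i := (\<lambda>y. y * F i y)))" for i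
    have H: "tensor_test S (H i)" for i
      unfolding H_def using l by (intro rescale_test[OF inward_mult_id[OF F]]) auto
    have dH: "deriv (H i i) y = inverse l * deriv (\<lambda>y. y * F i y) ((y - x$i) / l)" for i y
    proof (rule DERIV_imp_deriv)
      have s: "smooth1 (\<lambda>y. y * F i y)" using F by (auto simp: inward_def)
      have "((\<lambda>y. (y - x$i) / l) has_real_derivative inverse l) (at y)"
        using l by (auto intro!: derivative_eq_intros simp: field_simps)
      from DERIV_chain2[OF smooth1_deriv[OF s] this]
      show "(H i i has_real_derivative inverse l * deriv (\<lambda>y. y * F i y) ((y - x$i) / l)) (at y)"
        by (simp add: H_def rescale_def mult.commute)
    qed
    \<comment> \<open>The factor l of the chain rule turns the l^-4 of \<open>rescale_deriv\<close>
      into the l^-3 in \<open>avg\<close>.\<close>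
    have T: "tensor (rescale x l (G i)) z = l * tensor ((H i)(i := deriv (H i i))) z" for i z
    proof -
      have "tensor (rescale x l (G i)) z = deriv (\<lambda>y. y * F i y) ((z$i - x$i) / l) * (\<Prod>j\<in>-{i}. F j ((z$j - x$j) / l))"
        by (subst tensor_split[of _ _ i]) (auto simp: rescale_def G_def intro!: prod.cong)
      moreover have "tensor ((H i)(i := deriv (H i i))) z = deriv (H i i) (z$i) * (\<Prod>j\<in>-{i}. F j ((z$j - x$j) / l))"
        by (subst tensor_split[of _ _ i]) (auto simp: rescale_def H_def intro!: prod.cong)
      ultimately show ?thesis using l by (simp add: dH)
    qed
    have i1: "integrable M (\<lambda>z. f z * tensor (rescale x l (G i)) z)" for i
      using ti[OF G] l by simp
    have "(\<integral>z. k' l z \<partial>M) = (\<integral>z. - inverse (l ^ 4) * (\<Sum>i\<in>UNIV. f z * tensor (rescale x l (G i)) z) \<partial>M)"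
      by (simp add: k'_def sum_distrib_left mult.left_commute)
    also have "\<dots> = - inverse (l ^ 4) * (\<Sum>i\<in>UNIV. \<integral>z. f z * tensor (rescale x l (G i)) z \<partial>M)"
      unfolding integral_mult_right_zero using i1 by (subst Bochner_Integration.integral_sum) auto
    also have "\<dots> = (\<Sum>i\<in>UNIV. - inverse (l ^ 4) * (\<integral>z. f z * tensor (rescale x l (G i)) z \<partial>M))"
      by (rule sum_distrib_left)
    also have "\<dots> = (\<Sum>i\<in>UNIV. avg S x (d i) (F(i := (\<lambda>y. y * F i y))) l)"
    proof (rule sum.cong[OF refl])
      fix i
      have "(\<integral>z. f z * tensor (rescale x l (G i)) z \<partial>M) = l * (\<integral>z. f z * tensor ((H i)(i := deriv (H i i))) z \<partial>M)"
        unfolding T by (simp add: mult.left_commute)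
      also have "\<dots> = - l * (\<integral>z. d i z * tensor (H i) z \<partial>M)"
        using f[of i] H[of i] by (simp add: tensor_deriv_def M_def)
      finally show "- inverse (l ^ 4) * (\<integral>z. f z * tensor (rescale x l (G i)) z \<partial>M) = avg S x (d i) (F(i := (\<lambda>y. y * F i y))) l"
        using l by (simp add: avg_def H_def M_def field_simps power3_eq_cube power4_eq_xxxx)
    qed
    finally show ?thesis .
  qed
  ultimately show ?thesis by simp
qed

lemma L2_indicator_bounded:
  assumes S: "S \<in> sets lebesgue" and T: "T \<in> borel_measurable (lebesgue_on S)"
    and bd: "\<And>z. \<bar>T z\<bar> \<le> C * indicator (cbox u v) z" and sub: "cbox u v \<subseteq> S" and C: "C \<ge> 0"
  shows "T \<in> L2 (lebesgue_on S)" "L2norm (lebesgue_on S) T \<le> C * sqrt (measure lebesgue (cbox u v))"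
    "integrable (lebesgue_on S) (\<lambda>z. indicat_real (cbox u v) z)"
    "(\<integral>z. indicat_real (cbox u v) z \<partial>lebesgue_on S) = measure lebesgue (cbox u v)"
proof -
  have e: "(\<lambda>z. indicator S z * indicator (cbox u v) z) = (indicator (cbox u v) :: _ \<Rightarrow> real)"
    using sub by (auto simp: fun_eq_iff indicator_def)
  have lc: "integrable lebesgue (indicat_real (cbox u v))"
    using lmeasurable_compact[of "cbox u v"] by (simp add: lmeasurable_iff_integrable)
  show i1: "integrable (lebesgue_on S) (\<lambda>z. indicat_real (cbox u v) z)"
    using S lc by (simp add: integrable_restrict_space e)
  show i2: "(\<integral>z. indicat_real (cbox u v) z \<partial>lebesgue_on S) = measure lebesgue (cbox u v)"
    using S by (subst integral_restrict_space) (simp_all add: e)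
  have le: "(T z)\<^sup>2 \<le> C\<^sup>2 * indicator (cbox u v) z" for z
    using power_mono[OF bd[of z], of 2] by (auto simp: indicator_def split: if_splits)
  have i3: "integrable (lebesgue_on S) (\<lambda>z. C\<^sup>2 * indicator (cbox u v) z)"
    using i1 by (rule integrable_mult_right)
  show T2: "T \<in> L2 (lebesgue_on S)"
    unfolding L2_def using T
    by (auto intro!: Bochner_Integration.integrable_bound[OF i3] order_trans[OF le])
  have "(\<integral>z. (T z)\<^sup>2 \<partial>lebesgue_on S) \<le> (\<integral>z. C\<^sup>2 * indicator (cbox u v) z \<partial>lebesgue_on S)"
    using L2_integrable_power2[OF T2] i3 le by (intro integral_mono) auto
  also have "\<dots> = C\<^sup>2 * measure lebesgue (cbox u v)" using i2 by simp
  finally have "L2norm (lebesgue_on S) T \<le> sqrt (C\<^sup>2 * measure lebesgue (cbox u v))"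
    unfolding L2norm_def by (rule real_sqrt_le_mono)
  then show "L2norm (lebesgue_on S) T \<le> C * sqrt (measure lebesgue (cbox u v))"
    using C by (simp add: real_sqrt_mult)
qed

lemma measure_cbox_rescale:
  fixes x p q :: "real^3"
  assumes "l > 0"
  shows "measure lebesgue (cbox (x + l *\<^sub>R p) (x + l *\<^sub>R q)) = l ^ 3 * measure lebesgue (cbox p q)"
proof (cases "cbox p q = {}")
  case True
  then have "cbox (x + l *\<^sub>R p) (x + l *\<^sub>R q) = {}"
    using assms by (auto simp: interval_eq_empty_cart)
  with True show ?thesis by simp
next
  case False
  have "(\<lambda>y. l *\<^sub>R y + x) ` cbox p q = cbox (l *\<^sub>R p + x) (l *\<^sub>R q + x)"
    using image_affinity_cbox[of l x p q] False assms by simp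
  with content_image_affinity_cbox[of l x p q] assms show ?thesis
    by (simp add: add.commute power3_eq_cube mult.assoc)
qed

text \<open>The support has volume l^3 times that of the unscaled box; Cauchy-Schwarz gains its
  square root against the normalising factor l^-3 and leaves l^(-3/2).\<close>

lemma avg_bound:
  assumes S: "open S" and F: "inward S x p q F" and l: "0 < l" "l \<le> 1"
    and d: "d \<in> L2 (lebesgue_on S)" "L2norm (lebesgue_on S) d \<le> N"
    and C: "\<And>y. \<bar>tensor F y\<bar> \<le> C" "C \<ge> 0"
  shows "\<bar>avg S x d F l\<bar> \<le> C * sqrt (measure lebesgue (cbox p q)) * N * inverse (l * sqrt l)"
proof -
  have SL: "S \<in> sets lebesgue" using S by auto
  define V where "V = measure lebesgue (cbox p q)"
  define T where "T = tensor (rescale x l F)"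
  have "smooth1 (rescale x l F j)" for j
    using F by (intro smooth1_rescale) (auto simp: inward_def)
  then have Tm: "T \<in> borel_measurable (lebesgue_on S)"
    unfolding T_def by (intro measurable_restrict_space1 borel_measurable_lebesgueI tensor_measurable)
  have sub: "cbox (x + l *\<^sub>R p) (x + l *\<^sub>R q) \<subseteq> S"
  proof
    fix z assume z: "z \<in> cbox (x + l *\<^sub>R p) (x + l *\<^sub>R q)"
    have "inverse l *\<^sub>R (z - x) \<in> cbox p q"
      using z \<open>0 < l\<close> by (auto simp: mem_box_cart field_simps)
    then have "x + l *\<^sub>R (inverse l *\<^sub>R (z - x)) \<in> S" using F l unfolding inward_def by blast
    then show "z \<in> S" using \<open>0 < l\<close> by simp
  qed
  have T: "T \<in> L2 (lebesgue_on S)" "L2norm (lebesgue_on S) T \<le> C * sqrt (l ^ 3 * V)"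
    using L2_indicator_bounded[OF SL Tm _ sub C(2)] rescale_bounded[OF F l(1) C(1)]
    unfolding measure_cbox_rescale[OF l(1)] V_def T_def by blast+
  have s: "sqrt (l ^ 3 * V) = l * sqrt l * sqrt V"
    using l by (simp add: real_sqrt_mult power3_eq_cube mult.assoc)
  have "\<bar>\<integral>z. d z * T z \<partial>lebesgue_on S\<bar> \<le> N * (C * (l * sqrt l * sqrt V))"
    using L2_Cauchy_Schwarz[OF d(1) T(1)] mult_mono[OF d(2) T(2)] L2norm_nonneg order_trans[OF L2norm_nonneg d(2)]
    unfolding s by fastforce
  then have "inverse (l ^ 3) * \<bar>\<integral>z. d z * T z \<partial>lebesgue_on S\<bar> \<le> inverse (l ^ 3) * (N * (C * (l * sqrt l * sqrt V)))"
    using l by (intro mult_left_mono) auto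
  also have "\<dots> = C * sqrt V * N * inverse (l * sqrt l)"
  proof -
    define k where "k = l * sqrt l"
    have k: "k > 0" "l ^ 3 = k * k" using l by (auto simp: k_def power3_eq_cube)
    then show ?thesis unfolding k_def[symmetric] k(2) by (simp add: field_simps)
  qed
  finally have "\<bar>inverse (l ^ 3) * (\<integral>z. d z * T z \<partial>lebesgue_on S)\<bar> \<le> C * sqrt V * N * inverse (l * sqrt l)"
    using l by (simp only: abs_mult abs_of_pos zero_less_power positive_imp_inverse_positive)
  then show ?thesis unfolding avg_def T_def V_def .
qed

text \<open>Both h + F and h - F are nonincreasing. An explicit majorant h replaces the integration
  of F' near 0.\<close>

lemma derivative_comparison:
  fixes F h :: "real \<Rightarrow> real"
  assumes l: "0 < l" "l \<le> b"
    and F: "\<And>t. 0 < t \<Longrightarrow> t \<le> b \<Longrightarrow> (F has_real_derivative F' t) (at t)"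
    and h: "\<And>t. 0 < t \<Longrightarrow> t \<le> b \<Longrightarrow> (h has_real_derivative h' t) (at t)"
    and le: "\<And>t. 0 < t \<Longrightarrow> t \<le> b \<Longrightarrow> \<bar>F' t\<bar> \<le> - h' t"
  shows "\<bar>F l - F b\<bar> \<le> h l - h b"
proof -
  have "h b + F b \<le> h l + F l"
  proof (rule DERIV_nonpos_imp_nonincreasing[OF l(2)])
    fix t assume t: "l \<le> t" "t \<le> b"
    show "\<exists>y. ((\<lambda>t. h t + F t) has_real_derivative y) (at t) \<and> y \<le> 0"
      using DERIV_add[OF h[of t] F[of t]] le[of t] t l by (intro exI[of _ "h' t + F' t"]) auto
  qed
  moreover have "h b - F b \<le> h l - F l"
  proof (rule DERIV_nonpos_imp_nonincreasing[OF l(2)])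
    fix t assume t: "l \<le> t" "t \<le> b"
    show "\<exists>y. ((\<lambda>t. h t - F t) has_real_derivative y) (at t) \<and> y \<le> 0"
      using DERIV_diff[OF h[of t] F[of t]] le[of t] t l by (intro exI[of _ "h' t - F' t"]) auto
  qed
  ultimately show ?thesis by linarith
qed

text \<open>Two integrations of C t^(-3/2) downwards from 1/2: the majorant 2 C t^(-1/2) controls
  a', and 4 C t^(1/2), which stays bounded at 0, controls a. The base point 1/2 lies inside the
  range l < 1 of \<open>avg_deriv\<close>.\<close>

lemma second_derivative_bound:
  fixes a :: "real \<Rightarrow> real"
  assumes a: "\<And>t. 0 < t \<Longrightarrow> t \<le> 1/2 \<Longrightarrow> (a has_real_derivative a' t) (at t)"
    and a': "\<And>t. 0 < t \<Longrightarrow> t \<le> 1/2 \<Longrightarrow> (a' has_real_derivative a'' t) (at t)"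
    and C: "\<And>t. 0 < t \<Longrightarrow> t \<le> 1/2 \<Longrightarrow> \<bar>a'' t\<bar> \<le> C * inverse (t * sqrt t)" "C \<ge> 0"
    and l: "0 < l" "l \<le> 1/2"
  shows "\<bar>a l\<bar> \<le> \<bar>a (1/2)\<bar> + \<bar>a' (1/2)\<bar> + 4 * C"
proof -
  have 1: "\<bar>a' t\<bar> \<le> \<bar>a' (1/2)\<bar> + 2 * C * inverse (sqrt t)" if t: "0 < t" "t \<le> 1/2" for t
  proof -
    have "\<bar>a' t - a' (1/2)\<bar> \<le> 2 * C * inverse (sqrt t) - 2 * C * inverse (sqrt (1/2))"
    proof (rule derivative_comparison[OF t a', where h' = "\<lambda>t. - (C * inverse (t * sqrt t))"])
      fix s :: real assume s: "0 < s" "s \<le> 1/2"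
      have r: "(sqrt has_real_derivative inverse (sqrt s) / 2) (at s)"
        by (rule DERIV_real_sqrt[OF s(1)])
      have "((\<lambda>t. inverse (sqrt t)) has_real_derivative - (inverse (sqrt s) / 2) * inverse ((sqrt s)\<^sup>2)) (at s)"
        using DERIV_inverse_fun[OF r] s by (simp add: power2_eq_square)
      from DERIV_cmult[OF this, of "2 * C"]
      show "((\<lambda>t. 2 * C * inverse (sqrt t)) has_real_derivative - (C * inverse (s * sqrt s))) (at s)"
        by (rule DERIV_cong) (use s in \<open>simp add: field_simps\<close>)
      show "\<bar>a'' s\<bar> \<le> - (- (C * inverse (s * sqrt s)))" using C(1)[OF s] by simp
    qed auto
    moreover have "0 \<le> 2 * C * inverse (sqrt (1/2))" using C by simp
    ultimately show ?thesis by linarith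
  qed
  let ?h = "\<lambda>t. - (\<bar>a' (1/2)\<bar> * t + 4 * C * sqrt t)"
  have "\<bar>a l - a (1/2)\<bar> \<le> ?h l - ?h (1/2)"
  proof (rule derivative_comparison[OF l a, where h' = "\<lambda>t. - (\<bar>a' (1/2)\<bar> + 2 * C * inverse (sqrt t))"])
    fix s :: real assume s: "0 < s" "s \<le> 1/2"
    have "((\<lambda>t. \<bar>a' (1/2)\<bar> * t + 4 * C * sqrt t) has_real_derivative \<bar>a' (1/2)\<bar> * 1 + 4 * C * (inverse (sqrt s) / 2)) (at s)"
      by (intro DERIV_add DERIV_cmult DERIV_real_sqrt DERIV_ident s)
    from DERIV_minus[OF this]
    show "(?h has_real_derivative - (\<bar>a' (1/2)\<bar> + 2 * C * inverse (sqrt s))) (at s)"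
      by (rule DERIV_cong) simp
    show "\<bar>a' s\<bar> \<le> - (- (\<bar>a' (1/2)\<bar> + 2 * C * inverse (sqrt s)))" using 1[OF s] by simp
  qed auto
  moreover have "?h l - ?h (1/2) \<le> \<bar>a' (1/2)\<bar> + 4 * C"
  proof -
    have "\<bar>a' (1/2)\<bar> * (1/2) \<le> \<bar>a' (1/2)\<bar>" "0 \<le> \<bar>a' (1/2)\<bar> * l" "0 \<le> 4 * C * sqrt l"
      using l C by auto
    moreover have "4 * C * sqrt (1/2) \<le> 4 * C * 1"
      using C by (intro mult_left_mono) (auto simp: real_sqrt_le_1_iff)
    ultimately show ?thesis by linarith
  qed
  ultimately show ?thesis by linarith
qed

text \<open>Two derivatives in l of the average cost two derivatives of f; by Cauchy-Schwarz on a set of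
  volume \<open>l\<^sup>3\<close> the second one is \<open>O(l powr (- 3/2))\<close>, which is twice integrable at 0.\<close>

lemma avg_sup:
  fixes F :: "3 \<Rightarrow> real \<Rightarrow> real"
  obtains K where "K \<ge> 0"
    "\<And>S x f d1 d2 N l. open S \<Longrightarrow> inward S x p q F \<Longrightarrow> (\<And>i. tensor_deriv S i f (d1 i)) \<Longrightarrow>
      (\<And>i j. tensor_deriv S j (d1 i) (d2 i j)) \<Longrightarrow> L2norm (lebesgue_on S) f \<le> N \<Longrightarrow>
      (\<And>i. L2norm (lebesgue_on S) (d1 i) \<le> N) \<Longrightarrow> (\<And>i j. L2norm (lebesgue_on S) (d2 i j) \<le> N) \<Longrightarrow>
      0 < l \<Longrightarrow> l \<le> 1/2 \<Longrightarrow> \<bar>avg S x f F l\<bar> \<le> K * N"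
\<comment> \<open>If no S and x fit, the claim is vacuous. Otherwise one instance yields the bounds
  on F and on its products with coordinates, which involve neither S nor x.\<close>
proof (cases "\<exists>S x. inward S x p q F")
  case False
  then show ?thesis by (intro that[of 0]) auto
next
  case True
  define F1 where "F1 i = F(i := (\<lambda>y. y * F i y))" for i
  define F2 where "F2 i j = (F1 i)(j := (\<lambda>y. y * F1 i j y))" for i j
  have in1: "inward S x p q (F1 i)" and in2: "inward S x p q (F2 i j)" if "inward S x p q F" for S x i j
    unfolding F2_def F1_def using that by (intro inward_mult_id; assumption)+
  obtain C0 where C0: "C0 > 0" "\<And>y. \<bar>tensor F y\<bar> \<le> C0" using inward_bounded True by metis
  have "\<exists>C>0. \<forall>y. \<bar>tensor (F1 i) y\<bar> \<le> C" for i using inward_bounded in1 True by metis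
  then obtain C1 where C1: "\<And>i. C1 i > 0" "\<And>i y. \<bar>tensor (F1 i) y\<bar> \<le> C1 i" by metis
  have "\<exists>C>0. \<forall>y. \<bar>tensor (F2 i j) y\<bar> \<le> C" for i j using inward_bounded in2 True by metis
  then obtain C2 where C2: "\<And>i j. C2 i j > 0" "\<And>i j y. \<bar>tensor (F2 i j) y\<bar> \<le> C2 i j" by metis
  define V where "V = sqrt (measure lebesgue (cbox p q))"
  define h where "h = inverse (1/2 * sqrt (1/2) :: real)"
  define K where "K = C0 * V * h + (\<Sum>i\<in>UNIV. C1 i * V * h) + 4 * (\<Sum>i\<in>UNIV. \<Sum>j\<in>UNIV. C2 i j * V)"
  have V0: "V \<ge> 0" "h \<ge> 0" by (auto simp: V_def h_def)
  show ?thesis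
  proof (rule that[of K])
    show "K \<ge> 0" unfolding K_def using V0 C0(1) C1(1) C2(1)
      by (intro add_nonneg_nonneg sum_nonneg mult_nonneg_nonneg) (auto intro: less_imp_le)
    fix S x f d1 d2 N l
    assume S: "open S" and F: "inward S x p q F" and f: "\<And>i. tensor_deriv S i f (d1 i)"
      and d1: "\<And>i j. tensor_deriv S j (d1 i) (d2 i j)" and N: "L2norm (lebesgue_on S) f \<le> N"
      "\<And>i. L2norm (lebesgue_on S) (d1 i) \<le> N" "\<And>i j. L2norm (lebesgue_on S) (d2 i j) \<le> N"
      and l: "0 < l" "l \<le> (1/2::real)"
    have L2: "f \<in> L2 (lebesgue_on S)" "d1 i \<in> L2 (lebesgue_on S)" "d2 i j \<in> L2 (lebesgue_on S)" for i j
      using f[of i] d1[of j i] by (auto simp: tensor_deriv_def)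
    have N0: "N \<ge> 0" using N(1) L2norm_nonneg order_trans by blast
    let ?a' = "\<lambda>t. \<Sum>i\<in>UNIV. avg S x (d1 i) (F1 i) t"
    let ?a'' = "\<lambda>t. \<Sum>i\<in>UNIV. \<Sum>j\<in>UNIV. avg S x (d2 i j) (F2 i j) t"
    have "\<bar>avg S x f F l\<bar> \<le> \<bar>avg S x f F (1/2)\<bar> + \<bar>?a' (1/2)\<bar> + 4 * ((\<Sum>i\<in>UNIV. \<Sum>j\<in>UNIV. C2 i j * V) * N)"
    proof (rule second_derivative_bound[OF _ _ _ _ l, where a'' = ?a''])
      fix t :: real assume t: "0 < t" "t \<le> 1/2"
      show "(avg S x f F has_real_derivative ?a' t) (at t)"
        using avg_deriv[OF S F t(1) _ f] t unfolding F1_def by simp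
      show "(?a' has_real_derivative ?a'' t) (at t)"
        using avg_deriv[OF S in1[OF F] t(1) _ d1] t unfolding F2_def by (intro DERIV_sum) simp
      have "\<bar>?a'' t\<bar> \<le> (\<Sum>i\<in>UNIV. \<Sum>j\<in>UNIV. C2 i j * V * N * inverse (t * sqrt t))"
        using avg_bound[OF S in2[OF F] t(1) _ L2(3) N(3) C2(2) less_imp_le[OF C2(1)]] t unfolding V_def
        by (intro order_trans[OF sum_abs] sum_mono) auto
      then show "\<bar>?a'' t\<bar> \<le> (\<Sum>i\<in>UNIV. \<Sum>j\<in>UNIV. C2 i j * V) * N * inverse (t * sqrt t)"
        by (simp add: sum_distrib_right)
    next
      show "0 \<le> (\<Sum>i\<in>UNIV. \<Sum>j\<in>UNIV. C2 i j * V) * N"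
        using V0 C2(1) N0 by (intro mult_nonneg_nonneg sum_nonneg) (auto intro: less_imp_le)
    qed
    moreover have "\<bar>avg S x f F (1/2)\<bar> \<le> C0 * V * h * N"
      using avg_bound[OF S F _ _ L2(1) N(1) C0(2) less_imp_le[OF C0(1)], of "1/2"]
      by (simp add: V_def h_def mult_ac)
    moreover have "\<bar>?a' (1/2)\<bar> \<le> (\<Sum>i\<in>UNIV. C1 i * V * h * N)"
      using avg_bound[OF S in1[OF F] _ _ L2(2) N(2) C1(2) less_imp_le[OF C1(1)], of "1/2"]
      by (intro order_trans[OF sum_abs] sum_mono) (simp add: V_def h_def mult_ac)
    ultimately show "\<bar>avg S x f F l\<bar> \<le> K * N"
      by (simp add: K_def distrib_right sum_distrib_right mult.assoc)
  qed
qed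

text \<open>At a small scale g stays within half of |g x| of g x on the support of the kernel, so
  the average is at least half of |g x| times the volume where the kernel is 1. A bound on averages
  becomes a bound on the continuous representative without a limit in l.\<close>

lemma avg_lower_bound:
  assumes S: "open S" and x: "x \<in> S" and F: "inward S x p q F"
    and F0: "\<And>y. 0 \<le> tensor F y" and F1: "\<And>y. y \<in> cbox p' q' \<Longrightarrow> tensor F y = 1"
    and sub: "cbox p' q' \<subseteq> cbox p q"
    and f: "f \<in> L2 (lebesgue_on S)" and g: "continuous_on S g" and ae: "AE z in lebesgue_on S. g z = f z"
    and B: "\<And>l. 0 < l \<Longrightarrow> l \<le> 1/2 \<Longrightarrow> \<bar>avg S x f F l\<bar> \<le> B"
  shows "\<bar>g x\<bar> * measure lebesgue (cbox p' q') \<le> 2 * B"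
proof (cases "g x = 0")
  case True
  then show ?thesis using B[of "1/2"] by simp
next
  case False
  have SL: "S \<in> sets lebesgue" using S by auto
  obtain e where e: "e > 0" "\<And>z. z \<in> S \<Longrightarrow> dist z x < e \<Longrightarrow> dist (g z) (g x) < \<bar>g x\<bar> / 2"
    using g x False unfolding continuous_on_iff by (metis half_gt_zero zero_less_abs_iff)
  obtain R where R: "R > 0" "\<And>y. y \<in> cbox p q \<Longrightarrow> norm y \<le> R"
    using bounded_cbox[of p q] bounded_pos by metis
  define l where "l = min (1/2) (e / (2 * R))"
  have l: "0 < l" "l \<le> 1/2" "l \<le> 1" "l * R < e"
    using e(1) R(1) by (auto simp: l_def min_def field_simps)
  define s where "s = sgn (g x)"
  define T where "T = tensor (rescale x l F)"
  have T: "T z = tensor F (inverse l *\<^sub>R (z - x))" for z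
    by (simp add: T_def tensor_def rescale_def divide_inverse mult.commute)
  have near: "s * g z \<ge> \<bar>g x\<bar> / 2" "z \<in> S" if y: "inverse l *\<^sub>R (z - x) \<in> cbox p q" for z
  proof -
    have z: "z = x + l *\<^sub>R (inverse l *\<^sub>R (z - x))" using l by simp
    show zS: "z \<in> S" using F y l unfolding inward_def by (subst z) blast
    have "dist z x = l * norm (inverse l *\<^sub>R (z - x))" using l by (simp add: dist_norm)
    also have "\<dots> \<le> l * R" using R(2)[OF y] l by (intro mult_left_mono) auto
    finally have "dist (g z) (g x) < \<bar>g x\<bar> / 2" using l e(2)[OF zS] by linarith
    then show "s * g z \<ge> \<bar>g x\<bar> / 2"
      by (auto simp: s_def dist_real_def sgn_if abs_if split: if_splits)
  qed
  have T0: "T z = 0" if "inverse l *\<^sub>R (z - x) \<notin> cbox p q" for z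
  proof -
    obtain i where "(inverse l *\<^sub>R (z - x)) $ i \<notin> {p$i..q$i}" using \<open>_ \<notin> cbox p q\<close> by (auto simp: mem_box_cart)
    then show ?thesis unfolding T using F by (subst tensor_split[of _ _ i]) (auto simp: inward_def)
  qed
  have iff: "z \<in> cbox (x + l *\<^sub>R u) (x + l *\<^sub>R v) \<longleftrightarrow> inverse l *\<^sub>R (z - x) \<in> cbox u v" for z u v
    using l by (auto simp: mem_box_cart field_simps)
  let ?Q = "cbox (x + l *\<^sub>R p') (x + l *\<^sub>R q')"
  have QS: "?Q \<subseteq> S" using near(2) sub iff by blast
  have fT: "integrable (lebesgue_on S) (\<lambda>z. f z * T z)"
    unfolding T_def using l
    by (intro locally_integrable_tensor L2_locally_integrable S f SL rescale_test[OF F])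
  have ind: "integrable (lebesgue_on S) (\<lambda>z. indicat_real ?Q z)"
    "(\<integral>z. indicat_real ?Q z \<partial>lebesgue_on S) = measure lebesgue ?Q"
    using L2_indicator_bounded(3,4)[OF SL _ _ QS, of "\<lambda>_. 0" 0] by auto
  have pt: "\<bar>g x\<bar> / 2 * indicator ?Q z \<le> s * (g z * T z)" for z
  proof (cases "inverse l *\<^sub>R (z - x) \<in> cbox p q")
    case True
    have "0 \<le> T z" using F0 by (simp add: T)
    have "\<bar>g x\<bar> / 2 * T z \<le> s * g z * T z" using near(1)[OF True] \<open>0 \<le> T z\<close> by (rule mult_right_mono)
    moreover have "indicator ?Q z \<le> T z" using F1 \<open>0 \<le> T z\<close> unfolding indicator_def iff by (auto simp: T)
    ultimately show ?thesis using mult_left_mono[of "indicator ?Q z" "T z" "\<bar>g x\<bar> / 2"] by simp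
  next
    case False
    then have "indicator ?Q z = (0::real)" using sub iff[of z p' q'] by auto
    then show ?thesis using T0[OF False] by simp
  qed
  have "\<bar>g x\<bar> / 2 * measure lebesgue ?Q = (\<integral>z. \<bar>g x\<bar> / 2 * indicator ?Q z \<partial>lebesgue_on S)"
    using ind(2) by simp
  also have "\<dots> \<le> (\<integral>z. s * (f z * T z) \<partial>lebesgue_on S)"
  proof (rule integral_mono_AE)
    show "AE z in lebesgue_on S. \<bar>g x\<bar> / 2 * indicator ?Q z \<le> s * (f z * T z)"
      using ae by eventually_elim (use pt in metis)
  qed (use ind(1) fT in \<open>auto intro!: integrable_mult_right\<close>)
  also have "\<dots> = s * (\<integral>z. f z * T z \<partial>lebesgue_on S)" by simp
  finally have "\<bar>g x\<bar> / 2 * (l ^ 3 * measure lebesgue (cbox p' q')) \<le> s * (\<integral>z. f z * T z \<partial>lebesgue_on S)"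
    unfolding measure_cbox_rescale[OF l(1)] .
  then have "inverse (l ^ 3) * (\<bar>g x\<bar> / 2 * (l ^ 3 * measure lebesgue (cbox p' q'))) \<le> s * avg S x f F l"
    using l unfolding avg_def T_def[symmetric]
    by (subst mult.left_commute, intro mult_left_mono) auto
  moreover have "inverse (l ^ 3) * (\<bar>g x\<bar> / 2 * (l ^ 3 * measure lebesgue (cbox p' q'))) = \<bar>g x\<bar> / 2 * measure lebesgue (cbox p' q')"
    using l by simp
  moreover have "s * avg S x f F l \<le> B"
    using B[OF l(1,2)] False by (auto simp: s_def sgn_if abs_le_iff)
  ultimately have "\<bar>g x\<bar> / 2 * measure lebesgue (cbox p' q') \<le> B" by (simp only:)
  then show ?thesis by simp
qed

text \<open>In units of h, and mirrored where \<sigma> is false, the factor is supported in [1, 4]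
  and equals 1 on [2, 3]: \<open>step s\<close> opens at 1 and \<open>step (5 - s)\<close> closes at
  4.\<close>

definition corner_bump :: "real \<Rightarrow> (3 \<Rightarrow> bool) \<Rightarrow> 3 \<Rightarrow> real \<Rightarrow> real" where
  "corner_bump h \<sigma> i y = (let s = (if \<sigma> i then y / h else - y / h) in step s * step (5 - s))"

lemma open_box_dom: "open (box_dom a)"
proof -
  have "box_dom a = {x. 0 < x$1} \<inter> {x. x$1 < a} \<inter> {x. 0 < x$2} \<inter> {x. x$2 < a} \<inter> {x. 0 < x$3}"
    by (auto simp: box_dom_def)
  then show ?thesis by (auto intro!: open_Int open_Collect_less continuous_intros)
qed

text \<open>The sup bound of the Sobolev embedding. Each point admits one of eight sign patterns
  \<sigma> for which the bump points into the box; adding the eight constants gives one that serves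
  all points.\<close>

lemma box_dom_sup_bound:
  assumes a: "a > 0"
  obtains K where "K \<ge> 0"
    "\<And>f d1 d2 N g x. (\<And>i. tensor_deriv (box_dom a) i f (d1 i)) \<Longrightarrow>
      (\<And>i j. tensor_deriv (box_dom a) j (d1 i) (d2 i j)) \<Longrightarrow> L2norm (lebesgue_on (box_dom a)) f \<le> N \<Longrightarrow>
      (\<And>i. L2norm (lebesgue_on (box_dom a)) (d1 i) \<le> N) \<Longrightarrow>
      (\<And>i j. L2norm (lebesgue_on (box_dom a)) (d2 i j) \<le> N) \<Longrightarrow>
      continuous_on (box_dom a) g \<Longrightarrow> (AE z in lebesgue_on (box_dom a). g z = f z) \<Longrightarrow>
      x \<in> box_dom a \<Longrightarrow> \<bar>g x\<bar> \<le> K * N"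
proof -
  \<comment> \<open>A bump reaches at most 4 h = a/4 away from x, so it stays in (0, a) when it
    points to the farther end of this interval.\<close>
  define h where "h = a / 16"
  have h: "h > 0" using a by (simp add: h_def)
  define p q p' q' :: "(3 \<Rightarrow> bool) \<Rightarrow> real^3" where
    "p = (\<lambda>\<sigma>. \<chi> i. if \<sigma> i then h else - (4 * h))" and "q = (\<lambda>\<sigma>. \<chi> i. if \<sigma> i then 4 * h else - h)" and
    "p' = (\<lambda>\<sigma>. \<chi> i. if \<sigma> i then 2 * h else - (3 * h))" and "q' = (\<lambda>\<sigma>. \<chi> i. if \<sigma> i then 3 * h else - (2 * h))"
  define F where "F = corner_bump h"
  have "\<exists>K\<ge>0. \<forall>S x f d1 d2 N l. open S \<longrightarrow> inward S x (p \<sigma>) (q \<sigma>) (F \<sigma>) \<longrightarrow> (\<forall>i. tensor_deriv S i f (d1 i)) \<longrightarrow>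
      (\<forall>i j. tensor_deriv S j (d1 i) (d2 i j)) \<longrightarrow> L2norm (lebesgue_on S) f \<le> N \<longrightarrow>
      (\<forall>i. L2norm (lebesgue_on S) (d1 i) \<le> N) \<longrightarrow> (\<forall>i j. L2norm (lebesgue_on S) (d2 i j) \<le> N) \<longrightarrow>
      0 < l \<longrightarrow> l \<le> 1/2 \<longrightarrow> \<bar>avg S x f (F \<sigma>) l\<bar> \<le> K * N" for \<sigma>
    by (rule avg_sup[of "p \<sigma>" "q \<sigma>" "F \<sigma>"]) blast
  then obtain K where K: "\<And>\<sigma>. K \<sigma> \<ge> 0" "\<And>\<sigma> S x f d1 d2 N l. open S \<Longrightarrow> inward S x (p \<sigma>) (q \<sigma>) (F \<sigma>) \<Longrightarrow>
      (\<forall>i. tensor_deriv S i f (d1 i)) \<Longrightarrow>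
      (\<forall>i j. tensor_deriv S j (d1 i) (d2 i j)) \<Longrightarrow> L2norm (lebesgue_on S) f \<le> N \<Longrightarrow>
      (\<forall>i. L2norm (lebesgue_on S) (d1 i) \<le> N) \<Longrightarrow> (\<forall>i j. L2norm (lebesgue_on S) (d2 i j) \<le> N) \<Longrightarrow>
      0 < l \<Longrightarrow> l \<le> 1/2 \<Longrightarrow> \<bar>avg S x f (F \<sigma>) l\<bar> \<le> K \<sigma> * N"
    by metis
  have F: "smooth1 (F \<sigma> i)" for \<sigma> i
  proof -
    define c where "c = (if \<sigma> i then inverse h else - inverse h)"
    have "smooth1 (\<lambda>y. step (c * y + 0) * step ((- c) * y + 5))"
      by (intro smooth1_mult smooth1_affine smooth1_step)
    moreover have "(\<lambda>y. step (c * y + 0) * step ((- c) * y + 5)) = F \<sigma> i"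
      by (auto simp: F_def corner_bump_def[abs_def] c_def Let_def fun_eq_iff divide_inverse mult.commute)
    ultimately show ?thesis by simp
  qed
  have supp: "F \<sigma> i y = 0" if "y \<notin> {p \<sigma>$i..q \<sigma>$i}" for \<sigma> i y
  proof -
    have "if \<sigma> i then y / h < 1 \<or> 4 < y / h else y / h < - 4 \<or> - 1 < y / h"
      using that h by (auto simp: p_def q_def pos_divide_less_eq pos_less_divide_eq not_le)
    then show ?thesis by (auto simp: F_def corner_bump_def Let_def step_0 split: if_splits)
  qed
  have one: "tensor (F \<sigma>) y = 1" if y: "y \<in> cbox (p' \<sigma>) (q' \<sigma>)" for \<sigma> y
    unfolding tensor_def
  proof (rule prod.neutral, rule ballI)
    fix i
    have "p' \<sigma> $ i \<le> y $ i" "y $ i \<le> q' \<sigma> $ i" using y by (auto simp: mem_box_cart)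
    then have "if \<sigma> i then 2 \<le> y$i / h \<and> y$i / h \<le> 3 else - 3 \<le> y$i / h \<and> y$i / h \<le> - 2"
      using h by (auto simp: p'_def q'_def pos_le_divide_eq pos_divide_le_eq)
    then show "F \<sigma> i (y $ i) = 1"
      by (auto simp: F_def corner_bump_def Let_def step_1 split: if_splits)
  qed
  have nonneg: "0 \<le> tensor (F \<sigma>) y" for \<sigma> y
    unfolding tensor_def by (intro prod_nonneg) (auto simp: F_def corner_bump_def Let_def step_ge_0)
  have sub: "cbox (p' \<sigma>) (q' \<sigma>) \<subseteq> cbox (p \<sigma>) (q \<sigma>)" for \<sigma>
  proof
    fix y assume y: "y \<in> cbox (p' \<sigma>) (q' \<sigma>)"
    have "p \<sigma> $ i \<le> y $ i \<and> y $ i \<le> q \<sigma> $ i" for i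
    proof -
      have "p' \<sigma> $ i \<le> y $ i" "y $ i \<le> q' \<sigma> $ i" using y by (auto simp: mem_box_cart)
      then show ?thesis using h by (cases "\<sigma> i") (auto simp: p_def q_def p'_def q'_def)
    qed
    then show "y \<in> cbox (p \<sigma>) (q \<sigma>)" by (simp add: mem_box_cart)
  qed
  have vol: "measure lebesgue (cbox (p' \<sigma>) (q' \<sigma>)) = h ^ 3" for \<sigma>
  proof -
    have "measure lebesgue (cbox (p' \<sigma>) (q' \<sigma>)) = measure lborel (cbox (p' \<sigma>) (q' \<sigma>))" by simp
    also have "\<dots> = (\<Prod>i\<in>UNIV. q' \<sigma> $ i - p' \<sigma> $ i)"
      using h by (intro content_cbox_cart) (auto simp: p'_def q'_def interval_eq_empty_cart not_less)
    also have "\<dots> = (\<Prod>i\<in>(UNIV :: 3 set). h)" by (rule prod.cong) (auto simp: p'_def q'_def)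
    finally show ?thesis by simp
  qed
  define K' where "K' = 2 * (\<Sum>\<sigma>\<in>UNIV. K \<sigma>) / h ^ 3"
  show ?thesis
  proof (rule that[of K'])
    show "K' \<ge> 0" using K(1) h by (auto simp: K'_def intro!: divide_nonneg_nonneg sum_nonneg)
    fix f d1 d2 N g x
    assume f: "\<And>i. tensor_deriv (box_dom a) i f (d1 i)" "\<And>i j. tensor_deriv (box_dom a) j (d1 i) (d2 i j)"
      "L2norm (lebesgue_on (box_dom a)) f \<le> N" "\<And>i. L2norm (lebesgue_on (box_dom a)) (d1 i) \<le> N"
      "\<And>i j. L2norm (lebesgue_on (box_dom a)) (d2 i j) \<le> N"
      and g: "continuous_on (box_dom a) g" "AE z in lebesgue_on (box_dom a). g z = f z"
      and x: "x \<in> box_dom a"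
    \<comment> \<open>Upwards in z, and horizontally away from the nearer side face.\<close>
    define \<sigma> where "\<sigma> i = (i = 3 \<or> x$i < a / 2)" for i :: 3
    have inw: "inward (box_dom a) x (p \<sigma>) (q \<sigma>) (F \<sigma>)"
      unfolding inward_def
    proof (intro conjI allI impI F supp)
      fix l y assume l: "0 < l" "l \<le> (1::real)" and y: "y \<in> cbox (p \<sigma>) (q \<sigma>)"
      have y1: "(if \<sigma> i then 0 < y$i else y$i < 0)" "\<bar>y$i\<bar> \<le> 4 * h" for i
        using y h by (auto simp: mem_box_cart p_def q_def split: if_splits dest!: spec[of _ i])
      have ly: "(if \<sigma> i then 0 < l * y$i else l * y$i < 0)" "\<bar>l * y$i\<bar> \<le> 4 * h" for i
        using y1[of i] l mult_mono[of l 1 "\<bar>y$i\<bar>" "4 * h"] by (auto simp: abs_mult zero_less_mult_iff mult_less_0_iff)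
      show "x + l *\<^sub>R y \<in> box_dom a"
        using x ly[of 1] ly[of 2] ly[of 3] a unfolding box_dom_def \<sigma>_def h_def
        by (auto simp: split: if_splits)
    qed
    have av: "\<bar>avg (box_dom a) x f (F \<sigma>) l\<bar> \<le> K \<sigma> * N" if "0 < l" "l \<le> 1/2" for l
      by (rule K(2)[OF open_box_dom inw, of f d1 d2]) (use f that in auto)
    have fL: "f \<in> L2 (lebesgue_on (box_dom a))" using f(1)[of 1] by (simp add: tensor_deriv_def)
    have "\<bar>g x\<bar> * measure lebesgue (cbox (p' \<sigma>) (q' \<sigma>)) \<le> 2 * (K \<sigma> * N)"
      by (rule avg_lower_bound[OF open_box_dom x inw nonneg one sub fL g av])
    moreover have "K \<sigma> \<le> (\<Sum>\<sigma>\<in>UNIV. K \<sigma>)" using K(1) by (intro member_le_sum) auto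
    moreover have "N \<ge> 0" using f(3) L2norm_nonneg order_trans by blast
    ultimately have "\<bar>g x\<bar> * h ^ 3 \<le> 2 * ((\<Sum>\<sigma>\<in>UNIV. K \<sigma>) * N)"
      unfolding vol using mult_right_mono[of "K \<sigma>" "\<Sum>\<sigma>\<in>UNIV. K \<sigma>" N] by linarith
    then show "\<bar>g x\<bar> \<le> K' * N" using h by (simp add: K'_def pos_le_divide_eq mult.assoc)
  qed
qed

section \<open>Traces on the bottom of the half-infinite box\<close>

definition vec3 :: "real^2 \<Rightarrow> real \<Rightarrow> real^3" where
  "vec3 y z = vector [y$1, y$2, z]"

lemma vec3_nth [simp]: "vec3 y z $ 1 = y$1" "vec3 y z $ 2 = y$2" "vec3 y z $ 3 = z"
  by (simp_all add: vec3_def)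

definition horiz :: "real^3 \<Rightarrow> real^2" where
  "horiz x = vector [x$1, x$2]"

lemma horiz_nth [simp]: "horiz x $ 1 = x$1" "horiz x $ 2 = x$2"
  by (simp_all add: horiz_def)

lemma vec3_horiz [simp]: "vec3 (horiz x) (x$3) = x" "horiz (vec3 y z) = y"
  by (simp_all add: vec_eq_iff forall_3 forall_2)

lemma continuous_on_vec3: "continuous_on S (\<lambda>p. vec3 (fst p) (snd p))"
proof -
  have "(\<lambda>p. vec3 (fst p) (snd p)) = (\<lambda>p. \<chi> i. if i = 1 then fst p $ 1 else if i = 2 then fst p $ 2 else snd p)"
    by (auto simp: fun_eq_iff vec_eq_iff forall_3)
  moreover have "continuous_on S (\<lambda>p::(real^2) \<times> real. if i = 1 then fst p $ 1 else if i = (2::3) then fst p $ 2 else snd p)" for i :: 3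
    by (cases "i = 1"; cases "i = 2") (auto intro!: continuous_intros)
  ultimately show ?thesis by (simp only: continuous_on_vec_lambda)
qed

lemma measurable_vec3 [measurable]: "(\<lambda>p. vec3 (fst p) (snd p)) \<in> borel_measurable borel"
  by (rule borel_measurable_continuous_onI[OF continuous_on_vec3])

lemma continuous_on_horiz: "continuous_on S horiz"
proof -
  have e: "horiz = (\<lambda>x. \<chi> i. if i = 1 then x $ 1 else x $ 2)"
    by (auto simp: fun_eq_iff vec_eq_iff forall_2)
  have "continuous_on S (\<lambda>x::real^3. if i = (1::2) then x $ 1 else x $ 2)" for i :: 2
    by (cases "i = 1") (auto intro!: continuous_intros)
  then show ?thesis unfolding e by (rule continuous_on_vec_lambda)
qed

lemma measurable_horiz [measurable]: "horiz \<in> borel_measurable borel"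
  by (rule borel_measurable_continuous_onI[OF continuous_on_horiz])

lemma measurable_vec_nth' [measurable]: "(\<lambda>x::real^'n. x $ i) \<in> borel_measurable borel"
  by (intro borel_measurable_continuous_onI continuous_intros)

lemma prod_Basis_vec:
  fixes f :: "real^'n \<Rightarrow> 'b::comm_monoid_mult"
  shows "(\<Prod>b\<in>Basis. f b) = (\<Prod>i\<in>UNIV. f (axis i 1))"
proof -
  have "(Basis :: (real^'n) set) = (\<lambda>i. axis i 1) ` UNIV" by (auto simp: Basis_vec_def)
  then have "(\<Prod>b\<in>Basis. f b) = prod f ((\<lambda>i. axis i 1) ` UNIV)" by (rule arg_cong)
  also have "\<dots> = (\<Prod>i\<in>UNIV. f (axis i 1))"
    by (subst prod.reindex) (auto simp: inj_on_def axis_eq_axis)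
  finally show ?thesis .
qed

lemma prod_UNIV_3: "(\<Prod>i\<in>(UNIV :: 3 set). f i) = f 1 * f 2 * (f 3 :: real)"
  unfolding UNIV_3 by (simp add: mult.assoc)

lemma emeasure_box_vec2:
  fixes l u :: "real^2"
  assumes "l$1 \<le> u$1" "l$2 \<le> u$2"
  shows "emeasure lborel (box l u) = ennreal ((u$1 - l$1) * (u$2 - l$2))"
proof -
  have "emeasure lborel (box l u) = (\<Prod>b\<in>Basis. (u - l) \<bullet> b)"
  proof (rule emeasure_lborel_box)
    fix b :: "real^2" assume "b \<in> Basis"
    then obtain i where "b = axis i 1" by (auto simp: Basis_vec_def)
    then show "l \<bullet> b \<le> u \<bullet> b" using exhaust_2[of i] assms by (auto simp: inner_axis)
  qed
  also have "(\<Prod>b\<in>Basis. (u - l) \<bullet> b) = (u$1 - l$1) * (u$2 - l$2)"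
    by (simp add: prod_Basis_vec inner_axis UNIV_2)
  finally show ?thesis .
qed

text \<open>Points of \<open>real^3\<close> are not pairs; this splitting makes Fubini's theorem
  available for the vertical direction. Lebesgue measure is determined by its values on boxes, which
  multiply.\<close>

lemma lborel_vec3:
  "(lborel :: (real^3) measure) = distr (lborel \<Otimes>\<^sub>M lborel) borel (\<lambda>p. vec3 (fst p) (snd p))"
proof (rule lborel_eqI)
  fix l u :: "real^3" assume lu: "\<And>b. b \<in> Basis \<Longrightarrow> l \<bullet> b \<le> u \<bullet> b"
  have le: "l$i \<le> u$i" for i
    using lu[of "axis i 1"] by (simp add: inner_axis)
  have vi: "(\<lambda>p. vec3 (fst p) (snd p)) -` box l u = box (horiz l) (horiz u) \<times> box (l$3) (u$3)"
  proof (rule set_eqI)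
    fix p :: "(real^2) \<times> real"
    show "p \<in> (\<lambda>p. vec3 (fst p) (snd p)) -` box l u \<longleftrightarrow> p \<in> box (horiz l) (horiz u) \<times> box (l$3) (u$3)"
      by (cases p) (simp add: mem_box_cart forall_3 forall_2 box_real)
  qed
  have s: "space (lborel \<Otimes>\<^sub>M lborel :: ((real^2) \<times> real) measure) = UNIV" by (simp add: lborel_prod)
  have "emeasure (distr (lborel \<Otimes>\<^sub>M lborel) borel (\<lambda>p. vec3 (fst p) (snd p))) (box l u)
      = emeasure (lborel \<Otimes>\<^sub>M lborel) (box (horiz l) (horiz u) \<times> box (l$3) (u$3))"
    by (subst emeasure_distr) (simp_all add: vi s, simp_all add: lborel_prod)
  also have "\<dots> = emeasure lborel (box (horiz l) (horiz u)) * emeasure lborel (box (l$3) (u$3))"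
    by (rule lborel.emeasure_pair_measure_Times) auto
  also have "emeasure lborel (box (horiz l) (horiz u)) = ennreal ((u$1 - l$1) * (u$2 - l$2))"
    using le by (subst emeasure_box_vec2) auto
  also have "emeasure lborel (box (l$3) (u$3)) = ennreal (u$3 - l$3)"
    using le[of 3] by (simp add: box_real)
  also have "ennreal ((u$1 - l$1) * (u$2 - l$2)) * ennreal (u$3 - l$3) = ennreal (\<Prod>b\<in>Basis. (u - l) \<bullet> b)"
  proof -
    have p: "(\<Prod>b\<in>Basis. (u - l) \<bullet> b) = (u$1 - l$1) * (u$2 - l$2) * (u$3 - l$3)"
    proof -
      have "(\<Prod>b\<in>Basis. (u - l) \<bullet> b) = (\<Prod>i\<in>UNIV. (u - l) $ i)"
        unfolding prod_Basis_vec by (rule prod.cong) (simp_all add: inner_axis)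
      then show ?thesis by (simp only: prod_UNIV_3 vector_minus_component)
    qed
    show ?thesis unfolding p using le[of 1] le[of 2] le[of 3] by (subst ennreal_mult) auto
  qed
  finally show "emeasure (distr (lborel \<Otimes>\<^sub>M lborel) borel (\<lambda>p. vec3 (fst p) (snd p))) (box l u)
      = ennreal (\<Prod>b\<in>Basis. (u - l) \<bullet> b)" .
qed simp

lemma horiz_vert_integral:
  fixes h :: "real^2 \<Rightarrow> real" and k :: "real \<Rightarrow> real"
  assumes h: "integrable lborel h" and k: "integrable lborel k"
  shows "integrable lborel (\<lambda>x::real^3. h (horiz x) * k (x$3))"
    "(\<integral>x. h (horiz x) * k (x$3) \<partial>(lborel :: (real^3) measure)) = (\<integral>y. h y \<partial>lborel) * (\<integral>z. k z \<partial>lborel)"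
proof -
  have [measurable]: "h \<in> borel_measurable borel" "k \<in> borel_measurable borel"
    using borel_measurable_integrable[OF h] borel_measurable_integrable[OF k] by auto
  have i: "integrable (lborel \<Otimes>\<^sub>M lborel) (\<lambda>p. h (fst p) * k (snd p))"
  proof (rule lborel_pair.Fubini_integrable)
    show "integrable lborel (\<lambda>x. \<integral>y. norm (h (fst (x, y)) * k (snd (x, y))) \<partial>lborel)"
      using h by (simp add: abs_mult)
    show "AE x in lborel. integrable lborel (\<lambda>y. h (fst (x, y)) * k (snd (x, y)))"
      using k by simp
  qed measurable
  have m: "(\<lambda>p. vec3 (fst p) (snd p)) \<in> measurable (lborel \<Otimes>\<^sub>M lborel) borel"
    by (simp add: lborel_prod)
  have m2: "(\<lambda>x::real^3. h (horiz x) * k (x$3)) \<in> borel_measurable borel" by measurable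
  show "integrable lborel (\<lambda>x::real^3. h (horiz x) * k (x$3))"
    unfolding lborel_vec3 using i by (subst integrable_distr_eq[OF m m2]) simp
  have "(\<integral>x. h (horiz x) * k (x$3) \<partial>(lborel :: (real^3) measure)) = (\<integral>p. h (fst p) * k (snd p) \<partial>(lborel \<Otimes>\<^sub>M lborel))"
    unfolding lborel_vec3 by (subst integral_distr[OF m m2]) simp
  also have "\<dots> = (\<integral>y. (\<integral>z. h y * k z \<partial>lborel) \<partial>lborel)"
    using lborel_pair.integral_fst'[OF i] by simp
  finally show "(\<integral>x. h (horiz x) * k (x$3) \<partial>(lborel :: (real^3) measure)) = (\<integral>y. h y \<partial>lborel) * (\<integral>z. k z \<partial>lborel)"
    by simp
qed

lemma box_dom_indicator: "indicator (box_dom a) x = (indicator (dom_x a) (horiz x) * indicator {0<..} (x$3) :: real)"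
  by (auto simp: box_dom_def dom_x_def indicator_def)

lemma dom_x_box: "dom_x a = box 0 (vector [a, a])"
  by (auto simp: dom_x_def mem_box_cart forall_2)

lemma box_dom_sets [simp]: "box_dom a \<in> sets lebesgue" "box_dom a \<in> sets borel"
  using open_box_dom by auto

lemma integrable_exp_minus:
  assumes "b > (0::real)"
  shows "integrable lborel (\<lambda>z::real. exp (- b * z) * indicator {0<..} z)"
proof -
  have "(\<integral>\<^sup>+z. ennreal (exp (- b * z)) * indicator {0..} z \<partial>lborel) = ennreal (0 - (- exp (- b * 0) / b))"
  proof (rule nn_integral_FTC_atLeast)
    show "((\<lambda>z. - exp (- b * z) / b) has_real_derivative exp (- b * z)) (at z)" for z
      using assms by (auto intro!: derivative_eq_intros)
    have "((\<lambda>z. exp (- b * z)) \<longlongrightarrow> 0) at_top"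
      using assms by (intro filterlim_compose[OF exp_at_bot] filterlim_tendsto_neg_mult_at_bot[OF tendsto_const])
        (auto simp: filterlim_ident)
    from tendsto_divide[OF tendsto_minus[OF this] tendsto_const[of b]] assms
    show "((\<lambda>z. - exp (- b * z) / b) \<longlongrightarrow> 0) at_top" by simp
  qed auto
  then have fin: "(\<integral>\<^sup>+z. ennreal (exp (- b * z)) * indicator {0..} z \<partial>lborel) < \<infinity>" by simp
  show ?thesis
  proof (rule integrableI_bounded)
    have "(\<integral>\<^sup>+z. ennreal (norm (exp (- b * z) * indicator {0<..} z)) \<partial>lborel)
        \<le> (\<integral>\<^sup>+z. ennreal (exp (- b * z)) * indicator {0..} z \<partial>lborel)"
      by (intro nn_integral_mono) (auto simp: indicator_def)
    then show "(\<integral>\<^sup>+z. ennreal (norm (exp (- b * z) * indicator {0<..} z)) \<partial>lborel) < \<infinity>"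
      using fin by (rule order.strict_trans1)
  qed measurable
qed

lemma integrable_dom_x: "integrable lborel (indicat_real (dom_x a))"
  using emeasure_lborel_box_finite[of 0 "vector [a, a]"]
  by (intro integrable_real_indicator) (simp_all add: dom_x_box)

lemma exp_integrable_box_dom:
  assumes "b > 0"
  shows "integrable (lebesgue_on (box_dom a)) (\<lambda>x. exp (- b * x$3))"
proof -
  have "integrable lborel (\<lambda>x::real^3. indicator (dom_x a) (horiz x) * (exp (- b * x$3) * indicator {0<..} (x$3)))"
    by (rule horiz_vert_integral(1)[OF integrable_dom_x integrable_exp_minus[OF assms]])
  then have "integrable lebesgue (\<lambda>x::real^3. indicator (dom_x a) (horiz x) * (exp (- b * x$3) * indicator {0<..} (x$3)))"
    by (subst integrable_completion) (auto dest: borel_measurable_integrable)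
  moreover have "(\<lambda>x::real^3. indicator (dom_x a) (horiz x) * (exp (- b * x$3) * indicator {0<..} (x$3)))
      = (\<lambda>x. indicator (box_dom a) x *\<^sub>R exp (- b * x$3))"
    by (auto simp: box_dom_indicator)
  ultimately show ?thesis by (simp add: integrable_restrict_space)
qed

lemma closure_box_dom:
  assumes "a > 0"
  shows "closure (box_dom a) = {x. 0 \<le> x$1 \<and> x$1 \<le> a \<and> 0 \<le> x$2 \<and> x$2 \<le> a \<and> 0 \<le> x$3}" (is "_ = ?C")
proof
  have "?C = {x. 0 \<le> x$1} \<inter> {x. x$1 \<le> a} \<inter> {x. 0 \<le> x$2} \<inter> {x. x$2 \<le> a} \<inter> {x. 0 \<le> x$3}" by auto
  then have "closed ?C" by (auto intro!: closed_Int closed_Collect_le continuous_intros)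
  then show "closure (box_dom a) \<subseteq> ?C" by (intro closure_minimal) (auto simp: box_dom_def)
  show "?C \<subseteq> closure (box_dom a)"
  proof
    fix x assume x: "x \<in> ?C"
    \<comment> \<open>An interior point: convex combinations that give it positive weight lie in the
      open box.\<close>
    define c :: "real^3" where "c = vector [a/2, a/2, 1]"
    define X where "X n = (1 - 1 / real (Suc n)) *\<^sub>R x + (1 / real (Suc n)) *\<^sub>R c" for n
    have "X n \<in> box_dom a" for n
    proof -
      define t where "t = 1 / real (Suc n)"
      have t: "0 < t" "t \<le> 1" by (auto simp: t_def)
      have *: "0 < (1 - t) * v + t * w" if "0 \<le> v" "0 < w" for v w
        using that t by (intro add_nonneg_pos mult_nonneg_nonneg mult_pos_pos) auto
      have **: "(1 - t) * v + t * w < a" if "v \<le> a" "w < a" for v w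
        using *[of "a - v" "a - w"] that by (simp add: algebra_simps)
      show ?thesis unfolding X_def t_def[symmetric] box_dom_def
        using x assms *[of "x$1" "a/2"] **[of "x$1" "a/2"] *[of "x$2" "a/2"] **[of "x$2" "a/2"] *[of "x$3" 1]
        by (auto simp: c_def)
    qed
    moreover have "X \<longlonglongrightarrow> (1 - 0) *\<^sub>R x + 0 *\<^sub>R c"
      unfolding X_def using LIMSEQ_inverse_real_of_nat by (intro tendsto_intros) (simp_all add: inverse_eq_divide)
    ultimately show "x \<in> closure (box_dom a)"
      unfolding closure_sequential by (intro exI[of _ X]) auto
  qed
qed

lemma frontier_box_dom_lateral:
  assumes "a > 0" "x \<in> closure (box_dom a)" "x$1 = 0 \<or> x$1 = a \<or> x$2 = 0 \<or> x$2 = a"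
  shows "x \<in> frontier (box_dom a) - bottom a"
  using assms unfolding frontier_def interior_open[OF open_box_dom]
  by (auto simp: box_dom_def bottom_def)

lemma frontier_box_dom_bottom:
  assumes "a > 0" "x \<in> bottom a"
  shows "x \<in> frontier (box_dom a)" "x \<in> closure (box_dom a)"
  using assms unfolding frontier_def interior_open[OF open_box_dom] closure_box_dom[OF assms(1)]
  by (auto simp: box_dom_def bottom_def)

text \<open>Unit mass concentrating at \<open>z = 0\<close>: integrals against it converge to traces.\<close>

definition layer :: "nat \<Rightarrow> real \<Rightarrow> real" where
  "layer n z = real n * deriv step (real n * z)"

lemma layer_nonneg: "layer n z \<ge> 0"
  by (simp add: layer_def deriv_step_nonneg)

lemma layer_support: "layer n z \<noteq> 0 \<Longrightarrow> n > 0 \<and> 1 / real n \<le> z \<and> z \<le> 2 / real n"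
proof -
  assume "layer n z \<noteq> 0"
  then have "n \<noteq> 0" "deriv step (real n * z) \<noteq> 0" by (auto simp: layer_def)
  moreover from this have "\<not> (real n * z \<le> 1 \<or> real n * z \<ge> 2)" using deriv_step_0 by blast
  ultimately have "1 < real n * z" "real n * z < 2" "n > 0" by auto
  then show ?thesis by (auto simp: pos_divide_le_eq pos_le_divide_eq mult.commute)
qed

lemma layer_measurable [measurable]: "layer n \<in> borel_measurable borel"
proof -
  have "smooth1 (\<lambda>z. deriv step (real n * z + 0))"
    by (intro smooth1_affine smooth1_smooth_deriv smooth1_step)
  from smooth1_measurable[OF this] show ?thesis unfolding layer_def[abs_def] by simp
qed

lemma layer_integral:
  assumes "n > 0"
  shows "integrable lborel (layer n)" "(\<integral>z. layer n z \<partial>lborel) = 1"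
proof -
  have d: "((\<lambda>z. step (real n * z)) has_real_derivative layer n z) (at z)" for z
  proof -
    have "((\<lambda>z. real n * z) has_real_derivative real n) (at z)"
      by (auto intro!: derivative_eq_intros)
    from DERIV_chain2[OF smooth1_deriv[OF smooth1_step] this] show ?thesis
      by (simp add: layer_def mult.commute)
  qed
  have s1: "smooth1 (\<lambda>z. deriv step (real n * z + 0))"
    by (intro smooth1_affine smooth1_smooth_deriv smooth1_step)
  have "isCont (layer n) z" for z
    using smooth1_continuous[OF s1, of UNIV] unfolding layer_def[abs_def]
    by (intro continuous_intros) (simp add: continuous_on_eq_continuous_at)
  then have "has_bochner_integral lborel (\<lambda>z. layer n z * indicator {0..2} z) (step (real n * 2) - step (real n * 0))"
    by (intro has_bochner_integral_FTC_Icc_real d) auto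
  moreover have "(\<lambda>z. layer n z * indicator {0..2} z) = layer n"
  proof
    fix z show "layer n z * indicator {0..2} z = layer n z"
    proof (cases "layer n z = 0")
      case False
      from layer_support[OF this] have "1 / real n \<le> z" "z \<le> 2 / real n" by auto
      moreover have "2 / real n \<le> 2" "0 \<le> 1 / real n" using assms by (auto simp: divide_le_eq)
      ultimately have "0 \<le> z" "z \<le> 2" by linarith+
      then show ?thesis by simp
    qed simp
  qed
  moreover have "step (real n * 2) - step (real n * 0) = 1" using assms by (simp add: step_0 step_1)
  ultimately have "has_bochner_integral lborel (layer n) 1" by simp
  then show "integrable lborel (layer n)" "(\<integral>z. layer n z \<partial>lborel) = 1"
    by (auto simp: has_bochner_integral_iff)
qed

lemma dom_x_measure: "a > 0 \<Longrightarrow> (\<integral>y. indicat_real (dom_x a) y \<partial>lborel) = a\<^sup>2"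
  by (simp add: dom_x_box measure_def emeasure_box_vec2 power2_eq_square)

lemma layer_integral_box:
  assumes a: "a > 0" and n: "n > 0"
  shows "integrable (lebesgue_on (box_dom a)) (\<lambda>x. layer n (x$3))"
    "(\<integral>x. layer n (x$3) \<partial>lebesgue_on (box_dom a)) = a\<^sup>2"
proof -
  have e: "(\<lambda>x. indicator (box_dom a) x *\<^sub>R layer n (x$3)) = (\<lambda>x. indicator (dom_x a) (horiz x) * layer n (x$3))"
  proof
    fix x :: "real^3"
    show "indicator (box_dom a) x *\<^sub>R layer n (x$3) = indicator (dom_x a) (horiz x) * layer n (x$3)"
    proof (cases "layer n (x$3) = 0")
      case False
      from layer_support[OF this] have "x$3 > 0" by (auto intro: less_le_trans[of 0 "1 / real n"])
      then show ?thesis by (simp add: box_dom_indicator)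
    qed simp
  qed
  note hv = horiz_vert_integral[OF integrable_dom_x layer_integral(1)[OF n], of a]
  have m: "(\<lambda>x::real^3. indicat_real (dom_x a) (horiz x) * layer n (x$3)) \<in> borel_measurable lborel"
    using hv(1) by (rule borel_measurable_integrable)
  show "integrable (lebesgue_on (box_dom a)) (\<lambda>x. layer n (x$3))"
    using hv(1) by (subst integrable_restrict_space) (simp_all only: e integrable_completion[OF m], simp)
  have "(\<integral>x. layer n (x$3) \<partial>lebesgue_on (box_dom a)) = (\<integral>x. indicator (box_dom a) x *\<^sub>R layer n (x$3) \<partial>lebesgue)"
    by (rule integral_restrict_space) simp
  also have "\<dots> = (\<integral>x. indicator (dom_x a) (horiz x) * layer n (x$3) \<partial>(lborel :: (real^3) measure))"
    unfolding e by (rule integral_completion[OF m])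
  also have "\<dots> = a\<^sup>2" using hv(2) layer_integral(2)[OF n] dom_x_measure[OF a] by simp
  finally show "(\<integral>x. layer n (x$3) \<partial>lebesgue_on (box_dom a)) = a\<^sup>2" .
qed

text \<open>On the support of the layer uniform continuity replaces G by its value at the foot of
  the vertical line, and the layer has mass 1 in z. Since the bottom has finite area, a uniform
  error suffices.\<close>

lemma trace_limit:
  fixes G :: "real^3 \<Rightarrow> real"
  assumes a: "a > 0" and G: "continuous_on (closure (box_dom a)) G"
  shows "(\<lambda>n. \<integral>x. G x * layer n (x$3) \<partial>lebesgue_on (box_dom a)) \<longlonglongrightarrow> (LINT y:dom_x a|lebesgue. G (vec3 y 0))"
proof -
  \<comment> \<open>The layer lives at z \<le> 2/n, so height 2 is enough for all n \<ge> 1, and K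
    is compact.\<close>
  define K :: "(real^3) set" where "K = cbox 0 (vector [a, a, 2])"
  have KC: "K \<subseteq> closure (box_dom a)"
    unfolding K_def closure_box_dom[OF a] by (auto simp: mem_box_cart forall_3)
  have cK: "continuous_on K G" by (rule continuous_on_subset[OF G KC])
  have uc: "uniformly_continuous_on K G"
    by (rule compact_uniformly_continuous[OF cK]) (simp add: K_def)
  \<comment> \<open>The bottom values, extended by 0 outside the cross-section so that Fubini's
    theorem applies on the whole space.\<close>
  define H where "H y = indicat_real (dom_x a) y * G (vec3 y 0)" for y
  have cH: "continuous_on (dom_x a) (\<lambda>y. G (vec3 y 0))"
  proof (rule continuous_on_compose2[OF cK])
    show "continuous_on (dom_x a) (\<lambda>y. vec3 y 0)"
    proof -
      have "continuous_on (dom_x a) (\<lambda>y. (y, 0::real))" by (intro continuous_intros)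
      from continuous_on_compose2[OF continuous_on_vec3 this subset_UNIV] show ?thesis by simp
    qed
    show "(\<lambda>y. vec3 y 0) ` dom_x a \<subseteq> K"
      by (auto simp: K_def dom_x_def mem_box_cart forall_3)
  qed
  have Hm: "H \<in> borel_measurable borel"
    using borel_measurable_continuous_on_indicator[OF _ cH] unfolding H_def[abs_def]
    by (simp add: dom_x_box)
  obtain B where B: "\<And>x. x \<in> K \<Longrightarrow> \<bar>G x\<bar> \<le> B"
    using compact_imp_bounded[OF compact_continuous_image[OF cK]] unfolding bounded_iff K_def
    by (auto)
  have Hi: "integrable lborel H"
  proof (rule Bochner_Integration.integrable_bound)
    show "integrable lborel (\<lambda>y. B * indicat_real (dom_x a) y)"
      using integrable_dom_x by (rule integrable_mult_right)
    have "\<bar>H y\<bar> \<le> \<bar>B * indicat_real (dom_x a) y\<bar>" for y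
    proof (cases "y \<in> dom_x a")
      case True
      then have "vec3 y 0 \<in> K" by (auto simp: K_def dom_x_def mem_box_cart forall_3)
      from B[OF this] True show ?thesis by (simp add: H_def)
    qed (simp add: H_def)
    then show "AE y in lborel. norm (H y) \<le> norm (B * indicat_real (dom_x a) y)" by simp
  qed (use Hm in simp)
  have lim: "(LINT y:dom_x a|lebesgue. G (vec3 y 0)) = (\<integral>y. H y \<partial>lborel)"
    using integral_completion[of H lborel] Hm unfolding H_def[abs_def] by (simp add: set_lebesgue_integral_def)
  let ?M = "lebesgue_on (box_dom a)"
  let ?h = "\<lambda>x. H (horiz x)"
  have hi: "integrable ?M (\<lambda>x. ?h x * layer n (x$3))" and hI: "(\<integral>x. ?h x * layer n (x$3) \<partial>?M) = (\<integral>y. H y \<partial>lborel)"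
    if n: "n > 0" for n
  proof -
    note hv = horiz_vert_integral[OF Hi layer_integral(1)[OF n]]
    have m: "(\<lambda>x::real^3. ?h x * layer n (x$3)) \<in> borel_measurable lborel"
      using hv(1) by (rule borel_measurable_integrable)
    have e: "(\<lambda>x. indicator (box_dom a) x *\<^sub>R (?h x * layer n (x$3))) = (\<lambda>x. ?h x * layer n (x$3))"
    proof
      fix x :: "real^3"
      show "indicator (box_dom a) x *\<^sub>R (?h x * layer n (x$3)) = ?h x * layer n (x$3)"
      proof (cases "layer n (x$3) = 0")
        case False
        from layer_support[OF this] have "x$3 > 0" by (auto intro: less_le_trans[of 0 "1 / real n"])
        then show ?thesis by (auto simp: H_def indicator_def box_dom_def dom_x_def)
      qed simp
    qed
    show "integrable ?M (\<lambda>x. ?h x * layer n (x$3))"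
      using hv(1) by (subst integrable_restrict_space) (simp_all only: e integrable_completion[OF m], simp)
    have "(\<integral>x. ?h x * layer n (x$3) \<partial>?M) = (\<integral>x. indicator (box_dom a) x *\<^sub>R (?h x * layer n (x$3)) \<partial>lebesgue)"
      by (rule integral_restrict_space) simp
    also have "\<dots> = (\<integral>x. ?h x * layer n (x$3) \<partial>lborel)"
      unfolding e by (rule integral_completion[OF m])
    also have "\<dots> = (\<integral>y. H y \<partial>lborel)" using hv(2) layer_integral(2)[OF n] by simp
    finally show "(\<integral>x. ?h x * layer n (x$3) \<partial>?M) = (\<integral>y. H y \<partial>lborel)" .
  qed
  have Gm: "G \<in> borel_measurable ?M"
  proof -
    have "continuous_on (box_dom a) G" by (rule continuous_on_subset[OF G closure_subset])
    then show ?thesis by (rule continuous_imp_measurable_on_sets_lebesgue) simp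
  qed
  have lm: "(\<lambda>x. layer n (x$3)) \<in> borel_measurable ?M" for n
    by (intro measurable_restrict_space1 borel_measurable_lebesgueI) measurable
  show ?thesis unfolding lim
  proof (rule LIMSEQ_I)
    fix e :: real assume e: "e > 0"
    \<comment> \<open>The layer has total mass a^2 over the box; the factor 2 makes the final
      estimate strict.\<close>
    define e' where "e' = e / (2 * a\<^sup>2)"
    have e': "e' > 0" using e a by (simp add: e'_def)
    obtain d where d: "d > 0" "\<And>x x'. x \<in> K \<Longrightarrow> x' \<in> K \<Longrightarrow> dist x' x < d \<Longrightarrow> dist (G x') (G x) < e'"
      using uc e' unfolding uniformly_continuous_on_def by metis
    obtain N :: nat where N: "2 / d < real N" using reals_Archimedean2 by blast
    have "norm ((\<integral>x. G x * layer n (x$3) \<partial>?M) - (\<integral>y. H y \<partial>lborel)) < e" if n: "n \<ge> max N 1" for n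
    proof -
      have n0: "n > 0" using n by simp
      have "2 < real N * d" using N d(1) by (simp add: pos_divide_less_eq)
      also have "\<dots> \<le> real n * d" using n d(1) by (intro mult_right_mono) auto
      finally have nd: "2 / real n < d" using n0 by (simp add: pos_divide_less_eq mult.commute)
      have bd: "\<bar>(G x - ?h x) * layer n (x$3)\<bar> \<le> e' * layer n (x$3)" if x: "x \<in> box_dom a" for x
      proof (cases "layer n (x$3) = 0")
        case False
        from layer_support[OF this] have z: "x$3 \<le> 2 / real n" by auto
        also have "2 / real n \<le> 2" using n0 by (simp add: divide_le_eq)
        finally have xK: "x \<in> K" using x by (auto simp: K_def box_dom_def mem_box_cart forall_3)
        let ?x0 = "vec3 (horiz x) 0"
        have x0K: "?x0 \<in> K" using x a by (auto simp: K_def box_dom_def mem_box_cart forall_3)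
        have "?x0 - x = (- (x$3)) *\<^sub>R axis 3 1" by (auto simp: vec_eq_iff forall_3 axis_def)
        then have "dist ?x0 x = x$3" using x by (simp add: dist_norm norm_axis_1 box_dom_def)
        then have "dist (G ?x0) (G x) < e'" using z nd d(2)[OF xK x0K] by simp
        moreover have "?h x = G ?x0" using x by (auto simp: H_def box_dom_def dom_x_def)
        ultimately have "\<bar>G x - ?h x\<bar> \<le> e'" by (simp add: dist_real_def abs_minus_commute)
        then show ?thesis unfolding abs_mult using layer_nonneg[of n "x$3"]
          by (simp add: mult_right_mono)
      qed simp
      have li: "integrable ?M (\<lambda>x. e' * layer n (x$3))"
        using layer_integral_box(1)[OF a n0] by (rule integrable_mult_right)
      have di: "integrable ?M (\<lambda>x. (G x - ?h x) * layer n (x$3))"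
      proof (rule Bochner_Integration.integrable_bound[OF li])
        show "(\<lambda>x. (G x - ?h x) * layer n (x$3)) \<in> borel_measurable ?M"
        proof -
          have "(\<lambda>x. ?h x) \<in> borel_measurable ?M"
            by (intro measurable_restrict_space1 borel_measurable_lebesgueI measurable_compose[OF measurable_horiz Hm])
          then show ?thesis using Gm lm by (intro borel_measurable_times borel_measurable_diff)
        qed
        show "AE x in ?M. norm ((G x - ?h x) * layer n (x$3)) \<le> norm (e' * layer n (x$3))"
          using bd e' layer_nonneg by (intro AE_I2) (auto simp: space_restrict_space abs_mult)
      qed
      have "(\<integral>x. G x * layer n (x$3) \<partial>?M) = (\<integral>x. (G x - ?h x) * layer n (x$3) + ?h x * layer n (x$3) \<partial>?M)"
        by (simp add: algebra_simps)
      also have "\<dots> = (\<integral>x. (G x - ?h x) * layer n (x$3) \<partial>?M) + (\<integral>y. H y \<partial>lborel)"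
        using di hi[OF n0] hI[OF n0] by simp
      finally have "norm ((\<integral>x. G x * layer n (x$3) \<partial>?M) - (\<integral>y. H y \<partial>lborel)) = \<bar>\<integral>x. (G x - ?h x) * layer n (x$3) \<partial>?M\<bar>"
        by simp
      also have "\<dots> \<le> (\<integral>x. \<bar>(G x - ?h x) * layer n (x$3)\<bar> \<partial>?M)" by (rule integral_abs_bound)
      also have "\<dots> \<le> (\<integral>x. e' * layer n (x$3) \<partial>?M)"
        using di li bd by (intro integral_mono) (auto simp: space_restrict_space)
      also have "\<dots> = e' * a\<^sup>2" using layer_integral_box(2)[OF a n0] by simp
      also have "\<dots> < e" using e a by (simp add: e'_def)
      finally show ?thesis .
    qed
    then show "\<exists>no. \<forall>n\<ge>no. norm ((\<integral>x. G x * layer n (x$3) \<partial>?M) - (\<integral>y. H y \<partial>lborel)) < e" by blast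
  qed
qed

section \<open>Integration by parts against the weight\<close>

text \<open>For m > 0 it vanishes within 1/m of both ends of (0, a), which turns the horizontal
  factors of the weight into factors of a test function.\<close>

definition sin_cut :: "real \<Rightarrow> nat \<Rightarrow> real \<Rightarrow> real" where
  "sin_cut a m t = sin (pi / a * t) * (step (real m * t) * step (real m * (a - t)))"

text \<open>The defect of the cut-off sine in the equation \<open>f'' = - (pi / a)\<^sup>2 f\<close> of the sine itself.\<close>

definition sin_cut_err :: "real \<Rightarrow> nat \<Rightarrow> real \<Rightarrow> real" where
  "sin_cut_err a m t = deriv (deriv (sin_cut a m)) t + (pi / a)\<^sup>2 * sin_cut a m t"

definition column :: "real \<Rightarrow> nat \<Rightarrow> (real \<Rightarrow> real) \<Rightarrow> 3 \<Rightarrow> real \<Rightarrow> real" where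
  "column a m p = (\<lambda>i. if i = 3 then p else sin_cut a m)"

definition sin_weight :: "real \<Rightarrow> (real \<Rightarrow> real) \<Rightarrow> real^3 \<Rightarrow> real" where
  "sin_weight a p x = sin (pi / a * x$1) * sin (pi / a * x$2) * p (x$3)"

lemma weight_eq: "weight a \<alpha> x = sin_weight a (\<lambda>z. exp (- \<alpha> * z)) x"
  by (simp add: weight_def sin_weight_def mult.commute mult.left_commute)

lemma smooth1_sin_cut: "smooth1 (sin_cut a m)"
proof -
  have "smooth1 (\<lambda>t. sin (pi / a * t) * (step (real m * t + 0) * step ((- real m) * t + real m * a)))"
    by (intro smooth1_mult smooth1_sin smooth1_affine smooth1_step)
  then show ?thesis by (simp add: sin_cut_def[abs_def] algebra_simps)
qed

lemma sin_cut_support: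
  assumes "m > 0" "t \<notin> {1 / real m .. a - 1 / real m}"
  shows "sin_cut a m t = 0"
proof -
  have "real m * t \<le> 1 \<or> real m * (a - t) \<le> 1"
    using assms by (auto simp: not_le field_simps)
  then show ?thesis by (auto simp: sin_cut_def step_0)
qed

lemma sin_cut_le_1: "\<bar>sin_cut a m t\<bar> \<le> 1"
proof -
  have "\<bar>step (real m * t)\<bar> \<le> 1" "\<bar>step (real m * (a - t))\<bar> \<le> 1"
    using step_ge_0 step_le_1 by (auto simp: abs_le_iff intro: order_trans[of _ 0 1])
  then show ?thesis unfolding sin_cut_def abs_mult
    by (intro mult_le_one) auto
qed

lemma sin_cut_tendsto:
  assumes "0 < t" "t < a"
  shows "(\<lambda>m. sin_cut a m t) \<longlonglongrightarrow> sin (pi / a * t)"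
proof -
  have "(\<lambda>m. sin_cut a m t) \<longlonglongrightarrow> sin (pi / a * t) * (1 * 1)"
    unfolding sin_cut_def using step_scaled_tendsto[of t] step_scaled_tendsto[of "a - t"] assms
    by (intro tendsto_intros) simp_all
  then show ?thesis by simp
qed

text \<open>Two derivatives of the cut-off cost m^2, but they live on strips where the sine is at
  most 2 pi / (a m). The product is of order m, as is the mixed term with one derivative on each
  factor.\<close>

lemma sin_cut_err_bound:
  assumes a: "a > 0"
  obtains E where "E > 0"
    "\<And>m t. real m * a > 4 \<Longrightarrow> \<bar>sin_cut_err a m t\<bar>
      \<le> E * real m * (indicator {1 / real m .. 2 / real m} t + indicator {a - 2 / real m .. a - 1 / real m} t)"
proof -
  define k where "k = pi / a"
  have k: "k > 0" using a by (simp add: k_def)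
  obtain C where C: "C > 0" "\<And>x. \<bar>deriv step x\<bar> \<le> C" "\<And>x. \<bar>deriv (deriv step) x\<bar> \<le> C"
    by (rule step_derivs_bounded) blast
  show ?thesis
  proof (rule that[of "4 * k * C"])
    show "4 * k * C > 0" using k C by simp
    fix m :: nat and t :: real assume ma: "real m * a > 4"
    have m: "real m > 0" using ma a by (cases "m = 0") auto
    define A A1 A2 B B1 B2 where "A = (\<lambda>t. step (real m * t))" and "A1 = (\<lambda>t. deriv step (real m * t))"
      and "A2 = (\<lambda>t. deriv (deriv step) (real m * t))" and "B = (\<lambda>t. step (real m * (a - t)))"
      and "B1 = (\<lambda>t. deriv step (real m * (a - t)))" and "B2 = (\<lambda>t. deriv (deriv step) (real m * (a - t)))"
    have l1: "((\<lambda>t. real m * t) has_real_derivative real m) (at t)"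
      and l2: "((\<lambda>t. real m * (a - t)) has_real_derivative - real m) (at t)" for t
      by (auto intro!: derivative_eq_intros)
    have dA: "(A has_real_derivative A1 t * real m) (at t)" and dA1: "(A1 has_real_derivative A2 t * real m) (at t)"
      and dB: "(B has_real_derivative B1 t * - real m) (at t)" and dB1: "(B1 has_real_derivative B2 t * - real m) (at t)" for t
      unfolding A_def A1_def A2_def B_def B1_def B2_def
      by (rule DERIV_chain2[OF smooth1_deriv[OF smooth1_step] l1] DERIV_chain2[OF smooth1_deriv[OF smooth1_smooth_deriv[OF smooth1_step]] l1]
        DERIV_chain2[OF smooth1_deriv[OF smooth1_step] l2] DERIV_chain2[OF smooth1_deriv[OF smooth1_smooth_deriv[OF smooth1_step]] l2])+
    have F: "sin_cut a m = (\<lambda>t. sin (k * t) * (A t * B t))"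
      by (simp add: sin_cut_def[abs_def] k_def A_def B_def)
    define P where "P t = real m * (A1 t * B t - A t * B1 t)" for t
    define Q where "Q t = (real m)\<^sup>2 * (A2 t * B t - 2 * (A1 t * B1 t) + A t * B2 t)" for t
    have dP: "((\<lambda>t. A t * B t) has_real_derivative P t) (at t)" for t
      using DERIV_mult[OF dA dB] by (simp add: P_def algebra_simps)
    have dQ: "(P has_real_derivative Q t) (at t)" for t
    proof -
      have "((\<lambda>t. real m * (A1 t * B t - A t * B1 t)) has_real_derivative Q t) (at t)"
        by (rule DERIV_cong[OF DERIV_cmult[OF DERIV_diff[OF DERIV_mult[OF dA1 dB] DERIV_mult[OF dA dB1]]]])
           (simp add: Q_def algebra_simps power2_eq_square)
      then show ?thesis by (simp add: P_def[abs_def])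
    qed
    have ds: "((\<lambda>t. sin (k * t)) has_real_derivative k * cos (k * t)) (at t)"
      and dc: "((\<lambda>t. k * cos (k * t)) has_real_derivative - (k\<^sup>2 * sin (k * t))) (at t)" for t
      by (auto intro!: derivative_eq_intros simp: power2_eq_square)
    have d1: "deriv (sin_cut a m) = (\<lambda>t. k * cos (k * t) * (A t * B t) + P t * sin (k * t))"
      unfolding F using DERIV_imp_deriv[OF DERIV_mult[OF ds dP]] by (simp add: fun_eq_iff)
    have d2: "deriv (deriv (sin_cut a m)) t = - (k\<^sup>2) * sin_cut a m t + (2 * k * cos (k * t) * P t + sin (k * t) * Q t)" for t
      unfolding d1 unfolding F
      by (rule DERIV_imp_deriv, rule DERIV_cong[OF DERIV_add[OF DERIV_mult[OF dc dP] DERIV_mult[OF dQ ds]]])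
         (simp add: algebra_simps)
    have err: "sin_cut_err a m t = 2 * k * cos (k * t) * P t + sin (k * t) * Q t"
      unfolding sin_cut_err_def d2 by (simp add: k_def)
    have AB: "\<bar>A t\<bar> \<le> 1" "\<bar>B t\<bar> \<le> 1"
      using step_ge_0 step_le_1 by (auto simp: A_def B_def abs_le_iff intro: order_trans[of _ 0 1])
    have mC: "0 \<le> real m * C" using m C(1) by simp
    have gen: "\<bar>2 * k * cos (k * t) * P t + sin (k * t) * Q t\<bar> \<le> 4 * k * C * real m"
      if P: "\<bar>P t\<bar> \<le> real m * C" and Q: "\<bar>Q t\<bar> \<le> (real m)\<^sup>2 * C" and s: "\<bar>sin (k * t)\<bar> \<le> 2 * k / real m"
    proof -
      have "\<bar>2 * k * cos (k * t) * P t\<bar> \<le> 2 * k * 1 * (real m * C)"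
        unfolding abs_mult using P k abs_cos_le_one[of "k * t"] by (intro mult_mono) auto
      moreover have "\<bar>sin (k * t) * Q t\<bar> \<le> (2 * k / real m) * ((real m)\<^sup>2 * C)"
        unfolding abs_mult using s Q k m by (intro mult_mono) auto
      moreover have "(2 * k / real m) * ((real m)\<^sup>2 * C) = 2 * k * (real m * C)"
        using m by (simp add: power2_eq_square)
      ultimately show ?thesis by (simp add: mult.assoc mult.left_commute mult.commute[of "real m"])
    qed
    show "\<bar>sin_cut_err a m t\<bar>
      \<le> 4 * k * C * real m * (indicator {1 / real m .. 2 / real m} t + indicator {a - 2 / real m .. a - 1 / real m} t)"
    proof -
      have I1: "t \<in> {1 / real m .. 2 / real m} \<longleftrightarrow> 1 \<le> real m * t \<and> real m * t \<le> 2"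
        using m by (auto simp: field_simps)
      have I2: "t \<in> {a - 2 / real m .. a - 1 / real m} \<longleftrightarrow> 1 \<le> real m * (a - t) \<and> real m * (a - t) \<le> 2"
        using m by (auto simp: field_simps)
      \<comment> \<open>This keeps the two strips apart: on each of them the cut-off belonging to
        the other end has derivative 0.\<close>
      have sum: "real m * t + real m * (a - t) > 4" using ma by (simp add: algebra_simps)
      consider (1) "t \<in> {1 / real m .. 2 / real m}" | (2) "t \<in> {a - 2 / real m .. a - 1 / real m}"
        | (3) "t \<notin> {1 / real m .. 2 / real m}" "t \<notin> {a - 2 / real m .. a - 1 / real m}" by blast
      then show ?thesis
      proof cases
        case 1
        then have t: "1 \<le> real m * t" "real m * t \<le> 2" "real m * (a - t) > 2" using I1 sum by auto
        have "B1 t = 0" "B2 t = 0" using deriv_step_0 deriv2_step_0 t by (auto simp: B1_def B2_def)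
        then have "\<bar>P t\<bar> \<le> real m * C" "\<bar>Q t\<bar> \<le> (real m)\<^sup>2 * C"
          using C(2)[of "real m * t"] C(3)[of "real m * t"] AB(2) C(1)
            mult_mono[of "\<bar>A1 t\<bar>" C "\<bar>B t\<bar>" 1] mult_mono[of "\<bar>A2 t\<bar>" C "\<bar>B t\<bar>" 1]
          by (auto simp: P_def Q_def abs_mult A1_def A2_def intro!: mult_left_mono)
        moreover have "\<bar>sin (k * t)\<bar> \<le> 2 * k / real m"
        proof -
          have "\<bar>sin (k * t)\<bar> \<le> \<bar>k * t\<bar>" by (rule abs_sin_x_le_abs_x)
          also have "\<dots> = k * t"
          proof -
            have "0 < real m * t" using t(1) by linarith
            then have "0 < t" using m by (simp add: zero_less_mult_iff)
            then show ?thesis using k by simp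
          qed
          also have "\<dots> \<le> k * (2 / real m)" using t m k by (intro mult_left_mono) (auto simp: pos_le_divide_eq mult.commute)
          finally show ?thesis by (simp add: mult.commute)
        qed
        ultimately have "\<bar>sin_cut_err a m t\<bar> \<le> 4 * k * C * real m" unfolding err by (rule gen)
        also have "\<dots> \<le> 4 * k * C * real m * (indicator {1 / real m .. 2 / real m} t + indicator {a - 2 / real m .. a - 1 / real m} t)"
        proof -
          have "1 \<le> indicat_real {1 / real m .. 2 / real m} t + indicator {a - 2 / real m .. a - 1 / real m} t"
            using 1 by (simp add: indicator_def)
          from mult_left_mono[OF this, of "4 * k * C * real m"] k C(1) m show ?thesis by simp
        qed
        finally show ?thesis .
      next
        case 2
        then have t: "1 \<le> real m * (a - t)" "real m * (a - t) \<le> 2" "real m * t > 2" using I2 sum by auto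
        have "A1 t = 0" "A2 t = 0" using deriv_step_0 deriv2_step_0 t by (auto simp: A1_def A2_def)
        then have "\<bar>P t\<bar> \<le> real m * C" "\<bar>Q t\<bar> \<le> (real m)\<^sup>2 * C"
          using C(2)[of "real m * (a - t)"] C(3)[of "real m * (a - t)"] AB(1) C(1)
            mult_mono[of "\<bar>A t\<bar>" 1 "\<bar>B1 t\<bar>" C] mult_mono[of "\<bar>A t\<bar>" 1 "\<bar>B2 t\<bar>" C]
          by (auto simp: P_def Q_def abs_mult B1_def B2_def intro!: mult_left_mono)
        moreover have "\<bar>sin (k * t)\<bar> \<le> 2 * k / real m"
        proof -
          \<comment> \<open>The reflection t to a - t makes the sine small near the far end as
            well.\<close>
          have "k * t = pi - k * (a - t)" using a by (simp add: k_def field_simps)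
          then have "sin (k * t) = sin (k * (a - t))" by (simp only: sin_pi_minus)
          then have "\<bar>sin (k * t)\<bar> \<le> \<bar>k * (a - t)\<bar>" using abs_sin_x_le_abs_x by metis
          also have "\<dots> = k * (a - t)"
          proof -
            have "0 < real m * (a - t)" using t(1) by linarith
            then have "0 < a - t" using m by (simp only: zero_less_mult_iff) auto
            then show ?thesis using k by simp
          qed
          also have "\<dots> \<le> k * (2 / real m)" using t m k by (intro mult_left_mono) (auto simp: pos_le_divide_eq mult.commute)
          finally show ?thesis by (simp add: mult.commute)
        qed
        ultimately have "\<bar>sin_cut_err a m t\<bar> \<le> 4 * k * C * real m" unfolding err by (rule gen)
        also have "\<dots> \<le> 4 * k * C * real m * (indicator {1 / real m .. 2 / real m} t + indicator {a - 2 / real m .. a - 1 / real m} t)"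
        proof -
          have "1 \<le> indicat_real {1 / real m .. 2 / real m} t + indicator {a - 2 / real m .. a - 1 / real m} t"
            using 2 by (simp add: indicator_def)
          from mult_left_mono[OF this, of "4 * k * C * real m"] k C(1) m show ?thesis by simp
        qed
        finally show ?thesis .
      next
        case 3
        then have "A1 t = 0" "A2 t = 0" "B1 t = 0" "B2 t = 0"
          unfolding I1 I2 A1_def A2_def B1_def B2_def
          by (intro deriv_step_0 deriv2_step_0; linarith)+
        then show ?thesis using k C(1) m by (simp add: err P_def Q_def)
      qed
    qed
  qed
qed

lemma column_simps: "column a m p 1 = sin_cut a m" "column a m p 2 = sin_cut a m" "column a m p 3 = p"
  by (simp_all add: column_def)

lemma tensor_column: "tensor (column a m p) x = sin_cut a m (x$1) * sin_cut a m (x$2) * p (x$3)"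
  unfolding tensor_def by (simp only: prod_UNIV_3 column_simps)

lemma column_test:
  assumes a: "a > 0" and m: "m > 0" and p: "smooth1 p" "\<And>z. z \<notin> {c..d} \<Longrightarrow> p z = 0" "c > 0"
  shows "tensor_test (box_dom a) (column a m p)"
proof -
  let ?p = "(\<chi> i. if i = 3 then c else 1 / real m) :: real^3"
  let ?q = "(\<chi> i. if i = 3 then d else a - 1 / real m) :: real^3"
  have "smooth1 (column a m p i)" for i using p smooth1_sin_cut by (simp add: column_def)
  moreover have "cbox ?p ?q \<subseteq> box_dom a"
  proof
    fix x assume x: "x \<in> cbox ?p ?q"
    define e where "e = 1 / real m"
    have "0 < e" using m by (simp add: e_def)
    with x p(3) show "x \<in> box_dom a"
      unfolding e_def[symmetric] by (auto simp: mem_box_cart forall_3 box_dom_def)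
  qed
  moreover have "column a m p i z = 0" if "z \<notin> {?p $ i .. ?q $ i}" for i z
    using that p(2) sin_cut_support[OF m] by (auto simp: column_def split: if_splits)
  ultimately show ?thesis unfolding tensor_test_def by blast
qed

section \<open>Exponentially weighted integrability and removal of the lateral cut-offs\<close>

abbreviation (input) dom_measure :: "real \<Rightarrow> (real^3) measure" where
  "dom_measure a \<equiv> lebesgue_on (box_dom a)"

lemma borel_measurable_dom: "f \<in> borel_measurable borel \<Longrightarrow> f \<in> borel_measurable (dom_measure a)"
  by (intro measurable_restrict_space1 borel_measurable_lebesgueI)

text \<open>Shared by square integrable functions, through Cauchy-Schwarz, and by u^2, which is
  integrable. It supplies the dominating function whenever a cut-off is removed.\<close>

definition decaying :: "real \<Rightarrow> real \<Rightarrow> (real^3 \<Rightarrow> real) \<Rightarrow> bool" where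
  "decaying a b f \<longleftrightarrow> integrable (dom_measure a) (\<lambda>x. f x * exp (- b * x$3))"

lemma decaying_measurable: "decaying a b f \<Longrightarrow> f \<in> borel_measurable (dom_measure a)"
proof -
  assume "decaying a b f"
  then have "(\<lambda>x. f x * exp (- b * x$3)) \<in> borel_measurable (dom_measure a)"
    unfolding decaying_def by (rule borel_measurable_integrable)
  moreover have "(\<lambda>x. exp (b * x$3)) \<in> borel_measurable (dom_measure a)"
    by (rule borel_measurable_dom) measurable
  ultimately have "(\<lambda>x. f x * exp (- b * x$3) * exp (b * x$3)) \<in> borel_measurable (dom_measure a)"
    by (rule borel_measurable_times)
  then show ?thesis by (simp add: mult.assoc exp_add[symmetric])
qed

lemma decaying_integrable:
  assumes f: "decaying a b f" and m: "m \<in> borel_measurable (dom_measure a)"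
    and bd: "\<And>x. x \<in> box_dom a \<Longrightarrow> \<bar>m x\<bar> \<le> C * exp (- b * x$3)"
  shows "integrable (dom_measure a) (\<lambda>x. f x * m x)"
proof (rule Bochner_Integration.integrable_bound)
  show "integrable (dom_measure a) (\<lambda>x. C * (f x * exp (- b * x$3)))"
    using f unfolding decaying_def by (rule integrable_mult_right)
  show "(\<lambda>x. f x * m x) \<in> borel_measurable (dom_measure a)"
    by (rule borel_measurable_times[OF decaying_measurable[OF f] m])
  show "AE x in dom_measure a. norm (f x * m x) \<le> norm (C * (f x * exp (- b * x$3)))"
  proof (rule AE_I2)
    fix x assume "x \<in> space (dom_measure a)"
    then have "\<bar>m x\<bar> \<le> \<bar>C\<bar> * exp (- b * x$3)"
      using bd[of x] by (auto intro: order_trans[OF _ mult_right_mono[OF abs_ge_self]])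
    from mult_left_mono[OF this, of "\<bar>f x\<bar>"]
    show "norm (f x * m x) \<le> norm (C * (f x * exp (- b * x$3)))" by (simp add: abs_mult mult_ac)
  qed
qed

lemma decaying_convergence:
  assumes f: "decaying a b f" and m: "\<And>n. m n \<in> borel_measurable (dom_measure a)"
    and m': "m' \<in> borel_measurable (dom_measure a)"
    and bd: "\<And>n x. x \<in> box_dom a \<Longrightarrow> \<bar>m n x\<bar> \<le> C * exp (- b * x$3)"
    and lim: "\<And>x. x \<in> box_dom a \<Longrightarrow> (\<lambda>n. m n x) \<longlonglongrightarrow> m' x"
  shows "(\<lambda>n. \<integral>x. f x * m n x \<partial>dom_measure a) \<longlonglongrightarrow> (\<integral>x. f x * m' x \<partial>dom_measure a)"
proof (rule integral_dominated_convergence)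
  show "integrable (dom_measure a) (\<lambda>x. C * \<bar>f x * exp (- b * x$3)\<bar>)"
    using f unfolding decaying_def by (intro integrable_mult_right integrable_abs)
  show "(\<lambda>x. f x * m n x) \<in> borel_measurable (dom_measure a)" for n
    by (rule borel_measurable_times[OF decaying_measurable[OF f] m])
  show "(\<lambda>x. f x * m' x) \<in> borel_measurable (dom_measure a)"
    by (rule borel_measurable_times[OF decaying_measurable[OF f] m'])
  show "AE x in dom_measure a. (\<lambda>n. f x * m n x) \<longlonglongrightarrow> f x * m' x"
    using lim by (intro AE_I2 tendsto_mult_left) simp
  show "AE x in dom_measure a. norm (f x * m n x) \<le> C * \<bar>f x * exp (- b * x$3)\<bar>" for n
  proof (rule AE_I2)
    fix x assume "x \<in> space (dom_measure a)"
    then have "\<bar>f x\<bar> * \<bar>m n x\<bar> \<le> \<bar>f x\<bar> * (C * exp (- b * x$3))"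
      using bd[of x n] by (intro mult_left_mono) auto
    then show "norm (f x * m n x) \<le> C * \<bar>f x * exp (- b * x$3)\<bar>" by (simp add: abs_mult mult_ac)
  qed
qed

lemma L2_decaying:
  assumes "b > 0" "f \<in> L2 (dom_measure a)"
  shows "decaying a b f"
  unfolding decaying_def
proof (rule L2_mult_integrable[OF assms(2)])
  have "(\<lambda>x. (exp (- b * x$3))\<^sup>2) = (\<lambda>x::real^3. exp (- (2 * b) * x$3))"
    by (auto simp: power2_eq_square exp_add[symmetric] fun_eq_iff)
  then show "(\<lambda>x. exp (- b * x$3)) \<in> L2 (dom_measure a)"
    using exp_integrable_box_dom[of "2 * b" a] assms(1) unfolding L2_def
    by (auto intro!: borel_measurable_dom)
qed

lemma sin_weight_measurable:
  "p \<in> borel_measurable borel \<Longrightarrow> sin_weight a p \<in> borel_measurable (dom_measure a)"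
proof -
  assume "p \<in> borel_measurable borel"
  then have [measurable]: "(\<lambda>x::real^3. p (x $ 3)) \<in> borel_measurable borel"
    by (rule measurable_compose[OF measurable_vec_nth'])
  show ?thesis unfolding sin_weight_def[abs_def] by (rule borel_measurable_dom) measurable
qed

lemma sin_weight_le: "\<bar>sin_weight a p x\<bar> \<le> \<bar>p (x$3)\<bar>"
  unfolding sin_weight_def abs_mult
  by (rule mult_left_le_one_le[OF abs_ge_zero]) (auto intro!: mult_le_one)

lemma bounded_support_exp_bound:
  assumes "smooth1 p" "\<And>z. z \<notin> {c..d} \<Longrightarrow> p z = 0" "b > 0"
  obtains C where "C > 0" "\<And>z. \<bar>p z\<bar> \<le> C * exp (- b * z)"
proof -
  obtain B where B: "B > 0" "\<And>z. \<bar>p z\<bar> \<le> B" using smooth1_bounded_support[OF assms(1,2)] by metis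
  show ?thesis
  proof (rule that[of "B * exp (b * d)"])
    show "\<bar>p z\<bar> \<le> B * exp (b * d) * exp (- b * z)" for z
    proof (cases "z \<in> {c..d}")
      case True
      then have "1 \<le> exp (b * d + - b * z)" using assms(3) by simp
      then have "B * 1 \<le> B * exp (b * d + - b * z)" using B(1) by (intro mult_left_mono) auto
      moreover have "B * exp (b * d) * exp (- b * z) = B * exp (b * d + - b * z)"
        by (simp only: exp_add mult.assoc)
      ultimately show ?thesis using B(2)[of z] by linarith
    qed (use assms(2) B(1) in simp)
  qed (use B in simp)
qed

lemma column_integral_tendsto:
  assumes f: "decaying a b f" "b > 0" and p: "smooth1 p" "\<And>z. z \<notin> {c..d} \<Longrightarrow> p z = 0"
  shows "(\<lambda>m. \<integral>x. f x * tensor (column a m p) x \<partial>dom_measure a) \<longlonglongrightarrow> (\<integral>x. f x * sin_weight a p x \<partial>dom_measure a)"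
proof -
  obtain C where C: "C > 0" "\<And>z. \<bar>p z\<bar> \<le> C * exp (- b * z)"
    using bounded_support_exp_bound[OF p f(2)] by metis
  show ?thesis
  proof (rule decaying_convergence[OF f(1)])
    have "smooth1 (column a m p i)" for m i using p smooth1_sin_cut by (simp add: column_def)
    then show "tensor (column a m p) \<in> borel_measurable (dom_measure a)" for m
      by (intro borel_measurable_dom tensor_measurable)
    show "sin_weight a p \<in> borel_measurable (dom_measure a)"
      by (intro sin_weight_measurable smooth1_measurable p)
    show "\<bar>tensor (column a m p) x\<bar> \<le> C * exp (- b * x$3)" for m x
    proof -
      have "\<bar>tensor (column a m p) x\<bar> \<le> \<bar>p (x$3)\<bar>"
        unfolding tensor_column abs_mult
        by (rule mult_left_le_one_le[OF abs_ge_zero]) (auto intro!: mult_le_one sin_cut_le_1)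
      with C(2)[of "x$3"] show ?thesis by linarith
    qed
    show "(\<lambda>m. tensor (column a m p) x) \<longlonglongrightarrow> sin_weight a p x" if "x \<in> box_dom a" for x
      using that unfolding tensor_column sin_weight_def
      by (intro tendsto_intros sin_cut_tendsto) (auto simp: box_dom_def)
  qed
qed

text \<open>The lateral cut-offs are not differentiated by a vertical derivative, so they disappear
  by dominated convergence and leave no boundary term.\<close>

lemma vertical_parts:
  assumes a: "a > 0" and f: "decaying a b f" and g: "decaying a b g" and b: "b > 0"
    and TD: "\<And>F. tensor_test (box_dom a) F \<Longrightarrow>
      (\<integral>x. f x * tensor (F(3 := deriv (F 3))) x \<partial>dom_measure a) = - (\<integral>x. g x * tensor F x \<partial>dom_measure a)"
    and p: "smooth1 p" "\<And>z. z \<notin> {c..d} \<Longrightarrow> p z = 0" "c > 0"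
  shows "(\<integral>x. f x * sin_weight a (deriv p) x \<partial>dom_measure a) = - (\<integral>x. g x * sin_weight a p x \<partial>dom_measure a)"
proof (rule LIMSEQ_unique)
  show "(\<lambda>m. \<integral>x. f x * tensor (column a m (deriv p)) x \<partial>dom_measure a) \<longlonglongrightarrow> (\<integral>x. f x * sin_weight a (deriv p) x \<partial>dom_measure a)"
    by (rule column_integral_tendsto[OF f b smooth1_smooth_deriv[OF p(1)]]) (rule deriv_support[OF p(2)])
  have eq: "(\<integral>x. f x * tensor (column a m (deriv p)) x \<partial>dom_measure a) = - (\<integral>x. g x * tensor (column a m p) x \<partial>dom_measure a)"
    if m: "m \<ge> 1" for m
  proof -
    have "(column a m p)(3 := deriv (column a m p 3)) = column a m (deriv p)"
      by (auto simp: column_def fun_eq_iff)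
    with TD[OF column_test[OF a _ p, of m]] m show ?thesis by simp
  qed
  have "(\<lambda>m. - (\<integral>x. g x * tensor (column a m p) x \<partial>dom_measure a)) \<longlonglongrightarrow> - (\<integral>x. g x * sin_weight a p x \<partial>dom_measure a)"
    by (intro tendsto_minus column_integral_tendsto[OF g b p(1,2)])
  then show "(\<lambda>m. \<integral>x. f x * tensor (column a m (deriv p)) x \<partial>dom_measure a) \<longlonglongrightarrow> - (\<integral>x. g x * sin_weight a p x \<partial>dom_measure a)"
    by (rule Lim_transform_eventually) (use eq in \<open>auto intro!: eventually_sequentiallyI[of 1]\<close>)
qed

text \<open>The lower cut-off acts on the scale 1/n, so that its derivative is the concentrating
  \<open>layer n\<close>; the upper one acts on a fixed scale near z = n, so that its derivative
  stays bounded and moves off to infinity.\<close>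

definition exp_cut :: "real \<Rightarrow> nat \<Rightarrow> real \<Rightarrow> real" where
  "exp_cut b n z = exp (- b * z) * (step (real n * z) * step (real n - z))"

lemma smooth1_exp_cut: "smooth1 (exp_cut b n)"
proof -
  have "smooth1 (\<lambda>z. exp ((- b) * z) * (step (real n * z + 0) * step ((- 1) * z + real n)))"
    by (intro smooth1_mult smooth1_exp smooth1_affine smooth1_step)
  then show ?thesis by (simp add: exp_cut_def[abs_def])
qed

lemma exp_cut_support:
  assumes "n > 0" "z \<notin> {1 / real n .. real n}"
  shows "exp_cut b n z = 0"
proof -
  have "real n * z \<le> 1 \<or> real n - z \<le> 1" using assms by (auto simp: not_le field_simps)
  then show ?thesis by (auto simp: exp_cut_def step_0)
qed

lemma deriv_exp_cut:
  "deriv (exp_cut b n) z = - b * exp_cut b n z + exp (- b * z) * (layer n z * step (real n - z))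
     - exp (- b * z) * (step (real n * z) * deriv step (real n - z))"
proof (rule DERIV_imp_deriv)
  have l1: "((\<lambda>z. real n * z) has_real_derivative real n) (at z)"
    and l2: "((\<lambda>z. real n - z) has_real_derivative - 1) (at z)"
    and e: "((\<lambda>z. exp (- b * z)) has_real_derivative - b * exp (- b * z)) (at z)"
    by (auto intro!: derivative_eq_intros)
  show "(exp_cut b n has_real_derivative - b * exp_cut b n z + exp (- b * z) * (layer n z * step (real n - z))
     - exp (- b * z) * (step (real n * z) * deriv step (real n - z))) (at z)"
    unfolding exp_cut_def[abs_def]
    by (rule DERIV_cong[OF DERIV_mult[OF e DERIV_mult[OF DERIV_chain2[OF smooth1_deriv[OF smooth1_step] l1]
          DERIV_chain2[OF smooth1_deriv[OF smooth1_step] l2]]]])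
       (simp add: layer_def algebra_simps)
qed

lemma step_shift_tendsto: "(\<lambda>n. step (real n - z)) \<longlonglongrightarrow> 1"
proof (rule tendsto_eventually, rule eventually_sequentiallyI[of "nat \<lceil>z + 2\<rceil>"])
  fix n assume "nat \<lceil>z + 2\<rceil> \<le> n"
  then have "z + 2 \<le> real n" by linarith
  then show "step (real n - z) = 1" by (intro step_1) simp
qed

lemma deriv_step_shift_tendsto: "(\<lambda>n. deriv step (real n - z)) \<longlonglongrightarrow> 0"
proof (rule tendsto_eventually, rule eventually_sequentiallyI[of "nat \<lceil>z + 2\<rceil>"])
  fix n assume "nat \<lceil>z + 2\<rceil> \<le> n"
  then have "z + 2 \<le> real n" by linarith
  then show "deriv step (real n - z) = 0" by (intro deriv_step_0) simp
qed

lemma exp_cut_integral_tendsto: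
  assumes f: "decaying a b f"
  shows "(\<lambda>n. \<integral>x. f x * sin_weight a (exp_cut b n) x \<partial>dom_measure a) \<longlonglongrightarrow> (\<integral>x. f x * weight a b x \<partial>dom_measure a)"
proof (rule decaying_convergence[OF f])
  show "sin_weight a (exp_cut b n) \<in> borel_measurable (dom_measure a)" for n
    by (intro sin_weight_measurable smooth1_measurable smooth1_exp_cut)
  show "weight a b \<in> borel_measurable (dom_measure a)"
    unfolding weight_eq[abs_def] by (intro sin_weight_measurable) measurable
  show "\<bar>sin_weight a (exp_cut b n) x\<bar> \<le> 1 * exp (- b * x$3)" for n x
  proof -
    have "\<bar>exp_cut b n z\<bar> \<le> exp (- b * z)" for z
      unfolding exp_cut_def abs_mult using step_ge_0 step_le_1
      by (auto intro!: mult_left_le mult_le_one)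
    then show ?thesis using order_trans[OF sin_weight_le] by simp
  qed
  show "(\<lambda>n. sin_weight a (exp_cut b n) x) \<longlonglongrightarrow> weight a b x" if "x \<in> box_dom a" for x
  proof -
    have z: "x$3 > 0" using that by (simp add: box_dom_def)
    have "(\<lambda>n. exp_cut b n (x$3)) \<longlonglongrightarrow> exp (- b * x$3) * (1 * 1)"
      unfolding exp_cut_def using step_scaled_tendsto[of "x$3"] z
      by (intro tendsto_intros step_shift_tendsto) simp
    then show ?thesis unfolding weight_eq sin_weight_def by (intro tendsto_intros) simp
  qed
qed

text \<open>Integration by parts in z against the weight, whose own z-derivative is -b times itself.
  The left side is the bottom term in integrated form; its limit is identified separately for each
  f, from the boundary values of f.\<close>

lemma vertical_boundary_limit:
  assumes a: "a > 0" and f: "decaying a b f" and g: "decaying a b g" and b: "b > 0"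
    and TD: "\<And>F. tensor_test (box_dom a) F \<Longrightarrow>
      (\<integral>x. f x * tensor (F(3 := deriv (F 3))) x \<partial>dom_measure a) = - (\<integral>x. g x * tensor F x \<partial>dom_measure a)"
  shows "(\<lambda>n. \<integral>x. f x * weight a b x * layer n (x$3) \<partial>dom_measure a)
    \<longlonglongrightarrow> b * (\<integral>x. f x * weight a b x \<partial>dom_measure a) - (\<integral>x. g x * weight a b x \<partial>dom_measure a)"
proof -
  let ?M = "dom_measure a"
  obtain C where C: "C > 0" "\<And>x. \<bar>deriv step x\<bar> \<le> C" "\<And>x. \<bar>deriv (deriv step) x\<bar> \<le> C"
    by (rule step_derivs_bounded) blast
  \<comment> \<open>The term of \<open>deriv_exp_cut\<close> that comes from the upper cut-off:
    dominated by a multiple of exp (-b z) and pointwise convergent to 0.\<close>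
  define T where "T n z = exp (- b * z) * (step (real n * z) * deriv step (real n - z))" for n z
  have step_abs: "\<bar>step y\<bar> \<le> 1" for y using step_ge_0[of y] step_le_1[of y] by simp
  have sm: "smooth1 (\<lambda>z. exp ((- b) * z) * (step (real n * z + 0) * deriv step ((- 1) * z + real n)))" for n
    by (intro smooth1_mult smooth1_exp smooth1_affine smooth1_step smooth1_smooth_deriv)
  have Tm: "sin_weight a (T n) \<in> borel_measurable ?M" for n
    using smooth1_measurable[OF sm[of n]] by (intro sin_weight_measurable) (simp add: T_def[abs_def])
  have Tb: "\<bar>sin_weight a (T n) x\<bar> \<le> C * exp (- b * x$3)" for n x
  proof -
    have "\<bar>step (real n * z)\<bar> * \<bar>deriv step (real n - z)\<bar> \<le> 1 * C" for z
      using step_abs C by (intro mult_mono) auto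
    then have "\<bar>T n z\<bar> \<le> C * exp (- b * z)" for z
      unfolding T_def abs_mult by (simp add: mult.commute)
    then show ?thesis using order_trans[OF sin_weight_le] by blast
  qed
  have Tlim: "(\<lambda>n. \<integral>x. f x * sin_weight a (T n) x \<partial>?M) \<longlonglongrightarrow> (\<integral>x. f x * 0 \<partial>?M)"
  proof (rule decaying_convergence[OF f Tm _ Tb])
    show "(\<lambda>n. sin_weight a (T n) x) \<longlonglongrightarrow> 0" if x: "x \<in> box_dom a" for x
    proof -
      have z: "x$3 > 0" using x by (simp add: box_dom_def)
      have "(\<lambda>n. T n (x$3)) \<longlonglongrightarrow> exp (- b * x$3) * (1 * 0)"
        unfolding T_def using step_scaled_tendsto[of "x$3"] z
        by (intro tendsto_intros deriv_step_shift_tendsto) simp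
      then have "(\<lambda>n. sin_weight a (T n) x) \<longlonglongrightarrow> sin (pi / a * x$1) * sin (pi / a * x$2) * 0"
        unfolding sin_weight_def by (intro tendsto_intros) simp
      then show ?thesis by simp
    qed
  qed simp
  have eq: "b * (\<integral>x. f x * sin_weight a (exp_cut b n) x \<partial>?M) + (\<integral>x. f x * sin_weight a (T n) x \<partial>?M)
      - (\<integral>x. g x * sin_weight a (exp_cut b n) x \<partial>?M) = (\<integral>x. f x * weight a b x * layer n (x$3) \<partial>?M)"
    if n: "n \<ge> 3" for n
  proof -
    have n0: "n > 0" using n by simp
    have sup: "exp_cut b n z = 0" if "z \<notin> {1 / real n .. real n}" for z
      using exp_cut_support[OF n0 that] .
    have 1: "(\<integral>x. f x * sin_weight a (deriv (exp_cut b n)) x \<partial>?M) = - (\<integral>x. g x * sin_weight a (exp_cut b n) x \<partial>?M)"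
      by (rule vertical_parts[OF a f g b TD smooth1_exp_cut sup]) (use n0 in auto)
    \<comment> \<open>For n \<ge> 3 the layer lives at z \<le> 1 \<le> n - 2, where the upper
      cut-off is 1.\<close>
    have lay: "layer n z * step (real n - z) = layer n z" for z
    proof (cases "layer n z = 0")
      case False
      from layer_support[OF this] have "z \<le> 2 / real n" by simp
      also have "2 / real n \<le> 1" using n by (simp add: divide_le_eq)
      finally have "step (real n - z) = 1" using n by (intro step_1) linarith
      then show ?thesis by simp
    qed simp
    have pt: "f x * weight a b x * layer n (x$3) = f x * sin_weight a (deriv (exp_cut b n)) x
        + (b * (f x * sin_weight a (exp_cut b n) x) + f x * sin_weight a (T n) x)" for x
      unfolding weight_eq sin_weight_def deriv_exp_cut lay T_def by (simp add: algebra_simps)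
    have dec: "integrable ?M (\<lambda>x. f x * sin_weight a q x)" if q: "smooth1 q" "\<And>z. z \<notin> {c..d} \<Longrightarrow> q z = 0" for q c d
    proof -
      obtain C where C: "C > 0" "\<And>z. \<bar>q z\<bar> \<le> C * exp (- b * z)"
        using bounded_support_exp_bound[OF q b] by metis
      show ?thesis
        by (rule decaying_integrable[OF f sin_weight_measurable[OF smooth1_measurable[OF q(1)]]])
           (rule order_trans[OF sin_weight_le C(2)])
    qed
    have i1: "integrable ?M (\<lambda>x. f x * sin_weight a (deriv (exp_cut b n)) x)"
      by (rule dec[OF smooth1_smooth_deriv[OF smooth1_exp_cut]]) (rule deriv_support[OF sup])
    have i2: "integrable ?M (\<lambda>x. f x * sin_weight a (exp_cut b n) x)"
      by (rule dec[OF smooth1_exp_cut sup])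
    have i3: "integrable ?M (\<lambda>x. f x * sin_weight a (T n) x)"
      by (rule decaying_integrable[OF f Tm Tb])
    show ?thesis unfolding pt using i1 i2 i3 1 by simp
  qed
  have "(\<lambda>n. b * (\<integral>x. f x * sin_weight a (exp_cut b n) x \<partial>?M) + (\<integral>x. f x * sin_weight a (T n) x \<partial>?M)
      - (\<integral>x. g x * sin_weight a (exp_cut b n) x \<partial>?M))
    \<longlonglongrightarrow> b * (\<integral>x. f x * weight a b x \<partial>?M) + (\<integral>x. f x * 0 \<partial>?M) - (\<integral>x. g x * weight a b x \<partial>?M)"
    by (intro tendsto_intros exp_cut_integral_tendsto f g Tlim)
  from Lim_transform_eventually[OF this] eq
  have "(\<lambda>n. \<integral>x. f x * weight a b x * layer n (x$3) \<partial>?M)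
    \<longlonglongrightarrow> b * (\<integral>x. f x * weight a b x \<partial>?M) + (\<integral>x. f x * 0 \<partial>?M) - (\<integral>x. g x * weight a b x \<partial>?M)"
    by (meson eventually_sequentiallyI)
  then show ?thesis by simp
qed

text \<open>A non-integrable f has integral 0 by convention, which the integral of H, nonnegative
  almost everywhere, dominates; only the majorant has to be integrable.\<close>

lemma abs_integral_le:
  fixes f H :: "'a \<Rightarrow> real"
  assumes H: "integrable M H" and le: "AE x in M. \<bar>f x\<bar> \<le> H x"
  shows "\<bar>\<integral>x. f x \<partial>M\<bar> \<le> (\<integral>x. H x \<partial>M)"
proof (cases "integrable M f")
  case True
  have "\<bar>\<integral>x. f x \<partial>M\<bar> \<le> (\<integral>x. \<bar>f x\<bar> \<partial>M)" by (rule integral_abs_bound)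
  also have "\<dots> \<le> (\<integral>x. H x \<partial>M)" using True H le by (intro integral_mono_AE) auto
  finally show ?thesis .
next
  case False
  have "0 \<le> (\<integral>x. H x \<partial>M)"
    by (rule integral_nonneg_AE) (use le in eventually_elim, auto)
  with False show ?thesis by (simp add: not_integrable_integral_eq)
qed

section \<open>Vanishing of the terms at the side faces\<close>

lemma indicator_cbox_integral:
  assumes "S \<in> sets lebesgue"
  shows "integrable (lebesgue_on S) (indicat_real (cbox u v))"
    "(\<integral>x. indicat_real (cbox u v) x \<partial>lebesgue_on S) \<le> measure lebesgue (cbox u v)"
proof -
  have i: "integrable lebesgue (indicat_real (cbox u v))"
    using lmeasurable_compact[of "cbox u v"] by (simp only: lmeasurable_iff_integrable compact_cbox)
  have i2: "integrable lebesgue (\<lambda>x. indicator S x *\<^sub>R indicat_real (cbox u v) x)"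
    by (rule integrable_mult_indicator[OF assms i])
  show "integrable (lebesgue_on S) (indicat_real (cbox u v))"
    using assms i2 by (subst integrable_restrict_space) auto
  have "(\<integral>x. indicat_real (cbox u v) x \<partial>lebesgue_on S) = (\<integral>x. indicator S x *\<^sub>R indicat_real (cbox u v) x \<partial>lebesgue)"
    using assms by (subst integral_restrict_space) auto
  also have "\<dots> \<le> (\<integral>x. indicat_real (cbox u v) x \<partial>lebesgue)"
    by (rule integral_mono[OF i2 i]) (auto simp: indicator_def)
  also have "\<dots> = measure lebesgue (cbox u v)" by simp
  finally show "(\<integral>x. indicat_real (cbox u v) x \<partial>lebesgue_on S) \<le> measure lebesgue (cbox u v)" .
qed

lemma tensor_column_upd_le:
  assumes "i \<noteq> 3"
  shows "\<bar>tensor ((column a m p)(i := h)) x\<bar> \<le> \<bar>h (x$i)\<bar> * \<bar>p (x$3)\<bar>"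
proof -
  have "i = 1 \<or> i = 2" using assms exhaust_3[of i] by blast
  then have "\<exists>j. tensor ((column a m p)(i := h)) x = sin_cut a m (x$j) * (h (x$i) * p (x$3))"
    unfolding tensor_def prod_UNIV_3
    by (elim disjE) (auto simp: column_def intro: exI[of _ 1] exI[of _ 2])
  then obtain j where "tensor ((column a m p)(i := h)) x = sin_cut a m (x$j) * (h (x$i) * p (x$3))" ..
  then show ?thesis
    using mult_left_le_one_le[of "\<bar>h (x$i) * p (x$3)\<bar>" "\<bar>sin_cut a m (x$j)\<bar>"] sin_cut_le_1
    by (simp add: abs_mult)
qed

text \<open>Uniform continuity up to the height d: a point within s of a side face is within s of
  its projection onto that face, where G vanishes.\<close>

lemma lateral_small:
  fixes G :: "real^3 \<Rightarrow> real"
  assumes a: "a > 0" and G: "continuous_on (closure (box_dom a)) G"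
    and G0: "\<And>x. x \<in> frontier (box_dom a) - bottom a \<Longrightarrow> G x = 0" and i: "i \<noteq> 3" and e: "e > 0"
  obtains s where "s > 0"
    "\<And>x. x \<in> box_dom a \<Longrightarrow> x$3 \<le> d \<Longrightarrow> x$i < s \<or> a - s < x$i \<Longrightarrow> \<bar>G x\<bar> < e"
proof -
  define K :: "(real^3) set" where "K = cbox 0 (vector [a, a, d])"
  have KC: "K \<subseteq> closure (box_dom a)"
    unfolding K_def closure_box_dom[OF a] by (auto simp: mem_box_cart forall_3)
  have "uniformly_continuous_on K G"
    by (rule compact_uniformly_continuous[OF continuous_on_subset[OF G KC]]) (simp add: K_def)
  then obtain s where s: "s > 0" "\<And>x x'. x \<in> K \<Longrightarrow> x' \<in> K \<Longrightarrow> dist x' x < s \<Longrightarrow> dist (G x') (G x) < e"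
    using e unfolding uniformly_continuous_on_def by metis
  show ?thesis
  proof (rule that[OF s(1)])
    fix x assume x: "x \<in> box_dom a" "x$3 \<le> d" "x$i < s \<or> a - s < x$i"
    have i12: "i = 1 \<or> i = 2" using i exhaust_3[of i] by blast
    have xK: "x \<in> K" using x by (auto simp: K_def box_dom_def mem_box_cart forall_3)
    have *: "\<bar>G x\<bar> < e" if w: "w = 0 \<or> w = a" "\<bar>w - x$i\<bar> < s" for w
    proof -
      define x' where "x' = x + (w - x$i) *\<^sub>R axis i 1"
      have x'n: "x' $ j = (if j = i then w else x $ j)" for j by (simp add: x'_def axis_def)
      have x'K: "x' \<in> K" using xK w(1) a i12 by (auto simp: K_def mem_box_cart forall_3 x'n)
      have "G x' = 0"
        using i12 w(1) x'K KC
        by (intro G0 frontier_box_dom_lateral[OF a]) (auto simp: x'n)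
      moreover have "dist x' x < s" using w(2) by (simp add: x'_def dist_norm norm_axis_1)
      ultimately show ?thesis using s(2)[OF xK x'K] by (simp add: dist_real_def)
    qed
    have "0 < x$i" "x$i < a" using x(1) i12 by (auto simp: box_dom_def)
    with x(3) show "\<bar>G x\<bar> < e" using *[of 0] *[of a] by auto
  qed
qed

text \<open>An error of order m lives on strips of width 1/m, where the boundary condition makes G
  smaller than e. The integral is therefore at most a constant times e.\<close>

lemma column_err_tendsto:
  assumes a: "a > 0" and i: "i \<noteq> 3"
    and f: "f \<in> L2 (dom_measure a)" and G: "continuous_on (closure (box_dom a)) G"
    and G0: "\<And>x. x \<in> frontier (box_dom a) - bottom a \<Longrightarrow> G x = 0"
    and ae: "AE x in dom_measure a. G x = f x"
    and p: "smooth1 p" "\<And>z. z \<notin> {c..d} \<Longrightarrow> p z = 0" "c \<le> d"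
  shows "(\<lambda>m. \<integral>x. f x * tensor ((column a m p)(i := sin_cut_err a m)) x \<partial>dom_measure a) \<longlonglongrightarrow> 0"
proof (rule LIMSEQ_I)
  fix r :: real assume r: "r > 0"
  have i12: "i = 1 \<or> i = 2" using i exhaust_3[of i] by blast
  obtain E where E: "E > 0"
    "\<And>m t. real m * a > 4 \<Longrightarrow> \<bar>sin_cut_err a m t\<bar>
      \<le> E * real m * (indicator {1 / real m .. 2 / real m} t + indicator {a - 2 / real m .. a - 1 / real m} t)"
    using sin_cut_err_bound[OF a] by metis
  obtain B where B: "B > 0" "\<And>z. \<bar>p z\<bar> \<le> B" using smooth1_bounded_support[OF p(1,2)] by metis
  \<comment> \<open>The factor that multiplies e in the final estimate; the summand 1 keeps it
    positive for c = d and makes that estimate strict.\<close>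
  define L where "L = 2 * E * B * a * (d - c) + 1"
  have L: "L > 0" using E B a p(3) by (auto simp: L_def intro!: add_nonneg_pos mult_nonneg_nonneg)
  define e where "e = r / L"
  have e: "e > 0" using r L by (simp add: e_def)
  obtain s where s: "s > 0"
    "\<And>x. x \<in> box_dom a \<Longrightarrow> x$3 \<le> d \<Longrightarrow> x$i < s \<or> a - s < x$i \<Longrightarrow> \<bar>G x\<bar> < e"
    using lateral_small[OF a G G0 i e, of d] by metis
  obtain N1 N2 :: nat where N: "2 / s < real N1" "4 / a < real N2" using reals_Archimedean2 by metis
  have "norm ((\<integral>x. f x * tensor ((column a m p)(i := sin_cut_err a m)) x \<partial>dom_measure a) - 0) < r"
    if m: "m \<ge> max N1 N2" for m
  proof -
    have "2 / s < real m" "4 / a < real m" using N m by linarith+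
    then have ms: "2 < real m * s" "4 < real m * a"
      using s(1) a by (simp_all add: pos_divide_less_eq)
    have m0: "real m > 0" using ms(2) a by (cases "m = 0") auto
    have ms': "2 / real m < s" using ms(1) m0 by (simp add: pos_divide_less_eq mult.commute)
    define Q :: "real \<Rightarrow> real \<Rightarrow> (real^3) set" where
      "Q u v = cbox (\<chi> j. if j = i then u else if j = 3 then c else 0) (\<chi> j. if j = i then v else if j = 3 then d else a)" for u v
    have Qm: "measure lebesgue (Q u v) = (v - u) * a * (d - c)" if "u \<le> v" for u v
    proof -
      have ne: "Q u v \<noteq> {}"
        using that i12 a p(3) unfolding Q_def by (auto simp: interval_eq_empty_cart not_less)
      have "measure lebesgue (Q u v) = measure lborel (Q u v)" by (simp add: Q_def)
      also have "\<dots> = (\<Prod>j\<in>UNIV. (if j = i then v - u else if j = 3 then d - c else a))"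
        using ne unfolding Q_def by (subst content_cbox_cart) (auto intro!: prod.cong split: if_splits)
      also have "\<dots> = (v - u) * a * (d - c)" using i12 unfolding prod_UNIV_3 by auto
      finally show ?thesis .
    qed
    define Q1 Q2 where "Q1 = Q (1 / real m) (2 / real m)" and "Q2 = Q (a - 2 / real m) (a - 1 / real m)"
    have mQ: "measure lebesgue Q1 = 1 / real m * a * (d - c)" "measure lebesgue Q2 = 1 / real m * a * (d - c)"
      unfolding Q1_def Q2_def using m0 by (subst Qm; simp add: divide_right_mono diff_divide_distrib[symmetric])+
    have i1: "integrable (dom_measure a) (indicat_real Q1)" and i2: "integrable (dom_measure a) (indicat_real Q2)"
      unfolding Q1_def Q2_def Q_def by (rule indicator_cbox_integral; simp)+
    have leQ: "(\<integral>x. indicat_real (Q u v) x \<partial>dom_measure a) \<le> measure lebesgue (Q u v)" for u v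
      unfolding Q_def by (rule indicator_cbox_integral(2)) simp
    have le1: "(\<integral>x. indicat_real Q1 x \<partial>dom_measure a) \<le> 1 / real m * a * (d - c)"
      unfolding mQ(1)[symmetric] Q1_def by (rule leQ)
    have le2: "(\<integral>x. indicat_real Q2 x \<partial>dom_measure a) \<le> 1 / real m * a * (d - c)"
      unfolding mQ(2)[symmetric] Q2_def by (rule leQ)
    define H where "H x = e * (E * real m) * B * (indicat_real Q1 x + indicat_real Q2 x)" for x
    have Hi: "integrable (dom_measure a) H"
      unfolding H_def[abs_def] by (intro integrable_mult_right Bochner_Integration.integrable_add i1 i2)
    have pt: "\<bar>G x * tensor ((column a m p)(i := sin_cut_err a m)) x\<bar> \<le> H x" if x: "x \<in> box_dom a" for x
    proof -
      let ?t = "x$i"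
      let ?I = "indicat_real {1 / real m .. 2 / real m} ?t + indicat_real {a - 2 / real m .. a - 1 / real m} ?t"
      have t1: "\<bar>tensor ((column a m p)(i := sin_cut_err a m)) x\<bar> \<le> (E * real m * ?I) * \<bar>p (x$3)\<bar>"
        by (rule order_trans[OF tensor_column_upd_le[OF i] mult_right_mono[OF E(2)[OF ms(2)]]]) simp
      show ?thesis
      proof (cases "x$3 \<in> {c..d} \<and> ?I \<noteq> 0")
        case False
        then have "(E * real m * ?I) * \<bar>p (x$3)\<bar> = 0" using p(2) by auto
        then have "tensor ((column a m p)(i := sin_cut_err a m)) x = 0" using t1 by linarith
        moreover have "H x \<ge> 0" unfolding H_def using e E B m0 by (intro mult_nonneg_nonneg) (auto simp: indicator_def)
        ultimately show ?thesis by simp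
      next
        case True
        then have st: "?t < s \<or> a - s < ?t" using ms' by (auto simp: indicator_def split: if_splits)
        have Gs: "\<bar>G x\<bar> \<le> e" using s(2)[OF x _ st] True by auto
        have QI: "?I \<le> indicat_real Q1 x + indicat_real Q2 x"
        proof -
          have "indicat_real {u..v} ?t \<le> indicat_real (Q u v) x" for u v
            using x True i12 by (auto simp: indicator_def Q_def mem_box_cart forall_3 box_dom_def)
          then show ?thesis unfolding Q1_def Q2_def by (intro add_mono)
        qed
        have "\<bar>G x\<bar> * \<bar>tensor ((column a m p)(i := sin_cut_err a m)) x\<bar> \<le> e * ((E * real m * ?I) * B)"
          using Gs order_trans[OF t1 mult_left_mono[OF B(2)[of "x$3"]]] e E(1) m0
          by (intro mult_mono) (auto intro!: mult_nonneg_nonneg simp: indicator_def)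
        also have "\<dots> \<le> e * ((E * real m * (indicat_real Q1 x + indicat_real Q2 x)) * B)"
          using QI e E(1) m0 B(1) by (intro mult_left_mono mult_right_mono) auto
        finally show ?thesis by (simp add: H_def abs_mult mult_ac)
      qed
    qed
    have "\<bar>\<integral>x. f x * tensor ((column a m p)(i := sin_cut_err a m)) x \<partial>dom_measure a\<bar> \<le> (\<integral>x. H x \<partial>dom_measure a)"
    proof (rule abs_integral_le[OF Hi])
      show "AE x in dom_measure a. \<bar>f x * tensor ((column a m p)(i := sin_cut_err a m)) x\<bar> \<le> H x"
        using ae AE_space
      proof eventually_elim
        case (elim x)
        then show ?case using pt[of x] by simp
      qed
    qed
    also have "\<dots> = e * (E * real m) * B * ((\<integral>x. indicat_real Q1 x \<partial>dom_measure a) + (\<integral>x. indicat_real Q2 x \<partial>dom_measure a))"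
      unfolding H_def using i1 i2 by simp
    also have "\<dots> \<le> e * (E * real m) * B * (1 / real m * a * (d - c) + 1 / real m * a * (d - c))"
      using le1 le2 e E(1) B(1) by (intro mult_left_mono add_mono) auto
    also have "\<dots> = e * (2 * E * B * a * (d - c))" using m0 by (simp add: field_simps)
    also have "\<dots> < e * L" using e by (simp add: L_def)
    also have "\<dots> = r" using L by (simp add: e_def)
    finally show ?thesis by simp
  qed
  then show "\<exists>no. \<forall>m\<ge>no. norm ((\<integral>x. f x * tensor ((column a m p)(i := sin_cut_err a m)) x \<partial>dom_measure a) - 0) < r"
    by blast
qed

text \<open>Two integrations by parts in one go. At a side face the term with the normal derivative
  of f carries the sine, which is 0 there, and the term with f itself is 0 by the boundary
  condition. The lateral cut-off is removed first, for a vertical factor of compact support, and the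
  vertical cut-off afterwards.\<close>

lemma horizontal_parts:
  assumes a: "a > 0" and i: "i \<noteq> 3" and b: "b > 0"
    and f: "f \<in> L2 (dom_measure a)" and g: "g \<in> L2 (dom_measure a)"
    and TD: "\<And>F. tensor_test (box_dom a) F \<Longrightarrow>
      (\<integral>x. f x * tensor (F(i := deriv (deriv (F i)))) x \<partial>dom_measure a) = (\<integral>x. g x * tensor F x \<partial>dom_measure a)"
    and G: "continuous_on (closure (box_dom a)) G"
    and G0: "\<And>x. x \<in> frontier (box_dom a) - bottom a \<Longrightarrow> G x = 0"
    and ae: "AE x in dom_measure a. G x = f x"
  shows "(\<integral>x. g x * weight a b x \<partial>dom_measure a) = - (pi / a)\<^sup>2 * (\<integral>x. f x * weight a b x \<partial>dom_measure a)"
proof -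
  let ?M = "dom_measure a"
  have fd: "decaying a b f" and gd: "decaying a b g" using f g b by (auto intro: L2_decaying)
  have fli: "locally_integrable (box_dom a) f" by (rule L2_locally_integrable[OF open_box_dom f])
  have 1: "(\<integral>x. g x * sin_weight a p x \<partial>?M) = - (pi / a)\<^sup>2 * (\<integral>x. f x * sin_weight a p x \<partial>?M)"
    if p: "smooth1 p" "\<And>z. z \<notin> {c..d} \<Longrightarrow> p z = 0" "c > 0" "c \<le> d" for p c d
  proof (rule LIMSEQ_unique)
    show "(\<lambda>m. \<integral>x. g x * tensor (column a m p) x \<partial>?M) \<longlonglongrightarrow> (\<integral>x. g x * sin_weight a p x \<partial>?M)"
      by (rule column_integral_tendsto[OF gd b p(1,2)])
    have eq: "(\<integral>x. f x * tensor ((column a m p)(i := sin_cut_err a m)) x \<partial>?M)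
        - (pi / a)\<^sup>2 * (\<integral>x. f x * tensor (column a m p) x \<partial>?M) = (\<integral>x. g x * tensor (column a m p) x \<partial>?M)"
      if m: "m \<ge> 1" for m
    proof -
      have T: "tensor_test (box_dom a) (column a m p)" by (rule column_test[OF a _ p(1,2,3)]) (use m in auto)
      have ci: "column a m p i = sin_cut a m" using i by (simp add: column_def)
      have D: "tensor_test (box_dom a) ((column a m p)(i := deriv (deriv (sin_cut a m))))"
        using tensor_test_deriv[OF tensor_test_deriv[OF T, of i], of i] by (simp add: ci)
      have int: "integrable ?M (\<lambda>x. f x * tensor (column a m p) x)"
        "integrable ?M (\<lambda>x. f x * tensor ((column a m p)(i := deriv (deriv (sin_cut a m)))) x)"
        by (intro locally_integrable_tensor[OF fli] T D; simp)+
      have pt: "tensor ((column a m p)(i := sin_cut_err a m)) x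
          = tensor ((column a m p)(i := deriv (deriv (sin_cut a m)))) x + (pi / a)\<^sup>2 * tensor (column a m p) x" for x
        unfolding tensor_upd tensor_split[of "column a m p" x i] ci by (simp add: sin_cut_err_def algebra_simps)
      have "(\<integral>x. f x * tensor ((column a m p)(i := sin_cut_err a m)) x \<partial>?M)
          = (\<integral>x. f x * tensor ((column a m p)(i := deriv (deriv (sin_cut a m)))) x
              + (pi / a)\<^sup>2 * (f x * tensor (column a m p) x) \<partial>?M)"
        unfolding pt by (simp add: algebra_simps)
      also have "\<dots> = (\<integral>x. f x * tensor ((column a m p)(i := deriv (deriv (sin_cut a m)))) x \<partial>?M)
          + (pi / a)\<^sup>2 * (\<integral>x. f x * tensor (column a m p) x \<partial>?M)"
        using int by simp
      finally show ?thesis using TD[OF T] unfolding ci by simp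
    qed
    have "(\<lambda>m. (\<integral>x. f x * tensor ((column a m p)(i := sin_cut_err a m)) x \<partial>?M)
        - (pi / a)\<^sup>2 * (\<integral>x. f x * tensor (column a m p) x \<partial>?M))
      \<longlonglongrightarrow> 0 - (pi / a)\<^sup>2 * (\<integral>x. f x * sin_weight a p x \<partial>?M)"
      by (intro tendsto_intros column_err_tendsto[OF a i f G G0 ae p(1,2,4)] column_integral_tendsto[OF fd b p(1,2)])
    then have "(\<lambda>m. \<integral>x. g x * tensor (column a m p) x \<partial>?M) \<longlonglongrightarrow> 0 - (pi / a)\<^sup>2 * (\<integral>x. f x * sin_weight a p x \<partial>?M)"
      by (rule Lim_transform_eventually) (use eq in \<open>auto intro!: eventually_sequentiallyI[of 1]\<close>)
    then show "(\<lambda>m. \<integral>x. g x * tensor (column a m p) x \<partial>?M) \<longlonglongrightarrow> - (pi / a)\<^sup>2 * (\<integral>x. f x * sin_weight a p x \<partial>?M)"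
      by simp
  qed
  show ?thesis
  proof (rule LIMSEQ_unique)
    show "(\<lambda>n. \<integral>x. g x * sin_weight a (exp_cut b n) x \<partial>?M) \<longlonglongrightarrow> (\<integral>x. g x * weight a b x \<partial>?M)"
      by (rule exp_cut_integral_tendsto[OF gd])
    have "(\<lambda>n. - (pi / a)\<^sup>2 * (\<integral>x. f x * sin_weight a (exp_cut b n) x \<partial>?M))
        \<longlonglongrightarrow> - (pi / a)\<^sup>2 * (\<integral>x. f x * weight a b x \<partial>?M)"
      by (intro tendsto_mult_left exp_cut_integral_tendsto fd)
    moreover have "- (pi / a)\<^sup>2 * (\<integral>x. f x * sin_weight a (exp_cut b n) x \<partial>?M) = (\<integral>x. g x * sin_weight a (exp_cut b n) x \<partial>?M)"
      if n: "n \<ge> 1" for n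
    proof -
      have "1 \<le> real n" using n by simp
      moreover from this have "1 / real n \<le> 1" by (simp add: divide_le_eq)
      ultimately have "1 / real n \<le> real n" by linarith
      then show ?thesis using n by (intro 1[OF smooth1_exp_cut exp_cut_support, symmetric]) auto
    qed
    ultimately show "(\<lambda>n. \<integral>x. g x * sin_weight a (exp_cut b n) x \<partial>?M)
        \<longlonglongrightarrow> - (pi / a)\<^sup>2 * (\<integral>x. f x * weight a b x \<partial>?M)"
      by (elim Lim_transform_eventually) (auto intro!: eventually_sequentiallyI[of 1])
  qed
qed

section \<open>Differential inequalities\<close>

lemma nondecreasing_within:
  fixes f :: "real \<Rightarrow> real"
  assumes d: "\<And>t. 0 \<le> t \<Longrightarrow> t \<le> T \<Longrightarrow> (f has_real_derivative f' t) (at t within {0..})"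
    and nn: "\<And>t. 0 \<le> t \<Longrightarrow> t \<le> T \<Longrightarrow> 0 \<le> f' t"
    and st: "0 \<le> s" "s \<le> t" "t \<le> T"
  shows "f s \<le> f t"
proof (cases "s = t")
  case False
  have c: "continuous_on {s..t} f"
  proof (rule continuous_on_subset[of "{0..T}"])
    show "continuous_on {0..T} f"
      by (rule DERIV_continuous_on[of _ _ f']) (auto intro!: DERIV_subset[OF d])
  qed (use st in auto)
  show ?thesis
  proof (rule DERIV_nonneg_imp_increasing_open[OF st(2) _ c])
    fix x assume x: "s < x" "x < t"
    have "at x within {0..} = at x" using x st by (intro at_within_interior) auto
    then show "\<exists>y. (f has_real_derivative y) (at x) \<and> y \<ge> 0"
      using d[of x] nn[of x] x st by (intro exI[of _ "f' x"]) auto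
  qed
qed simp

lemma integral_deriv_within:
  fixes h :: "real \<Rightarrow> real"
  assumes h: "continuous_on {0..} h" and t: "t \<ge> 0"
  shows "((\<lambda>t. integral {0..t} h) has_real_derivative h t) (at t within {0..})"
proof -
  have "((\<lambda>x. integral {0..x} h) has_real_derivative h t) (at t within {0..t+1})"
    by (rule integral_has_real_derivative) (use t in \<open>auto intro: continuous_on_subset[OF h]\<close>)
  moreover have "at t within {0..t+1} = at t within {0..}"
    by (rule at_within_nhd[of _ "{..<t+1}"]) (use t in auto)
  ultimately show ?thesis by simp
qed

text \<open>Energy method for H'' \<ge> 2 c exp (2 H / c): multiplying by 2 H' shows that Z^2 - 2
  c^2 exp (2 H / c) does not decrease. Since H grows at least linearly, eventually H' \<ge> c exp (H
  / c), and this first order inequality has no global solution.\<close>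

lemma no_global_supersolution:
  fixes G Z :: "real \<Rightarrow> real"
  assumes c: "c > 0" and A: "G 0 > 0" and Z0: "Z 0 > 0"
    and G: "\<And>t. t \<ge> 0 \<Longrightarrow> (G has_real_derivative G' t) (at t within {0..})"
    and G': "\<And>t. t \<ge> 0 \<Longrightarrow> Z t \<le> G' t"
    and Z: "\<And>t. t \<ge> 0 \<Longrightarrow> (Z has_real_derivative Z' t) (at t within {0..})"
    and Z': "\<And>t. t \<ge> 0 \<Longrightarrow> 2 * c * exp (2 * G t / c) \<le> Z' t"
  shows False
proof -
  have Zc: "continuous_on {0..} Z" by (rule DERIV_continuous_on[of _ _ Z']) (use Z in auto)
  \<comment> \<open>A minorant of G whose derivative is exactly Z, as the energy argument requires;
    the lower bound on Z' survives because exp is monotone.\<close>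
  define H where "H t = G 0 + integral {0..t} Z" for t
  have H: "(H has_real_derivative Z t) (at t within {0..})" if "t \<ge> 0" for t
    unfolding H_def[abs_def] using DERIV_add[OF DERIV_const integral_deriv_within[OF Zc that]] by simp
  have H0: "H 0 = G 0" by (simp add: H_def)
  have Zpos: "Z t \<ge> Z 0" if "t \<ge> 0" for t
  proof (rule nondecreasing_within[of t Z Z' 0 t])
    fix s :: real assume s: "0 \<le> s"
    have "0 \<le> 2 * c * exp (2 * G s / c)" using c by simp
    with Z'[OF s] show "0 \<le> Z' s" by linarith
  qed (use Z that in auto)
  have GH: "H t \<le> G t" if "t \<ge> 0" for t
  proof -
    have "G 0 - H 0 \<le> G t - H t"
      by (rule nondecreasing_within[of t "\<lambda>t. G t - H t" "\<lambda>t. G' t - Z t" 0 t])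
         (use G' that in \<open>auto intro!: DERIV_diff G H\<close>)
    then show ?thesis by (simp add: H0)
  qed
  have Hlin: "G 0 + Z 0 * t \<le> H t" if "t \<ge> 0" for t
  proof -
    have "H 0 - Z 0 * 0 \<le> H t - Z 0 * t"
      by (rule nondecreasing_within[of t "\<lambda>t. H t - Z 0 * t" "\<lambda>t. Z t - Z 0" 0 t])
         (use Zpos that in \<open>auto intro!: derivative_eq_intros H\<close>)
    then show ?thesis by (simp add: H0)
  qed
  define Q where "Q t = (Z t)\<^sup>2 - 2 * c\<^sup>2 * exp (2 * H t / c)" for t
  have Q: "Q 0 \<le> Q t" if "t \<ge> 0" for t
  proof (rule nondecreasing_within[of t Q "\<lambda>t. 2 * Z t * (Z' t - 2 * c * exp (2 * H t / c))" 0 t])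
    fix s :: real assume s: "0 \<le> s"
    have zz: "((\<lambda>t. (Z t)\<^sup>2) has_real_derivative 2 * Z s * Z' s) (at s within {0..})"
      using DERIV_power[OF Z[OF s], of 2] by (simp add: mult_ac)
    have "((\<lambda>t. 2 * H t / c) has_real_derivative 2 * Z s / c) (at s within {0..})"
      using DERIV_cdivide[OF DERIV_cmult[OF H[OF s], of 2], of c] .
    from DERIV_cmult[OF DERIV_chain2[OF DERIV_exp this], of "2 * c\<^sup>2"]
    have "((\<lambda>t. 2 * c\<^sup>2 * exp (2 * H t / c)) has_real_derivative 2 * c\<^sup>2 * (exp (2 * H s / c) * (2 * Z s / c))) (at s within {0..})" .
    from DERIV_diff[OF zz this]
    show "(Q has_real_derivative 2 * Z s * (Z' s - 2 * c * exp (2 * H s / c))) (at s within {0..})"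
      unfolding Q_def[abs_def] by (rule DERIV_cong) (use c in \<open>simp add: algebra_simps power2_eq_square\<close>)
    have "2 * c * exp (2 * H s / c) \<le> 2 * c * exp (2 * G s / c)"
      using GH[OF s] c by (intro mult_left_mono) (auto simp: divide_right_mono)
    then have "0 \<le> Z' s - 2 * c * exp (2 * H s / c)" using Z'[OF s] by linarith
    moreover have "0 \<le> 2 * Z s" using Zpos[OF s] Z0 by simp
    ultimately show "0 \<le> 2 * Z s * (Z' s - 2 * c * exp (2 * H s / c))" by (rule mult_nonneg_nonneg[rotated])
  qed (use that in auto)
  \<comment> \<open>From this time on the linear lower bound for H gives |Q 0| \<le> 2 c H \<le> c^2
    exp (2 H / c): half of the exponential term in Q absorbs the initial energy, and the other half
    remains.\<close>
  define t1 where "t1 = \<bar>Q 0\<bar> / (2 * c * Z 0)"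
  have t1: "t1 \<ge> 0" using c Z0 by (simp add: t1_def)
  have fast: "c * exp (H t / c) \<le> Z t" if t: "t1 \<le> t" for t
  proof (rule power2_le_imp_le)
    have t0: "t \<ge> 0" using t t1 by linarith
    have "\<bar>Q 0\<bar> = 2 * c * (Z 0 * t1)" using c Z0 by (simp add: t1_def)
    also have "\<dots> \<le> 2 * c * (Z 0 * t)" using t c Z0 by (intro mult_left_mono) auto
    also have "\<dots> \<le> 2 * c * H t" using Hlin[OF t0] A c by (intro mult_left_mono) auto
    also have "\<dots> = c\<^sup>2 * (2 * H t / c)" using c by (simp add: power2_eq_square)
    also have "\<dots> \<le> c\<^sup>2 * exp (2 * H t / c)"
    proof (rule mult_left_mono)
      show "2 * H t / c \<le> exp (2 * H t / c)" using exp_ge_add_one_self[of "2 * H t / c"] by linarith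
    qed simp
    finally have "c\<^sup>2 * exp (2 * H t / c) \<le> (Z t)\<^sup>2" using Q[OF t0] by (simp add: Q_def)
    then show "(c * exp (H t / c))\<^sup>2 \<le> (Z t)\<^sup>2"
      by (simp add: power_mult_distrib exp_double[symmetric])
    show "0 \<le> Z t" using Zpos[OF t0] Z0 by simp
  qed
  \<comment> \<open>H' \<ge> c exp (H / c) says that -exp (-H / c) has slope at least 1. Its values
    lie in [-1, 0) because H \<ge> 0, so an interval of length 2 gives a contradiction.\<close>
  define S where "S t = - exp (- (H t / c)) - t" for t
  define S' where "S' t = (if t1 \<le> t then exp (- (H t / c)) * (Z t / c) - 1 else 0)" for t
  have dS: "(S has_real_derivative S' t) (at t within {0..})" and S'0: "0 \<le> S' t" if t: "t1 \<le> t" for t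
  proof -
    have t0: "t \<ge> 0" using t t1 by linarith
    have "((\<lambda>t. - (H t / c)) has_real_derivative - (Z t / c)) (at t within {0..})"
      using DERIV_minus[OF DERIV_cdivide[OF H[OF t0], of c]] .
    from DERIV_diff[OF DERIV_minus[OF DERIV_chain2[OF DERIV_exp this]] DERIV_ident]
    show "(S has_real_derivative S' t) (at t within {0..})"
      unfolding S_def[abs_def] by (rule DERIV_cong) (use t in \<open>simp add: S'_def\<close>)
    have "exp (H t / c) \<le> Z t / c" using fast[OF t] c by (simp add: pos_le_divide_eq mult.commute)
    then have "exp (- (H t / c)) * exp (H t / c) \<le> exp (- (H t / c)) * (Z t / c)" by (intro mult_left_mono) auto
    then show "0 \<le> S' t" using t by (simp add: S'_def exp_minus)
  qed
  have "S t1 \<le> S (t1 + 2)"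
  proof (rule DERIV_nonneg_imp_increasing_open[where f = S and a = t1 and b = "t1 + 2"])
    show "continuous_on {t1..t1+2} S"
      by (rule DERIV_continuous_on[of _ _ S']) (use t1 in \<open>auto intro!: DERIV_subset[OF dS]\<close>)
    fix x assume x: "t1 < x" "x < t1 + 2"
    have "at x within {0..} = at x" using x t1 by (intro at_within_interior) auto
    then show "\<exists>y. (S has_real_derivative y) (at x) \<and> y \<ge> 0"
      using dS[of x] S'0[of x] x by (intro exI[of _ "S' x"]) auto
  qed simp
  then have "2 \<le> exp (- (H t1 / c)) - exp (- (H (t1 + 2) / c))" by (simp add: S_def)
  moreover have "exp (- (H t1 / c)) \<le> 1"
  proof -
    have "0 \<le> Z 0 * t1" using t1 Z0 by simp
    then have "0 \<le> H t1" using Hlin[OF t1] A by linarith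
    then show ?thesis using c by simp
  qed
  moreover have "exp (- (H (t1 + 2) / c)) > 0" by simp
  ultimately show False by linarith
qed

section \<open>Comparison of a solution of the linear equation with its initial value\<close>

lemma C1_L2_cong_AE:
  assumes V: "C1_L2 M V V'" and ae: "\<And>t. t \<ge> 0 \<Longrightarrow> AE x in M. V t x = U t x" "\<And>t. t \<ge> 0 \<Longrightarrow> AE x in M. V' t x = U' t x"
    and m: "\<And>t. t \<ge> 0 \<Longrightarrow> U t \<in> borel_measurable M" "\<And>t. t \<ge> 0 \<Longrightarrow> U' t \<in> borel_measurable M"
  shows "C1_L2 M U U'"
  unfolding C1_L2_def
proof (intro allI impI conjI)
  fix t :: real assume t: "0 \<le> t"
  have V2: "V s \<in> L2 M" "V' s \<in> L2 M" if "s \<ge> 0" for s using V that by (auto simp: C1_L2_def)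
  show "U t \<in> L2 M" "U' t \<in> L2 M"
    using L2_cong_AE[OF V2(1)[OF t] m(1)[OF t] ae(1)[OF t]] L2_cong_AE[OF V2(2)[OF t] m(2)[OF t] ae(2)[OF t]] by auto
  have eq: "L2norm M (\<lambda>x. (V s x - V t x) / (s - t) - V' t x) = L2norm M (\<lambda>x. (U s x - U t x) / (s - t) - U' t x)"
    if s: "s \<ge> 0" for s
  proof (rule L2norm_cong_AE)
    show "AE x in M. (V s x - V t x) / (s - t) - V' t x = (U s x - U t x) / (s - t) - U' t x"
      using ae(1)[OF s] ae(1)[OF t] ae(2)[OF t] by eventually_elim simp
    show "(\<lambda>x. (V s x - V t x) / (s - t) - V' t x) \<in> borel_measurable M"
      using L2_measurable[OF C1_L2_quotient[OF V t s]] .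
    show "(\<lambda>x. (U s x - U t x) / (s - t) - U' t x) \<in> borel_measurable M"
      using m(1)[OF s] m(1)[OF t] m(2)[OF t] by measurable
  qed
  have "((\<lambda>s. L2norm M (\<lambda>x. (V s x - V t x) / (s - t) - V' t x)) \<longlongrightarrow> 0) (at t within {0..})"
    using V t by (simp add: C1_L2_def)
  then show "((\<lambda>s. L2norm M (\<lambda>x. (U s x - U t x) / (s - t) - U' t x)) \<longlongrightarrow> 0) (at t within {0..})"
    by (rule Lim_transform_eventually) (use eq in \<open>auto simp: eventually_at_filter intro!: always_eventually\<close>)
qed

text \<open>The derivative of N t = int u^2 m is int 4 w u^2 m, so |N'| \<le> 4 K N; hence exp (4 K
  t) N is nondecreasing and exp (-4 K t) N is nonincreasing. The bound B of m does not enter the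
  constants, which allows weights that concentrate.\<close>

lemma linear_growth_monotone:
  assumes u: "C1_L2 M u u'" and T: "T \<ge> 0"
    and eq: "\<And>t. t \<ge> 0 \<Longrightarrow> AE x in M. u' t x = 2 * u t x * w t x"
    and K: "\<And>t. 0 \<le> t \<Longrightarrow> t \<le> T \<Longrightarrow> AE x in M. \<bar>w t x\<bar> \<le> K"
    and m: "m \<in> borel_measurable M" "\<And>x. x \<in> space M \<Longrightarrow> 0 \<le> m x \<and> m x \<le> B"
  shows "exp (- 4 * K * T) * (\<integral>x. (u 0 x)\<^sup>2 * m x \<partial>M) \<le> (\<integral>x. (u T x)\<^sup>2 * m x \<partial>M)"
    "(\<integral>x. (u T x)\<^sup>2 * m x \<partial>M) \<le> exp (4 * K * T) * (\<integral>x. (u 0 x)\<^sup>2 * m x \<partial>M)"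
proof -
  define N where "N t = (\<integral>x. (u t x)\<^sup>2 * m x \<partial>M)" for t
  define N' where "N' t = (\<integral>x. 2 * u t x * u' t x * m x \<partial>M)" for t
  have mb: "\<bar>m x\<bar> \<le> B" if "x \<in> space M" for x using m(2)[OF that] by simp
  have dN: "(N has_real_derivative N' t) (at t within {0..})" if "t \<ge> 0" for t
    unfolding N_def[abs_def] N'_def by (rule C1_L2_square_deriv[OF u that m(1) mb])
  have u2: "u t \<in> L2 M" "u' t \<in> L2 M" if "t \<ge> 0" for t using u that by (auto simp: C1_L2_def)
  have N'b: "\<bar>N' t\<bar> \<le> 4 * K * N t" if t: "0 \<le> t" "t \<le> T" for t
  proof -
    have i: "integrable M (\<lambda>x. (u t x)\<^sup>2 * m x)"
      using L2_mult_integrable[OF u2(1)[OF t(1)] L2_bounded_mult[OF u2(1)[OF t(1)] m(1) mb]]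
      by (simp add: power2_eq_square mult.assoc)
    have "\<bar>N' t\<bar> \<le> (\<integral>x. 4 * K * ((u t x)\<^sup>2 * m x) \<partial>M)"
      unfolding N'_def
    proof (rule abs_integral_le[OF integrable_mult_right[OF i]])
      show "AE x in M. \<bar>2 * u t x * u' t x * m x\<bar> \<le> 4 * K * ((u t x)\<^sup>2 * m x)"
        using eq[OF t(1)] K[OF t] AE_space
      proof eventually_elim
        case (elim x)
        have "0 \<le> (u t x)\<^sup>2 * m x" using m(2)[OF elim(3)] by simp
        from mult_right_mono[OF elim(2) this] show ?case
          unfolding elim(1) using m(2)[OF elim(3)] by (simp add: abs_mult power2_eq_square mult_ac)
      qed
    qed
    then show ?thesis using i by (simp add: N_def)
  qed
  have "exp (4 * K * 0) * N 0 \<le> exp (4 * K * T) * N T"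
  proof (rule nondecreasing_within[of T "\<lambda>t. exp (4 * K * t) * N t" "\<lambda>t. exp (4 * K * t) * (N' t + 4 * K * N t)"])
    fix t assume t: "0 \<le> t" "t \<le> T"
    have "((\<lambda>t. exp (4 * K * t)) has_real_derivative exp (4 * K * t) * (4 * K)) (at t within {0..})"
      by (auto intro!: derivative_eq_intros)
    from DERIV_mult[OF this dN[OF t(1)]]
    show "((\<lambda>t. exp (4 * K * t) * N t) has_real_derivative exp (4 * K * t) * (N' t + 4 * K * N t)) (at t within {0..})"
      by (rule DERIV_cong) (simp add: algebra_simps)
    show "0 \<le> exp (4 * K * t) * (N' t + 4 * K * N t)"
      using N'b[OF t] by (intro mult_nonneg_nonneg) auto
  qed (use T in auto)
  then have "exp (- 4 * K * T) * N 0 \<le> exp (- 4 * K * T) * (exp (4 * K * T) * N T)" by (intro mult_left_mono) auto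
  then show "exp (- 4 * K * T) * (\<integral>x. (u 0 x)\<^sup>2 * m x \<partial>M) \<le> (\<integral>x. (u T x)\<^sup>2 * m x \<partial>M)"
    by (simp add: N_def mult.assoc[symmetric] exp_minus)
  have "- (exp (- 4 * K * 0) * N 0) \<le> - (exp (- 4 * K * T) * N T)"
  proof (rule nondecreasing_within[of T "\<lambda>t. - (exp (- 4 * K * t) * N t)" "\<lambda>t. exp (- 4 * K * t) * (4 * K * N t - N' t)"])
    fix t assume t: "0 \<le> t" "t \<le> T"
    have "((\<lambda>t. exp (- 4 * K * t)) has_real_derivative exp (- 4 * K * t) * (- 4 * K)) (at t within {0..})"
      by (auto intro!: derivative_eq_intros)
    from DERIV_minus[OF DERIV_mult[OF this dN[OF t(1)]]]
    show "((\<lambda>t. - (exp (- 4 * K * t) * N t)) has_real_derivative exp (- 4 * K * t) * (4 * K * N t - N' t)) (at t within {0..})"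
      by (rule DERIV_cong) (simp add: algebra_simps)
    show "0 \<le> exp (- 4 * K * t) * (4 * K * N t - N' t)"
      using N'b[OF t] by (intro mult_nonneg_nonneg) auto
  qed (use T in auto)
  then have "exp (4 * K * T) * (exp (- 4 * K * T) * N T) \<le> exp (4 * K * T) * N 0" by (intro mult_left_mono) auto
  then show "(\<integral>x. (u T x)\<^sup>2 * m x \<partial>M) \<le> exp (4 * K * T) * (\<integral>x. (u 0 x)\<^sup>2 * m x \<partial>M)"
    by (simp add: N_def mult.assoc[symmetric] exp_add[symmetric])
qed

text \<open>The integrated bound with m the indicator of the set F where the claim fails: the
  integral of D, which is positive on F and 0 elsewhere, is at most 0, so F is a null set.\<close>

lemma linear_growth_lower_bound:
  assumes u: "C1_L2 M u u'" and T: "T \<ge> 0"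
    and eq: "\<And>t. t \<ge> 0 \<Longrightarrow> AE x in M. u' t x = 2 * u t x * w t x"
    and K: "\<And>t. 0 \<le> t \<Longrightarrow> t \<le> T \<Longrightarrow> AE x in M. \<bar>w t x\<bar> \<le> K"
  shows "AE x in M. exp (- 4 * K * T) * (u 0 x)\<^sup>2 \<le> (u T x)\<^sup>2"
proof -
  define q where "q = exp (- 4 * K * T)"
  have u2: "u t \<in> L2 M" if "t \<ge> 0" for t using u that by (auto simp: C1_L2_def)
  have [measurable]: "u 0 \<in> borel_measurable M" "u T \<in> borel_measurable M"
    using u2[of 0] u2[OF T] by (auto simp: L2_def)
  define F where "F = {x \<in> space M. (u T x)\<^sup>2 < q * (u 0 x)\<^sup>2}"
  have Fm: "F \<in> sets M" unfolding F_def by measurable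
  define D where "D x = (q * (u 0 x)\<^sup>2 - (u T x)\<^sup>2) * indicator F x" for x
  have i: "integrable M (\<lambda>x. (u t x)\<^sup>2 * indicat_real F x)" if "t \<ge> 0" for t
    using integrable_mult_indicator[OF Fm L2_integrable_power2[OF u2[OF that]]] by (simp add: mult.commute)
  have Di: "integrable M D"
    using Bochner_Integration.integrable_diff[OF integrable_mult_right[OF i[of 0], of q] i[OF T]]
    by (simp add: D_def[abs_def] left_diff_distrib mult.assoc)
  have D0: "0 \<le> D x" for x by (auto simp: D_def F_def indicator_def)
  have "(\<integral>x. D x \<partial>M) = q * (\<integral>x. (u 0 x)\<^sup>2 * indicat_real F x \<partial>M) - (\<integral>x. (u T x)\<^sup>2 * indicat_real F x \<partial>M)"
    using i[of 0] i[OF T] by (simp add: D_def left_diff_distrib mult.assoc)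
  also have "\<dots> \<le> 0"
    using linear_growth_monotone(1)[OF u T eq K, of "indicat_real F" 1] Fm by (simp add: q_def)
  finally have "(\<integral>x. D x \<partial>M) = 0" using D0 by (simp add: antisym)
  then have "AE x in M. D x = 0" using integral_nonneg_eq_0_iff_AE[OF Di] D0 by auto
  then show ?thesis using AE_space
  proof eventually_elim
    case (elim x)
    then show ?case unfolding q_def[symmetric] by (cases "x \<in> F") (auto simp: D_def F_def)
  qed
qed

section \<open>Weak derivatives along coordinate directions\<close>

lemma mi_order_add_unit: "mi_order (\<lambda>j. \<beta> j + mi_unit i j) = mi_order \<beta> + 1"
  by (simp add: mi_order_def mi_unit_def sum.distrib)

lemma mi_order_unit [simp]: "mi_order (mi_unit i) = 1" "mi_order (\<lambda>j. 2 * mi_unit i j) = 2"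
  by (simp_all add: mi_order_def mi_unit_def sum_distrib_left[symmetric])

lemma unit_tensor: "(\<lambda>j. (deriv ^^ mi_unit i j) (F j)) = F(i := deriv (F i))"
  by (auto simp: mi_unit_def fun_eq_iff)

lemma unit2_tensor: "(\<lambda>j. (deriv ^^ (2 * mi_unit i j)) (F j)) = F(i := deriv (deriv (F i)))"
  by (auto simp: mi_unit_def fun_eq_iff numeral_2_eq_2)

lemma has_weak_deriv_unit:
  assumes "S \<in> sets lebesgue" "has_weak_deriv S (mi_unit i) f g" "tensor_test S F"
  shows "(\<integral>x. f x * tensor (F(i := deriv (F i))) x \<partial>lebesgue_on S) = - (\<integral>x. g x * tensor F x \<partial>lebesgue_on S)"
  using has_weak_deriv_tensor[OF assms] by (simp add: unit_tensor)

lemma has_weak_deriv_unit2: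
  assumes "S \<in> sets lebesgue" "has_weak_deriv S (\<lambda>j. 2 * mi_unit i j) f g" "tensor_test S F"
  shows "(\<integral>x. f x * tensor (F(i := deriv (deriv (F i)))) x \<partial>lebesgue_on S) = (\<integral>x. g x * tensor F x \<partial>lebesgue_on S)"
  using has_weak_deriv_tensor[OF assms] by (simp add: unit2_tensor)

text \<open>The derivatives of f of orders \<beta> and \<beta> + e_i are chosen independently. They
  are linked because both sides, tested with products, reduce to the same integral of f itself, up
  to signs that differ by one factor -1.\<close>

lemma sobolev_tensor_deriv:
  assumes S: "open S" and f: "f \<in> sobolev k S" and b: "mi_order \<beta> < k"
  shows "tensor_deriv S i (weak_deriv S \<beta> f) (weak_deriv S (\<lambda>j. \<beta> j + mi_unit i j) f)"
proof -
  let ?\<gamma> = "\<lambda>j. \<beta> j + mi_unit i j"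
  have SL: "S \<in> sets lebesgue" using S by auto
  have b': "mi_order \<beta> \<le> k" "mi_order ?\<gamma> \<le> k" using b by (auto simp: mi_order_add_unit)
  note w = sobolev_weak_deriv[OF S f]
  have "(\<integral>x. weak_deriv S \<beta> f x * tensor (F(i := deriv (F i))) x \<partial>lebesgue_on S)
      = - (\<integral>x. weak_deriv S ?\<gamma> f x * tensor F x \<partial>lebesgue_on S)" if F: "tensor_test S F" for F
  proof -
    have "(\<lambda>j. (deriv ^^ \<beta> j) ((F(i := deriv (F i))) j)) = (\<lambda>j. (deriv ^^ ?\<gamma> j) (F j))"
      by (auto simp: mi_unit_def fun_eq_iff funpow_swap1)
    with has_weak_deriv_tensor[OF SL w(1)[OF b'(1)] tensor_test_deriv[OF F, of i]]
      has_weak_deriv_tensor[OF SL w(1)[OF b'(2)] F]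
    have "(- 1) ^ mi_order \<beta> * (\<integral>x. weak_deriv S \<beta> f x * tensor (F(i := deriv (F i))) x \<partial>lebesgue_on S)
        = (- 1) ^ mi_order \<beta> * (- (\<integral>x. weak_deriv S ?\<gamma> f x * tensor F x \<partial>lebesgue_on S))"
      by (simp add: mi_order_add_unit)
    then show ?thesis by (subst (asm) mult_left_cancel) auto
  qed
  then show ?thesis using w(2)[OF b'(1)] w(2)[OF b'(2)] by (simp add: tensor_deriv_def)
qed

lemma is_cont_rep_AE:
  "S \<in> sets lebesgue \<Longrightarrow> is_cont_rep S f g \<Longrightarrow> AE x in lebesgue_on S. g x = f x"
  by (simp add: is_cont_rep_def AE_lebesgue_on_iff)

section \<open>Bounds for the weight and the elliptic identity\<close>

lemma weight_bounds:
  assumes a: "a > 0" and x: "x \<in> box_dom a"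
  shows "0 < weight a b x" "weight a b x \<le> exp (- b * x$3)"
proof -
  have "0 < sin (pi * t / a)" if "0 < t" "t < a" for t
    using that a by (intro sin_gt_zero) (auto simp: field_simps)
  then show "0 < weight a b x" using x by (auto simp: weight_def box_dom_def intro!: mult_pos_pos)
  have "\<bar>weight a b x\<bar> \<le> \<bar>exp (- b * x$3)\<bar>" unfolding weight_eq by (rule sin_weight_le)
  then show "weight a b x \<le> exp (- b * x$3)" by simp
qed

lemma weight_le_1:
  assumes "a > 0" "b > 0" "x \<in> box_dom a"
  shows "weight a b x \<le> 1"
proof -
  have "0 \<le> b * x$3" using assms by (simp add: box_dom_def)
  then have "exp (- b * x$3) \<le> 1" by simp
  with weight_bounds(2)[OF assms(1,3), of b] show ?thesis by linarith
qed

lemma weight_measurable: "weight a b \<in> borel_measurable (dom_measure a)"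
  unfolding weight_eq[abs_def] by (intro sin_weight_measurable) measurable

lemma weight_integrable:
  assumes "a > 0" "b > 0" shows "integrable (dom_measure a) (weight a b)"
proof (rule Bochner_Integration.integrable_bound[OF exp_integrable_box_dom[OF assms(2), of a] weight_measurable])
  show "AE x in dom_measure a. norm (weight a b x) \<le> norm (exp (- b * x$3))"
    using weight_bounds[OF assms(1)] by (intro AE_I2) (auto simp: abs_of_pos)
qed

lemma weight_L2:
  assumes "a > 0" "b > 0" shows "weight a b \<in> L2 (dom_measure a)"
proof -
  have "integrable (dom_measure a) (\<lambda>x. (weight a b x)\<^sup>2)"
  proof (rule Bochner_Integration.integrable_bound[OF weight_integrable[OF assms]])
    show "(\<lambda>x. (weight a b x)\<^sup>2) \<in> borel_measurable (dom_measure a)"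
      using weight_measurable by measurable
    have "(weight a b x)\<^sup>2 \<le> weight a b x" if "x \<in> box_dom a" for x
      using weight_bounds(1)[OF assms(1) that, of b] weight_le_1[OF assms that]
      by (simp add: power2_eq_square mult_left_le)
    then show "AE x in dom_measure a. norm ((weight a b x)\<^sup>2) \<le> norm (weight a b x)"
      using weight_bounds(1)[OF assms(1), of _ b] by (intro AE_I2) (auto simp: abs_of_pos)
  qed
  then show ?thesis using weight_measurable by (simp add: L2_def)
qed

lemma continuous_on_weight: "continuous_on S (weight a b)"
  unfolding weight_def[abs_def] divide_inverse by (intro continuous_intros)

lemma weight_vec3: "weight a b (vec3 y 0) = sin (pi * y$1 / a) * sin (pi * y$2 / a)"
  by (simp add: weight_def)

text \<open>Let I = int D phi, J = int D_z phi and R the integral on the bottom. Each horizontal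
  direction contributes -k^2 I to the Laplacian, the trace of D gives R = k I - J, and the zero
  trace of D_z gives int D_zz phi = k J. Altogether 2 k^2 I - k J = k J + 2 k R.\<close>

lemma elliptic_identity:
  assumes a: "a > 0" and D: "D \<in> sobolev 3 (box_dom a)" and k: "k = pi / a"
    and G: "is_cont_rep (box_dom a) D G" "\<And>x. x \<in> frontier (box_dom a) - bottom a \<Longrightarrow> G x = 0"
    and h: "is_cont_rep (box_dom a) (weak_deriv (box_dom a) (mi_unit 3) D) h" "\<And>x. x \<in> bottom a \<Longrightarrow> h x = 0"
  shows "- (\<Sum>i\<in>UNIV. \<integral>x. weak_deriv (box_dom a) (\<lambda>j. 2 * mi_unit i j) D x * weight a k x \<partial>dom_measure a)
    = k * (\<integral>x. weak_deriv (box_dom a) (mi_unit 3) D x * weight a k x \<partial>dom_measure a)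
      + 2 * k * (LINT y:dom_x a|lebesgue. G (vec3 y 0) * (sin (pi * y$1 / a) * sin (pi * y$2 / a)))"
proof -
  let ?S = "box_dom a" and ?M = "dom_measure a"
  have k0: "k > 0" using a k by simp
  note op = open_box_dom[of a]
  have DL: "D \<in> L2 ?M" by (rule sobolev_L2[OF _ D]) simp
  have wL: "weak_deriv ?S (mi_unit 3) D \<in> L2 ?M" by (rule sobolev_weak_deriv(2)[OF op D]) simp
  have w2L: "weak_deriv ?S (\<lambda>j. 2 * mi_unit i j) D \<in> L2 ?M" for i by (rule sobolev_weak_deriv(2)[OF op D]) simp
  have hw2: "has_weak_deriv ?S (\<lambda>j. 2 * mi_unit i j) D (weak_deriv ?S (\<lambda>j. 2 * mi_unit i j) D)" for i
    by (rule sobolev_weak_deriv(1)[OF op D]) simp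
  have hw1: "has_weak_deriv ?S (mi_unit 3) D (weak_deriv ?S (mi_unit 3) D)"
    by (rule sobolev_weak_deriv(1)[OF op D]) simp
  have Gc: "continuous_on (closure ?S) G" and hc: "continuous_on (closure ?S) h"
    using G(1) h(1) by (auto simp: is_cont_rep_def)
  have Gae: "AE x in ?M. G x = D x" by (rule is_cont_rep_AE[OF _ G(1)]) simp
  have hae: "AE x in ?M. h x = weak_deriv ?S (mi_unit 3) D x" by (rule is_cont_rep_AE[OF _ h(1)]) simp
  define I J where "I = (\<integral>x. D x * weight a k x \<partial>?M)" and "J = (\<integral>x. weak_deriv ?S (mi_unit 3) D x * weight a k x \<partial>?M)"
  define R where "R = (LINT y:dom_x a|lebesgue. G (vec3 y 0) * (sin (pi * y$1 / a) * sin (pi * y$2 / a)))"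
  have lat: "(\<integral>x. weak_deriv ?S (\<lambda>j. 2 * mi_unit i j) D x * weight a k x \<partial>?M) = - k\<^sup>2 * I" if "i \<noteq> 3" for i
    unfolding I_def k
    by (rule horizontal_parts[OF a that _ DL w2L has_weak_deriv_unit2[OF _ hw2] Gc G(2) Gae]) (use a in auto)
  have cong: "(\<integral>x. f x * weight a k x * layer n (x$3) \<partial>?M) = (\<integral>x. g x * weight a k x * layer n (x$3) \<partial>?M)"
    if fg: "AE x in ?M. g x = f x" and f: "f \<in> borel_measurable ?M" and g: "g \<in> borel_measurable ?M" for f g n
  proof (rule integral_cong_AE)
    have l: "(\<lambda>x. layer n (x$3)) \<in> borel_measurable ?M" by (rule borel_measurable_dom) measurable
    show "(\<lambda>x. f x * weight a k x * layer n (x$3)) \<in> borel_measurable ?M"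
      "(\<lambda>x. g x * weight a k x * layer n (x$3)) \<in> borel_measurable ?M"
      using f g l weight_measurable by (auto intro!: borel_measurable_times)
    show "AE x in ?M. f x * weight a k x * layer n (x$3) = g x * weight a k x * layer n (x$3)"
      using fg by eventually_elim simp
  qed
  have cm: "f \<in> borel_measurable ?M" if "continuous_on (closure ?S) f" for f :: "real^3 \<Rightarrow> real"
    by (rule continuous_imp_measurable_on_sets_lebesgue[OF continuous_on_subset[OF that closure_subset]]) simp
  \<comment> \<open>The layer integrals of D have two limits that must agree: the trace of the
    continuous representative and the outcome of integration by parts.\<close>
  have R: "R = k * I - J"
  proof (rule LIMSEQ_unique)
    have "(\<lambda>n. \<integral>x. (G x * weight a k x) * layer n (x$3) \<partial>?M) \<longlonglongrightarrow> (LINT y:dom_x a|lebesgue. G (vec3 y 0) * weight a k (vec3 y 0))"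
      by (rule trace_limit[OF a]) (intro continuous_on_mult Gc continuous_on_weight)
    then show "(\<lambda>n. \<integral>x. D x * weight a k x * layer n (x$3) \<partial>?M) \<longlonglongrightarrow> R"
      unfolding cong[OF Gae L2_measurable[OF DL] cm[OF Gc]] R_def weight_vec3 .
    show "(\<lambda>n. \<integral>x. D x * weight a k x * layer n (x$3) \<partial>?M) \<longlonglongrightarrow> k * I - J"
      unfolding I_def J_def
      by (rule vertical_boundary_limit[OF a L2_decaying[OF k0 DL] L2_decaying[OF k0 wL] k0 has_weak_deriv_unit[OF _ hw1]]) auto
  qed
  \<comment> \<open>The same comparison for D_z, whose trace on the bottom is 0.\<close>
  have "0 = k * J - (\<integral>x. weak_deriv ?S (\<lambda>j. 2 * mi_unit 3 j) D x * weight a k x \<partial>?M)"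
  proof (rule LIMSEQ_unique)
    have "(\<lambda>n. \<integral>x. (h x * weight a k x) * layer n (x$3) \<partial>?M) \<longlonglongrightarrow> (LINT y:dom_x a|lebesgue. h (vec3 y 0) * weight a k (vec3 y 0))"
      by (rule trace_limit[OF a]) (intro continuous_on_mult hc continuous_on_weight)
    moreover have "(LINT y:dom_x a|lebesgue. h (vec3 y 0) * weight a k (vec3 y 0)) = (LINT y:dom_x a|lebesgue. 0)"
    proof (rule set_lebesgue_integral_cong)
      show "dom_x a \<in> sets lebesgue" by (simp add: dom_x_box)
      have "h (vec3 y 0) = 0" if "y \<in> dom_x a" for y
        using that by (intro h(2)) (simp add: dom_x_def bottom_def)
      then show "\<forall>y. y \<in> dom_x a \<longrightarrow> h (vec3 y 0) * weight a k (vec3 y 0) = 0" by simp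
    qed
    ultimately show "(\<lambda>n. \<integral>x. weak_deriv ?S (mi_unit 3) D x * weight a k x * layer n (x$3) \<partial>?M) \<longlonglongrightarrow> 0"
      unfolding cong[OF hae L2_measurable[OF wL] cm[OF hc]] by simp
    have TD: "tensor_deriv ?S 3 (weak_deriv ?S (mi_unit 3) D) (weak_deriv ?S (\<lambda>j. 2 * mi_unit 3 j) D)"
      using sobolev_tensor_deriv[OF op D, of "mi_unit 3" 3] by (simp add: mult_2)
    show "(\<lambda>n. \<integral>x. weak_deriv ?S (mi_unit 3) D x * weight a k x * layer n (x$3) \<partial>?M)
        \<longlonglongrightarrow> k * J - (\<integral>x. weak_deriv ?S (\<lambda>j. 2 * mi_unit 3 j) D x * weight a k x \<partial>?M)"
      unfolding J_def using TD
      by (intro vertical_boundary_limit[OF a L2_decaying[OF k0 wL] L2_decaying[OF k0 w2L] k0]) (auto simp: tensor_deriv_def)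
  qed
  then have e3: "(\<integral>x. weak_deriv ?S (\<lambda>j. 2 * mi_unit 3 j) D x * weight a k x \<partial>?M) = k * J" by simp
  show ?thesis
    unfolding sum_3 e3 lat[of 1, simplified] lat[of 2, simplified] R_def[symmetric] J_def[symmetric] R
    by (simp add: algebra_simps power2_eq_square)
qed

lemma L2_dominated:
  assumes g: "g \<in> L2 M" and f: "f \<in> borel_measurable M" and le: "\<And>x. x \<in> space M \<Longrightarrow> \<bar>f x\<bar> \<le> C * \<bar>g x\<bar>"
  shows "f \<in> L2 M"
proof -
  have "integrable M (\<lambda>x. (f x)\<^sup>2)"
  proof (rule Bochner_Integration.integrable_bound)
    show "integrable M (\<lambda>x. C\<^sup>2 * (g x)\<^sup>2)" using L2_integrable_power2[OF g] by (rule integrable_mult_right)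
    show "(\<lambda>x. (f x)\<^sup>2) \<in> borel_measurable M" using f by measurable
    show "AE x in M. norm ((f x)\<^sup>2) \<le> norm (C\<^sup>2 * (g x)\<^sup>2)"
    proof (rule AE_I2)
      fix x assume "x \<in> space M"
      from power_mono[OF le[OF this], of 2] show "norm ((f x)\<^sup>2) \<le> norm (C\<^sup>2 * (g x)\<^sup>2)"
        by (simp add: power_mult_distrib)
    qed
  qed
  then show ?thesis using f by (simp add: L2_def)
qed

lemma square_add_pos: "e > 0 \<Longrightarrow> (y::real)\<^sup>2 + e > 0"
  by (rule add_nonneg_pos) auto

section \<open>Regularised logarithm\<close>

text \<open>Approximates ln |y| from above and has a Lipschitz derivative, as the chain rule
  requires. It depends on y^2 only, so the sign of u at positive times does not matter.\<close>

definition reg_log :: "real \<Rightarrow> real \<Rightarrow> real" where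
  "reg_log e y = ln (y\<^sup>2 + e) / 2"

lemma reg_log_deriv:
  assumes "e > 0"
  shows "(reg_log e has_real_derivative y / (y\<^sup>2 + e)) (at y)"
proof -
  note p = square_add_pos[OF assms, of y]
  have d: "((\<lambda>y. y\<^sup>2 + e) has_real_derivative 2 * y) (at y)"
    by (rule DERIV_cong[OF DERIV_add[OF DERIV_power[OF DERIV_ident] DERIV_const]]) simp
  have "((\<lambda>y. ln (y\<^sup>2 + e)) has_real_derivative inverse (y\<^sup>2 + e) * (2 * y)) (at y)"
    by (rule DERIV_chain2[where f = ln and g = "\<lambda>y. y\<^sup>2 + e", OF DERIV_ln[OF p] d])
  then have "((\<lambda>y. ln (y\<^sup>2 + e) / 2) has_real_derivative inverse (y\<^sup>2 + e) * (2 * y) / 2) (at y)"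
    by (rule DERIV_cdivide)
  then have "((\<lambda>y. ln (y\<^sup>2 + e) / 2) has_real_derivative y / (y\<^sup>2 + e)) (at y)"
    by (rule DERIV_cong) (simp, rule divide_inverse_commute[symmetric])
  then show ?thesis unfolding reg_log_def[abs_def] .
qed

text \<open>The difference equals (y - z) (e - y z) / ((y^2 + e) (z^2 + e)), and e |e - y z| \<le>
  (y^2 + e) (z^2 + e) because 2 |y z| \<le> y^2 + z^2.\<close>

lemma reg_log_deriv_Lipschitz:
  fixes y z e :: real
  assumes e: "e > 0"
  shows "\<bar>y / (y\<^sup>2 + e) - z / (z\<^sup>2 + e)\<bar> \<le> 1 / e * \<bar>y - z\<bar>"
proof -
  note p = square_add_pos[OF e, of y] square_add_pos[OF e, of z]
  have "y / (y\<^sup>2 + e) - z / (z\<^sup>2 + e) = (y - z) * (e - y * z) / ((y\<^sup>2 + e) * (z\<^sup>2 + e))"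
  proof -
    have "y / (y\<^sup>2 + e) - z / (z\<^sup>2 + e) = (y * (z\<^sup>2 + e) - z * (y\<^sup>2 + e)) / ((y\<^sup>2 + e) * (z\<^sup>2 + e))"
      using p by (intro diff_frac_eq) auto
    also have "y * (z\<^sup>2 + e) - z * (y\<^sup>2 + e) = (y - z) * (e - y * z)"
      by (simp add: algebra_simps power2_eq_square)
    finally show ?thesis .
  qed
  also have "\<bar>\<dots>\<bar> = \<bar>y - z\<bar> * (\<bar>e - y * z\<bar> / ((y\<^sup>2 + e) * (z\<^sup>2 + e)))"
    using p by (simp add: abs_mult)
  also have "\<dots> \<le> \<bar>y - z\<bar> * (1 / e)"
  proof (rule mult_left_mono)
    have "2 * \<bar>y * z\<bar> \<le> y\<^sup>2 + z\<^sup>2" using sum_squares_bound[of "\<bar>y\<bar>" "\<bar>z\<bar>"] by (simp add: abs_mult)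
    then have "e * \<bar>y * z\<bar> \<le> e * (y\<^sup>2 + z\<^sup>2)" using e by (intro mult_left_mono) auto
    then have s1: "e * \<bar>y * z\<bar> \<le> e * y\<^sup>2 + e * z\<^sup>2" by (simp only: distrib_left)
    have "e * \<bar>e - y * z\<bar> \<le> e * (e + \<bar>y * z\<bar>)" using e by (intro mult_left_mono) auto
    then have s2: "e * \<bar>e - y * z\<bar> \<le> e * e + e * \<bar>y * z\<bar>" by (simp only: distrib_left)
    have s3: "(y\<^sup>2 + e) * (z\<^sup>2 + e) = e * y\<^sup>2 + e * z\<^sup>2 + e * e + (y * z)\<^sup>2" by (simp add: algebra_simps power2_eq_square)
    have s4: "0 \<le> (y * z)\<^sup>2" by simp
    have s5: "e * \<bar>e - y * z\<bar> \<le> (y\<^sup>2 + e) * (z\<^sup>2 + e)" unfolding s3 using s1 s2 s4 by linarith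
    then show "\<bar>e - y * z\<bar> / ((y\<^sup>2 + e) * (z\<^sup>2 + e)) \<le> 1 / e"
    proof -
      have "\<bar>e - y * z\<bar> \<le> ((y\<^sup>2 + e) * (z\<^sup>2 + e)) / e"
        using s5 by (subst pos_le_divide_eq[OF e]) (simp only: mult.commute)
      then have "\<bar>e - y * z\<bar> \<le> 1 / e * ((y\<^sup>2 + e) * (z\<^sup>2 + e))" by simp
      then show ?thesis by (subst pos_divide_le_eq[OF mult_pos_pos[OF p]])
    qed
  qed simp
  finally show ?thesis by (simp add: mult.commute)
qed

lemma reg_log_abs_le:
  assumes e: "e > 0"
  shows "\<bar>reg_log e y\<bar> \<le> y\<^sup>2 + (e + \<bar>ln e\<bar>)"
proof -
  note p = square_add_pos[OF e, of y]
  have "ln (y\<^sup>2 + e) \<le> y\<^sup>2 + e - 1" by (rule ln_le_minus_one[OF p])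
  moreover have "ln e \<le> ln (y\<^sup>2 + e)" using e p by simp
  ultimately have "\<bar>ln (y\<^sup>2 + e)\<bar> \<le> y\<^sup>2 + e + \<bar>ln e\<bar>" using p by linarith
  moreover have "\<bar>ln (y\<^sup>2 + e) / 2\<bar> = \<bar>ln (y\<^sup>2 + e)\<bar> / 2" by (simp only: abs_divide abs_numeral)
  ultimately show ?thesis unfolding reg_log_def by linarith
qed

text \<open>The logarithm lies below its tangent at exp (2 k). Integrated against the weight and
  with the best k, this is Jensen's inequality.\<close>

lemma reg_log_tangent:
  assumes e: "e > 0"
  shows "reg_log e y \<le> exp (- 2 * k) * (y\<^sup>2 + e) / 2 + (k - 1 / 2)"
proof -
  note p = square_add_pos[OF e, of y]
  have "ln (exp (- 2 * k) * (y\<^sup>2 + e)) \<le> exp (- 2 * k) * (y\<^sup>2 + e) - 1"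
    using p by (intro ln_le_minus_one mult_pos_pos) auto
  moreover have "ln (exp (- 2 * k) * (y\<^sup>2 + e)) = - 2 * k + ln (y\<^sup>2 + e)"
    using p by (subst ln_mult) auto
  ultimately show ?thesis unfolding reg_log_def by linarith
qed

text \<open>The points of S where two continuous representatives differ form an open null set, which
  is empty; continuity extends the equality to the closure. Hence the choice in
  \<open>cont_rep\<close> is determined on the bottom.\<close>

lemma cont_rep_unique:
  assumes S: "open S" and g1: "is_cont_rep S f g1" and g2: "is_cont_rep S f g2" and x: "x \<in> closure S"
  shows "g1 x = g2 x"
proof -
  have c: "continuous_on (closure S) (\<lambda>x. g1 x - g2 x)"
    using g1 g2 unfolding is_cont_rep_def by (intro continuous_on_diff) auto
  have o: "open (S \<inter> (\<lambda>x. g1 x - g2 x) -` (- {0}))"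
    using continuous_on_subset[OF c closure_subset] by (intro continuous_open_preimage S) auto
  from o have m: "S \<inter> (\<lambda>x. g1 x - g2 x) -` (- {0}) \<in> sets lebesgue" by (intro sets_completionI_sets) simp
  have "AE x in lebesgue. x \<notin> S \<inter> (\<lambda>x. g1 x - g2 x) -` (- {0})"
    using g1[unfolded is_cont_rep_def, THEN conjunct2] g2[unfolded is_cont_rep_def, THEN conjunct2]
    by eventually_elim auto
  then have "negligible (S \<inter> (\<lambda>x. g1 x - g2 x) -` (- {0}))"
    unfolding negligible_iff_null_sets by (subst AE_iff_null_sets[OF m])
  with o have "S \<inter> (\<lambda>x. g1 x - g2 x) -` (- {0}) = {}" using open_not_negligible by blast
  then have "y \<in> S \<Longrightarrow> g1 y - g2 y = 0" for y by blast
  from continuous_constant_on_closure[OF c this x] show ?thesis by simp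
qed

section \<open>Global solutions\<close>

text \<open>The situation to be refuted: a solution on all of [0, \<infinity>). The parameter
  \<kappa> is at once the decay rate of the weight and its horizontal frequency.\<close>

locale global_solution =
  fixes a :: real and u0 \<psi>0 :: "real^3 \<Rightarrow> real" and u \<psi> ut \<psi>t :: "real \<Rightarrow> real^3 \<Rightarrow> real" and \<kappa> :: real
  assumes a: "a > 0"
    and \<kappa>: "\<kappa> = pi / a"
    and u0_vanishes: "vanishes_on (box_dom a) u0 (frontier (box_dom a))"
    and u0_positive: "positive_on (box_dom a) u0 (box_dom a)"
    and \<psi>0: "\<psi>0 \<in> sobolev 3 (box_dom a)"
    and bc0: "boundary_cond a \<psi>0"
    and u_C1: "C1_sobolev 2 (box_dom a) \<infinity> u ut"
    and \<psi>_C1: "C1_sobolev 3 (box_dom a) \<infinity> \<psi> \<psi>t"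
    and u_eq: "\<And>t. t \<ge> 0 \<Longrightarrow> AE x in dom_measure a. ut t x = 2 * u t x * weak_deriv (box_dom a) (mi_unit 3) (\<psi> t) x"
    and \<psi>_eq: "\<And>t. t \<ge> 0 \<Longrightarrow> has_weak_deriv (box_dom a) (mi_unit 3)
              (\<lambda>x. (u t x)\<^sup>2) (\<lambda>x. - weak_laplacian (box_dom a) (\<psi>t t) x)"
    and bc: "\<And>t. t \<ge> 0 \<Longrightarrow> boundary_cond a (\<psi> t)"
    and u_init: "AE x in dom_measure a. u 0 x = u0 x"
    and \<psi>_init: "AE x in dom_measure a. \<psi> 0 x = \<psi>0 x"
begin

abbreviation "M \<equiv> dom_measure a"
abbreviation "\<phi> \<equiv> weight a \<kappa>"
abbreviation "wd \<equiv> weak_deriv (box_dom a)"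
abbreviation "w t \<equiv> wd (mi_unit 3) (\<psi> t)"

lemma \<kappa>_pos: "\<kappa> > 0"
  using a by (simp add: \<kappa>)

lemma T_inf: "time_interval \<infinity> = {0..}"
  by (auto simp: time_interval_def)

lemma u_sobolev: "t \<ge> 0 \<Longrightarrow> u t \<in> sobolev 2 (box_dom a)" "t \<ge> 0 \<Longrightarrow> ut t \<in> sobolev 2 (box_dom a)"
  using u_C1 unfolding C1_sobolev_def T_inf by auto

lemma \<psi>_sobolev: "t \<ge> 0 \<Longrightarrow> \<psi> t \<in> sobolev 3 (box_dom a)" "t \<ge> 0 \<Longrightarrow> \<psi>t t \<in> sobolev 3 (box_dom a)"
  using \<psi>_C1 unfolding C1_sobolev_def T_inf by auto

lemma u_C1_L2: "C1_L2 M u ut"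
proof (rule C1_L2_cong_AE[OF C1_sobolev_weak_deriv[OF open_box_dom u_C1, of "\<lambda>_. 0"]])
  fix t :: real assume t: "t \<ge> 0"
  show "AE x in M. wd (\<lambda>_. 0) (u t) x = u t x" "AE x in M. wd (\<lambda>_. 0) (ut t) x = ut t x"
    by (rule weak_deriv_0[OF open_box_dom u_sobolev(1)[OF t]], rule weak_deriv_0[OF open_box_dom u_sobolev(2)[OF t]])
  show "u t \<in> borel_measurable M" "ut t \<in> borel_measurable M"
    by (rule L2_measurable[OF sobolev_L2[OF _ u_sobolev(1)[OF t]]], simp,
        rule L2_measurable[OF sobolev_L2[OF _ u_sobolev(2)[OF t]]], simp)
qed simp

lemma u_L2: "t \<ge> 0 \<Longrightarrow> u t \<in> L2 M" "t \<ge> 0 \<Longrightarrow> ut t \<in> L2 M"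
  using u_C1_L2 by (auto simp: C1_L2_def)

lemma \<psi>_C1_L2: "mi_order \<beta> \<le> 3 \<Longrightarrow> C1_L2 M (\<lambda>t. wd \<beta> (\<psi> t)) (\<lambda>t. wd \<beta> (\<psi>t t))"
  by (rule C1_sobolev_weak_deriv[OF open_box_dom \<psi>_C1])

lemma w_L2: "t \<ge> 0 \<Longrightarrow> w t \<in> L2 M"
  by (rule sobolev_weak_deriv(2)[OF open_box_dom \<psi>_sobolev(1)]) auto

lemma \<phi>_L2: "\<phi> \<in> L2 M" and \<phi>_int: "integrable M \<phi>" and \<phi>_meas: "\<phi> \<in> borel_measurable M"
  by (rule weight_L2[OF a \<kappa>_pos] weight_integrable[OF a \<kappa>_pos] weight_measurable)+

lemma \<phi>_bounds: "x \<in> box_dom a \<Longrightarrow> 0 < \<phi> x" "x \<in> box_dom a \<Longrightarrow> \<phi> x \<le> 1"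
  by (rule weight_bounds(1)[OF a], assumption, rule weight_le_1[OF a \<kappa>_pos])

text \<open>\<open>w t\<close> and its derivatives up to order 2 are derivatives of
  \<open>\<psi> t\<close> up to order 3. Their L2 norms are bounded on [0, T], and the constant of
  the embedding does not depend on the time.\<close>

lemma w_bounded:
  obtains K where "K \<ge> 0" "\<And>t. 0 \<le> t \<Longrightarrow> t \<le> T \<Longrightarrow> AE x in M. \<bar>w t x\<bar> \<le> K"
proof -
  let ?B = "{\<beta>. mi_order \<beta> \<le> 3}"
  have "\<exists>c\<ge>0. \<forall>t. 0 \<le> t \<longrightarrow> t \<le> T \<longrightarrow> L2norm M (wd \<beta> (\<psi> t)) \<le> c" if "mi_order \<beta> \<le> 3" for \<beta>
    using C1_L2_bounded[OF \<psi>_C1_L2[OF that]] by metis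
  then obtain c where c: "\<And>\<beta>. mi_order \<beta> \<le> 3 \<Longrightarrow> c \<beta> \<ge> 0"
    "\<And>\<beta> t. mi_order \<beta> \<le> 3 \<Longrightarrow> 0 \<le> t \<Longrightarrow> t \<le> T \<Longrightarrow> L2norm M (wd \<beta> (\<psi> t)) \<le> c \<beta>" by metis
  define N where "N = sum c ?B"
  have N: "L2norm M (wd \<beta> (\<psi> t)) \<le> N" if "mi_order \<beta> \<le> 3" "0 \<le> t" "t \<le> T" for \<beta> t
  proof -
    have "c \<beta> \<le> N" unfolding N_def using that c(1) finite_mi_order by (intro member_le_sum) auto
    with c(2)[OF that] show ?thesis by linarith
  qed
  have N0: "N \<ge> 0" unfolding N_def using c(1) by (intro sum_nonneg) auto
  show ?thesis
  proof (rule box_dom_sup_bound[OF a])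
    fix C assume C: "C \<ge> 0" "\<And>f d1 d2 N g x. (\<And>i. tensor_deriv (box_dom a) i f (d1 i)) \<Longrightarrow>
      (\<And>i j. tensor_deriv (box_dom a) j (d1 i) (d2 i j)) \<Longrightarrow> L2norm M f \<le> N \<Longrightarrow>
      (\<And>i. L2norm M (d1 i) \<le> N) \<Longrightarrow> (\<And>i j. L2norm M (d2 i j) \<le> N) \<Longrightarrow>
      continuous_on (box_dom a) g \<Longrightarrow> (AE z in M. g z = f z) \<Longrightarrow> x \<in> box_dom a \<Longrightarrow> \<bar>g x\<bar> \<le> C * N"
  show ?thesis
  proof (rule that[of "C * N"])
    show "C * N \<ge> 0" using C(1) N0 by simp
    fix t assume t: "0 \<le> t" "t \<le> T"
    let ?e2 = "\<lambda>i j. mi_unit 3 j + mi_unit i j"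
    let ?e3 = "\<lambda>i l j. ?e2 i j + mi_unit l j"
    have o2: "mi_order (?e2 i) = 2" and o3: "mi_order (?e3 i l) = 3" for i l
      by (simp_all add: mi_order_add_unit)
    \<comment> \<open>The continuous representative that the sup bound refers to comes with the
      boundary condition on the bottom.\<close>
    obtain g where g: "is_cont_rep (box_dom a) (w t) g"
      using bc[OF t(1)] unfolding boundary_cond_def vanishes_on_def by blast
    have gc: "continuous_on (box_dom a) g"
      using g closure_subset unfolding is_cont_rep_def by (blast intro: continuous_on_subset)
    have gae: "AE z in M. g z = w t z" by (rule is_cont_rep_AE[OF _ g]) simp
    have b: "\<bar>g x\<bar> \<le> C * N" if "x \<in> box_dom a" for x
    proof (rule C(2)[of "w t" "\<lambda>i. wd (?e2 i) (\<psi> t)" "\<lambda>i l. wd (?e3 i l) (\<psi> t)"])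
      show "tensor_deriv (box_dom a) i (w t) (wd (?e2 i) (\<psi> t))" for i
        by (rule sobolev_tensor_deriv[OF open_box_dom \<psi>_sobolev(1)[OF t(1)]]) simp
      show "tensor_deriv (box_dom a) l (wd (?e2 i) (\<psi> t)) (wd (?e3 i l) (\<psi> t))" for i l
        by (rule sobolev_tensor_deriv[OF open_box_dom \<psi>_sobolev(1)[OF t(1)]]) (simp add: o2)
      show "L2norm M (w t) \<le> N" "L2norm M (wd (?e2 i) (\<psi> t)) \<le> N" "L2norm M (wd (?e3 i l) (\<psi> t)) \<le> N" for i l
        by (rule N[OF _ t]; simp add: o2 o3)+
    qed (use gc gae that in auto)
    show "AE x in M. \<bar>w t x\<bar> \<le> C * N"
      using gae AE_space
    proof eventually_elim
      case (elim x)
      then show ?case using b[of x] by simp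
    qed
  qed
  qed
qed

lemma layer_bound: "\<exists>B. \<forall>x\<in>box_dom a. 0 \<le> \<phi> x * layer n (x$3) \<and> \<phi> x * layer n (x$3) \<le> B"
proof -
  obtain C where C: "C > 0" "\<And>x. \<bar>deriv step x\<bar> \<le> C"
    by (rule step_derivs_bounded) blast
  have l: "layer n z \<le> real n * C" for z
    unfolding layer_def using C(2)[of "real n * z"] by (intro mult_left_mono) auto
  have "0 \<le> \<phi> x * layer n (x$3) \<and> \<phi> x * layer n (x$3) \<le> 1 * (real n * C)" if "x \<in> box_dom a" for x
    using \<phi>_bounds[OF that] layer_nonneg[of n "x$3"] l[of "x$3"] by (intro conjI mult_nonneg_nonneg mult_mono) auto
  then show ?thesis by blast
qed

text \<open>The growth bound with m = phi times the layer compares u^2 with u0^2 near the bottom,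
  with a factor independent of n. For u0^2 the layer integrals converge to its trace integral, which
  is 0.\<close>

lemma boundary_layer_vanishes:
  assumes t: "t \<ge> 0"
  shows "(\<lambda>n. \<integral>x. (u t x)\<^sup>2 * \<phi> x * layer n (x$3) \<partial>M) \<longlonglongrightarrow> 0"
proof -
  obtain K where K: "K \<ge> 0" "\<And>s. 0 \<le> s \<Longrightarrow> s \<le> t \<Longrightarrow> AE x in M. \<bar>w s x\<bar> \<le> K"
    using w_bounded[of t] by metis
  obtain g where g: "is_cont_rep (box_dom a) u0 g" "\<And>x. x \<in> frontier (box_dom a) \<Longrightarrow> g x = 0"
    using u0_vanishes unfolding vanishes_on_def by blast
  have gc: "continuous_on (closure (box_dom a)) g" using g(1) by (simp add: is_cont_rep_def)
  have lm: "(\<lambda>x. \<phi> x * layer n (x$3)) \<in> borel_measurable M" for n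
    by (intro borel_measurable_times \<phi>_meas borel_measurable_dom) measurable
  have up: "(\<integral>x. (u t x)\<^sup>2 * (\<phi> x * layer n (x$3)) \<partial>M) \<le> exp (4 * K * t) * (\<integral>x. (u 0 x)\<^sup>2 * (\<phi> x * layer n (x$3)) \<partial>M)" for n
  proof -
    obtain B where "\<forall>x\<in>box_dom a. 0 \<le> \<phi> x * layer n (x$3) \<and> \<phi> x * layer n (x$3) \<le> B"
      using layer_bound[of n] by blast
    then show ?thesis
      by (intro linear_growth_monotone(2)[OF u_C1_L2 t u_eq K(2) lm]) auto
  qed
  have init: "(\<integral>x. (u 0 x)\<^sup>2 * (\<phi> x * layer n (x$3)) \<partial>M) = (\<integral>x. ((g x)\<^sup>2 * \<phi> x) * layer n (x$3) \<partial>M)" for n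
  proof (rule integral_cong_AE)
    have "g \<in> borel_measurable M"
      by (rule continuous_imp_measurable_on_sets_lebesgue[OF continuous_on_subset[OF gc closure_subset]]) simp
    then show "(\<lambda>x. ((g x)\<^sup>2 * \<phi> x) * layer n (x$3)) \<in> borel_measurable M"
      using borel_measurable_times[OF borel_measurable_power[of g M 2] lm[of n]] by (simp add: mult.assoc)
    show "(\<lambda>x. (u 0 x)\<^sup>2 * (\<phi> x * layer n (x$3))) \<in> borel_measurable M"
      by (intro borel_measurable_times borel_measurable_power lm L2_measurable[OF u_L2(1)]) simp
    show "AE x in M. (u 0 x)\<^sup>2 * (\<phi> x * layer n (x$3)) = (g x)\<^sup>2 * \<phi> x * layer n (x$3)"
      using is_cont_rep_AE[OF _ g(1), simplified] u_init by eventually_elim simp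
  qed
  have lim0: "(\<lambda>n. \<integral>x. ((g x)\<^sup>2 * \<phi> x) * layer n (x$3) \<partial>M) \<longlonglongrightarrow> 0"
  proof -
    have "(\<lambda>n. \<integral>x. ((g x)\<^sup>2 * \<phi> x) * layer n (x$3) \<partial>M) \<longlonglongrightarrow> (LINT y:dom_x a|lebesgue. (g (vec3 y 0))\<^sup>2 * \<phi> (vec3 y 0))"
      by (rule trace_limit[OF a]) (intro continuous_on_mult continuous_on_power gc continuous_on_weight)
    moreover have "(LINT y:dom_x a|lebesgue. (g (vec3 y 0))\<^sup>2 * \<phi> (vec3 y 0)) = (LINT y:dom_x a|lebesgue. 0)"
    proof (rule set_lebesgue_integral_cong)
      show "dom_x a \<in> sets lebesgue" by (simp add: dom_x_box)
      have "g (vec3 y 0) = 0" if "y \<in> dom_x a" for y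
        using that by (intro g(2) frontier_box_dom_bottom(1)[OF a]) (simp add: dom_x_def bottom_def)
      then show "\<forall>y. y \<in> dom_x a \<longrightarrow> (g (vec3 y 0))\<^sup>2 * \<phi> (vec3 y 0) = 0" by simp
    qed
    ultimately show ?thesis by simp
  qed
  have "(\<lambda>n. exp (4 * K * t) * (\<integral>x. ((g x)\<^sup>2 * \<phi> x) * layer n (x$3) \<partial>M)) \<longlonglongrightarrow> exp (4 * K * t) * 0"
    by (rule tendsto_mult_left[OF lim0])
  then have up0: "(\<lambda>n. exp (4 * K * t) * (\<integral>x. ((g x)\<^sup>2 * \<phi> x) * layer n (x$3) \<partial>M)) \<longlonglongrightarrow> 0" by simp
  have nn: "0 \<le> (\<integral>x. (u t x)\<^sup>2 * (\<phi> x * layer n (x$3)) \<partial>M)" for n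
    using \<phi>_bounds(1) layer_nonneg by (intro integral_nonneg_AE AE_I2) (simp add: less_imp_le)
  have "(\<lambda>n. \<integral>x. (u t x)\<^sup>2 * (\<phi> x * layer n (x$3)) \<partial>M) \<longlonglongrightarrow> 0"
    by (rule tendsto_sandwich[OF _ _ tendsto_const up0]) (use nn up[unfolded init] in \<open>auto intro!: always_eventually\<close>)
  then show ?thesis by (simp add: mult.assoc)
qed

text \<open>A sum of three integrals of separately chosen weak derivatives, so that each of them is
  differentiated in time by \<open>C1_L2_pairing_deriv\<close>.\<close>

definition "P t = - (\<Sum>i\<in>UNIV. \<integral>x. wd (\<lambda>j. 2 * mi_unit i j) (\<psi> t) x * \<phi> x \<partial>M)"

lemma u2_\<phi>_integrable:
  assumes "t \<ge> 0" shows "integrable M (\<lambda>x. (u t x)\<^sup>2 * \<phi> x)"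
proof -
  have "\<bar>\<phi> x\<bar> \<le> 1" if "x \<in> space M" for x using \<phi>_bounds[of x] that by simp
  from L2_mult_integrable[OF u_L2(1)[OF assms] L2_bounded_mult[OF u_L2(1)[OF assms] \<phi>_meas this]]
  show ?thesis by (simp add: power2_eq_square mult.assoc)
qed

text \<open>\<open>vertical_boundary_limit\<close> for u^2, with -\<Delta> \<psi>_t as its weak
  z-derivative. The limit it gives must be 0 by \<open>boundary_layer_vanishes\<close>, and this is
  the required identity.\<close>

lemma P_deriv:
  assumes t: "t \<ge> 0"
  shows "(P has_real_derivative \<kappa> * (\<integral>x. (u t x)\<^sup>2 * \<phi> x \<partial>M)) (at t within {0..})"
proof -
  let ?L = "\<lambda>x. - weak_laplacian (box_dom a) (\<psi>t t) x"
  have w2: "wd (\<lambda>j. 2 * mi_unit i j) (\<psi>t t) \<in> L2 M" for i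
    by (rule sobolev_weak_deriv(2)[OF open_box_dom \<psi>_sobolev(2)[OF t]]) simp
  have d: "(P has_real_derivative - (\<Sum>i\<in>UNIV. \<integral>x. wd (\<lambda>j. 2 * mi_unit i j) (\<psi>t t) x * \<phi> x \<partial>M)) (at t within {0..})"
    unfolding P_def[abs_def]
    by (intro DERIV_minus DERIV_sum C1_L2_pairing_deriv[OF \<psi>_C1_L2 \<phi>_L2 t]) simp
  have L: "- (\<Sum>i\<in>UNIV. \<integral>x. wd (\<lambda>j. 2 * mi_unit i j) (\<psi>t t) x * \<phi> x \<partial>M) = (\<integral>x. ?L x * \<phi> x \<partial>M)"
    unfolding weak_laplacian_def using L2_mult_integrable[OF w2 \<phi>_L2]
    by (simp add: sum_distrib_right)
  have L2: "?L \<in> L2 M"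
    unfolding weak_laplacian_def sum_3 using L2_cmult[OF L2_add[OF L2_add[OF w2 w2] w2], of "- 1"] by simp
  have u2d: "decaying a \<kappa> (\<lambda>x. (u t x)\<^sup>2)"
    unfolding decaying_def
  proof (rule Bochner_Integration.integrable_bound[OF L2_integrable_power2[OF u_L2(1)[OF t]]])
    show "(\<lambda>x. (u t x)\<^sup>2 * exp (- \<kappa> * x$3)) \<in> borel_measurable M"
      by (intro borel_measurable_times borel_measurable_power L2_measurable[OF u_L2(1)[OF t]] borel_measurable_dom) measurable
    show "AE x in M. norm ((u t x)\<^sup>2 * exp (- \<kappa> * x$3)) \<le> norm ((u t x)\<^sup>2)"
      using \<kappa>_pos by (intro AE_I2) (auto simp: box_dom_def abs_mult intro!: mult_left_le)
  qed
  have "(\<lambda>n. \<integral>x. (u t x)\<^sup>2 * \<phi> x * layer n (x$3) \<partial>M) \<longlonglongrightarrow> \<kappa> * (\<integral>x. (u t x)\<^sup>2 * \<phi> x \<partial>M) - (\<integral>x. ?L x * \<phi> x \<partial>M)"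
    by (rule vertical_boundary_limit[OF a u2d L2_decaying[OF \<kappa>_pos L2] \<kappa>_pos])
       (rule has_weak_deriv_unit[OF _ \<psi>_eq[OF t]], simp)
  from LIMSEQ_unique[OF this boundary_layer_vanishes[OF t]]
  have "(\<integral>x. ?L x * \<phi> x \<partial>M) = \<kappa> * (\<integral>x. (u t x)\<^sup>2 * \<phi> x \<partial>M)" by simp
  with d L show ?thesis by simp
qed

text \<open>Formally the time derivative of int (log u) phi.\<close>

definition "flux t = 2 * (\<integral>x. w t x * \<phi> x \<partial>M)"

lemma flux_continuous: "continuous_on {0..} flux"
proof (rule DERIV_continuous_on)
  fix t :: real assume "t \<in> {0..}"
  then show "(flux has_real_derivative 2 * (\<integral>x. wd (mi_unit 3) (\<psi>t t) x * \<phi> x \<partial>M)) (at t within {0..})"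
    unfolding flux_def[abs_def] by (intro DERIV_cmult C1_L2_pairing_deriv[OF \<psi>_C1_L2 \<phi>_L2]) auto
qed

text \<open>\<open>elliptic_identity\<close> for D = \<psi> t - \<psi>0, whose left side is P t - P
  0. Multiplication by 2/\<kappa> turns the coefficients \<kappa> and 2 \<kappa> into 2 and
  4.\<close>

lemma flux_identity:
  assumes t: "t \<ge> 0"
  shows "flux t = 2 * (\<integral>x. wd (mi_unit 3) \<psi>0 x * \<phi> x \<partial>M) + 2 / \<kappa> * (P t - P 0)
    - 4 * (LINT y:dom_x a|lebesgue. cont_rep (box_dom a) (\<lambda>x. \<psi> t x - \<psi>0 x) (vec3 y 0)
        * (sin (pi * y$1 / a) * sin (pi * y$2 / a)))"
proof -
  define D where "D = (\<lambda>x. \<psi> t x - \<psi>0 x)"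
  note op = open_box_dom[of a]
  have D: "D \<in> sobolev 3 (box_dom a)"
    unfolding D_def by (rule weak_deriv_diff(2)[OF op \<psi>_sobolev(1)[OF t] \<psi>0, of "\<lambda>_. 0"]) simp
  have dD: "AE x in M. wd \<beta> D x = wd \<beta> (\<psi> t) x - wd \<beta> \<psi>0 x" if "mi_order \<beta> \<le> 3" for \<beta>
    unfolding D_def by (rule weak_deriv_diff(1)[OF op \<psi>_sobolev(1)[OF t] \<psi>0 that])
  have d0: "AE x in M. wd \<beta> (\<psi> 0) x = wd \<beta> \<psi>0 x" if "mi_order \<beta> \<le> 3" for \<beta>
    by (rule has_weak_deriv_unique[OF op sobolev_weak_deriv(1)[OF op \<psi>_sobolev(1) that] sobolev_weak_deriv(1)[OF op \<psi>0 that] \<psi>_init]) simp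
  have L2s: "wd \<beta> D \<in> L2 M" "wd \<beta> (\<psi> t) \<in> L2 M" "wd \<beta> (\<psi> 0) \<in> L2 M" "wd \<beta> \<psi>0 \<in> L2 M" if "mi_order \<beta> \<le> 3" for \<beta>
    using sobolev_weak_deriv(2)[OF op _ that] D \<psi>_sobolev(1)[OF t] \<psi>_sobolev(1)[of 0] \<psi>0 by auto
  have intD: "(\<integral>x. wd \<beta> D x * \<phi> x \<partial>M) = (\<integral>x. wd \<beta> (\<psi> t) x * \<phi> x \<partial>M) - (\<integral>x. wd \<beta> \<psi>0 x * \<phi> x \<partial>M)"
    and int0: "(\<integral>x. wd \<beta> (\<psi> 0) x * \<phi> x \<partial>M) = (\<integral>x. wd \<beta> \<psi>0 x * \<phi> x \<partial>M)" if b: "mi_order \<beta> \<le> 3" for \<beta>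
  proof -
    note i = L2_mult_integrable[OF _ \<phi>_L2]
    have "(\<integral>x. wd \<beta> D x * \<phi> x \<partial>M) = (\<integral>x. wd \<beta> (\<psi> t) x * \<phi> x - wd \<beta> \<psi>0 x * \<phi> x \<partial>M)"
    proof (rule integral_cong_AE)
      show "AE x in M. wd \<beta> D x * \<phi> x = wd \<beta> (\<psi> t) x * \<phi> x - wd \<beta> \<psi>0 x * \<phi> x"
        using dD[OF b] by eventually_elim (simp add: left_diff_distrib)
      show "(\<lambda>x. wd \<beta> D x * \<phi> x) \<in> borel_measurable M"
        by (rule borel_measurable_integrable[OF i[OF L2s(1)[OF b]]])
      show "(\<lambda>x. wd \<beta> (\<psi> t) x * \<phi> x - wd \<beta> \<psi>0 x * \<phi> x) \<in> borel_measurable M"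
        by (rule borel_measurable_integrable[OF Bochner_Integration.integrable_diff[OF i[OF L2s(2)[OF b]] i[OF L2s(4)[OF b]]]])
    qed
    then show "(\<integral>x. wd \<beta> D x * \<phi> x \<partial>M) = (\<integral>x. wd \<beta> (\<psi> t) x * \<phi> x \<partial>M) - (\<integral>x. wd \<beta> \<psi>0 x * \<phi> x \<partial>M)"
      using i[OF L2s(2)[OF b]] i[OF L2s(4)[OF b]] by simp
    show "(\<integral>x. wd \<beta> (\<psi> 0) x * \<phi> x \<partial>M) = (\<integral>x. wd \<beta> \<psi>0 x * \<phi> x \<partial>M)"
    proof (rule integral_cong_AE)
      show "AE x in M. wd \<beta> (\<psi> 0) x * \<phi> x = wd \<beta> \<psi>0 x * \<phi> x"
        using d0[OF b] by eventually_elim simp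
    qed (rule borel_measurable_integrable[OF i[OF L2s(3)[OF b]]] borel_measurable_integrable[OF i[OF L2s(4)[OF b]]])+
  qed
  obtain gt ht where gt: "is_cont_rep (box_dom a) (\<psi> t) gt" "\<And>x. x \<in> frontier (box_dom a) - bottom a \<Longrightarrow> gt x = 0"
    and ht: "is_cont_rep (box_dom a) (w t) ht" "\<And>x. x \<in> bottom a \<Longrightarrow> ht x = 0"
    using bc[OF t] unfolding boundary_cond_def vanishes_on_def by blast
  obtain g0 h0 where g0: "is_cont_rep (box_dom a) \<psi>0 g0" "\<And>x. x \<in> frontier (box_dom a) - bottom a \<Longrightarrow> g0 x = 0"
    and h0: "is_cont_rep (box_dom a) (wd (mi_unit 3) \<psi>0) h0" "\<And>x. x \<in> bottom a \<Longrightarrow> h0 x = 0"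
    using bc0 unfolding boundary_cond_def vanishes_on_def by blast
  define G where "G = (\<lambda>x. gt x - g0 x)"
  define h where "h = (\<lambda>x. ht x - h0 x)"
  have G: "is_cont_rep (box_dom a) D G"
  proof -
    have "AE x in M. G x = D x"
      using is_cont_rep_AE[OF _ gt(1), simplified] is_cont_rep_AE[OF _ g0(1), simplified]
      by eventually_elim (simp add: G_def D_def)
    then show ?thesis using gt(1) g0(1)
      by (auto simp: is_cont_rep_def AE_lebesgue_on_iff G_def intro: continuous_on_diff)
  qed
  have h: "is_cont_rep (box_dom a) (wd (mi_unit 3) D) h"
  proof -
    have "AE x in M. h x = wd (mi_unit 3) D x"
      using is_cont_rep_AE[OF _ ht(1), simplified] is_cont_rep_AE[OF _ h0(1), simplified] dD[of "mi_unit 3", simplified]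
      by eventually_elim (simp add: h_def)
    then show ?thesis using ht(1) h0(1)
      by (auto simp: is_cont_rep_def AE_lebesgue_on_iff h_def intro: continuous_on_diff)
  qed
  \<comment> \<open>The boundary integral is stated with the chosen representative; on the closure
    it must coincide with the explicit difference G.\<close>
  have rep: "cont_rep (box_dom a) D x = G x" if "x \<in> closure (box_dom a)" for x
  proof -
    have c: "is_cont_rep (box_dom a) D (cont_rep (box_dom a) D)"
      unfolding cont_rep_def by (rule someI[of "is_cont_rep (box_dom a) D" G]) (rule G)
    show ?thesis by (rule cont_rep_unique[OF op c G that])
  qed
  have R: "(LINT y:dom_x a|lebesgue. cont_rep (box_dom a) D (vec3 y 0) * (sin (pi * y$1 / a) * sin (pi * y$2 / a)))
      = (LINT y:dom_x a|lebesgue. G (vec3 y 0) * (sin (pi * y$1 / a) * sin (pi * y$2 / a)))" (is "?R = _")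
  proof (rule set_lebesgue_integral_cong)
    show "dom_x a \<in> sets lebesgue" by (simp add: dom_x_box)
    have "cont_rep (box_dom a) D (vec3 y 0) = G (vec3 y 0)" if "y \<in> dom_x a" for y
      using that by (intro rep frontier_box_dom_bottom(2)[OF a]) (simp add: dom_x_def bottom_def)
    then show "\<forall>y. y \<in> dom_x a \<longrightarrow> cont_rep (box_dom a) D (vec3 y 0) * (sin (pi * y$1 / a) * sin (pi * y$2 / a))
        = G (vec3 y 0) * (sin (pi * y$1 / a) * sin (pi * y$2 / a))" by simp
  qed
  have "- (\<Sum>i\<in>UNIV. \<integral>x. wd (\<lambda>j. 2 * mi_unit i j) D x * \<phi> x \<partial>M) = \<kappa> * (\<integral>x. wd (mi_unit 3) D x * \<phi> x \<partial>M) + 2 * \<kappa> * ?R"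
    unfolding R by (rule elliptic_identity[OF a D \<kappa> G _ h]) (auto simp: G_def h_def gt(2) g0(2) ht(2) h0(2))
  moreover have "- (\<Sum>i\<in>UNIV. \<integral>x. wd (\<lambda>j. 2 * mi_unit i j) D x * \<phi> x \<partial>M) = P t - P 0"
    unfolding P_def using intD[of "\<lambda>j. 2 * mi_unit _ j"] int0[of "\<lambda>j. 2 * mi_unit _ j"] by (simp add: sum_subtractf)
  moreover have "(\<integral>x. wd (mi_unit 3) D x * \<phi> x \<partial>M) = flux t / 2 - (\<integral>x. wd (mi_unit 3) \<psi>0 x * \<phi> x \<partial>M)"
    using intD[of "mi_unit 3"] by (simp add: flux_def)
  ultimately have "P t - P 0 = \<kappa> * (flux t / 2 - (\<integral>x. wd (mi_unit 3) \<psi>0 x * \<phi> x \<partial>M)) + 2 * \<kappa> * ?R" by simp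
  then have "2 / \<kappa> * (P t - P 0) = flux t - 2 * (\<integral>x. wd (mi_unit 3) \<psi>0 x * \<phi> x \<partial>M) + 4 * ?R"
    using \<kappa>_pos by (simp add: field_simps)
  then show ?thesis unfolding D_def by linarith
qed

text \<open>With the regularised logarithm the time derivative is int 2 w u^2 / (u^2 + e) phi and
  misses \<open>flux\<close> by int 2 w e / (u^2 + e) phi. As u^2 is at least q (u 0)^2 on [0, T],
  this error is at most \<eta> n at all these times, and \<eta> n tends to 0 by dominated
  convergence since u 0 > 0 almost everywhere. The number k is the free parameter of the
  tangent.\<close>

lemma log_estimate:
  assumes T: "T \<ge> 0" and A: "integrable M (\<lambda>x. ln (u0 x) * \<phi> x)"
  shows "(\<integral>x. ln (u0 x) * \<phi> x \<partial>M) + integral {0..T} flux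
    \<le> exp (- 2 * k) / 2 * (\<integral>x. (u T x)\<^sup>2 * \<phi> x \<partial>M) + (k - 1 / 2) * (\<integral>x. \<phi> x \<partial>M)"
proof -
  obtain K where K: "K \<ge> 0" "\<And>s. 0 \<le> s \<Longrightarrow> s \<le> T \<Longrightarrow> AE x in M. \<bar>w s x\<bar> \<le> K"
    using w_bounded[of T] by metis
  \<comment> \<open>The smallest factor over [0, T] in the lower bound of u^2 by (u 0)^2.\<close>
  define q where "q = exp (- 4 * K * T)"
  define c where "c = (\<integral>x. \<phi> x \<partial>M)"
  define e where "e n = 1 / real (Suc n)" for n
  have e: "e n > 0" for n by (simp add: e_def)
  have e0: "e \<longlonglongrightarrow> 0" unfolding e_def using LIMSEQ_inverse_real_of_nat by (simp add: inverse_eq_divide)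
  \<comment> \<open>A majorant of the error 2 |w| e / (u^2 + e) phi that does not depend on the
    time.\<close>
  define H where "H n x = 2 * K * (e n / (q * (u 0 x)\<^sup>2 + e n)) * \<phi> x" for n x
  have q0: "q > 0" by (simp add: q_def)
  have frac: "0 \<le> e n / (q * y + e n)" "e n / (q * y + e n) \<le> 1" if "y \<ge> 0" for n y
  proof -
    have "0 \<le> q * y" using that q0 by simp
    then show "0 \<le> e n / (q * y + e n)" "e n / (q * y + e n) \<le> 1" using e[of n] by (auto simp: divide_le_eq)
  qed
  have um: "u t \<in> borel_measurable M" if "t \<ge> 0" for t by (rule L2_measurable[OF u_L2(1)[OF that]])
  have Hm: "H n \<in> borel_measurable M" for n
    using um[of 0] \<phi>_meas unfolding H_def[abs_def] by measurable
  have Hb: "\<bar>H n x\<bar> \<le> 2 * K * \<phi> x" if "x \<in> box_dom a" for n x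
  proof -
    have "2 * K * (e n / (q * (u 0 x)\<^sup>2 + e n)) \<le> 2 * K * 1" using frac[of "(u 0 x)\<^sup>2" n] K(1) by (intro mult_left_mono) auto
    moreover have "0 \<le> 2 * K * (e n / (q * (u 0 x)\<^sup>2 + e n))" using frac[of "(u 0 x)\<^sup>2" n] K(1) by (intro mult_nonneg_nonneg) auto
    ultimately show ?thesis
      unfolding H_def using \<phi>_bounds(1)[OF that] by (simp only: abs_mult abs_of_nonneg abs_of_pos mult_1_right mult_right_mono less_imp_le)
  qed
  have Ki: "integrable M (\<lambda>x. 2 * K * \<phi> x)" using \<phi>_int by (rule integrable_mult_right)
  have Hi: "integrable M (H n)" for n
    by (rule Bochner_Integration.integrable_bound[OF Ki Hm], rule AE_I2) (use Hb K(1) \<phi>_bounds(1) in \<open>force simp: abs_mult\<close>)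
  define \<eta> where "\<eta> n = (\<integral>x. H n x \<partial>M)" for n
  have u0pos: "AE x in M. u 0 x > 0 \<and> u 0 x = u0 x"
  proof -
    obtain g where g: "is_cont_rep (box_dom a) u0 g" "\<And>x. x \<in> box_dom a \<Longrightarrow> g x > 0"
      using u0_positive unfolding positive_on_def by blast
    show ?thesis using is_cont_rep_AE[OF _ g(1), simplified] u_init AE_space
    proof eventually_elim
      case (elim x)
      then show ?case using g(2)[of x] by simp
    qed
  qed
  have \<eta>0: "\<eta> \<longlonglongrightarrow> 0"
  proof -
    have "\<eta> \<longlonglongrightarrow> (\<integral>x. 0 \<partial>M)"
      unfolding \<eta>_def
    proof (rule integral_dominated_convergence[OF _ Hm Ki])
      show "AE x in M. (\<lambda>n. H n x) \<longlonglongrightarrow> 0" using u0pos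
      proof eventually_elim
        case (elim x)
        then have "q * (u 0 x)\<^sup>2 > 0" using q0 by simp
        then have "(\<lambda>n. H n x) \<longlonglongrightarrow> 2 * K * (0 / (q * (u 0 x)\<^sup>2 + 0)) * \<phi> x"
          unfolding H_def by (intro tendsto_intros e0) auto
        then show ?case by simp
      qed
      show "AE x in M. norm (H n x) \<le> 2 * K * \<phi> x" for n using Hb by (intro AE_I2) simp
    qed simp
    then show ?thesis by simp
  qed
  have \<phi>b: "\<bar>\<phi> x\<bar> \<le> 1" if "x \<in> space M" for x using \<phi>_bounds[of x] that by simp
  define L where "L n t = (\<integral>x. reg_log (e n) (u t x) * \<phi> x \<partial>M)" for n t
  have Li: "integrable M (\<lambda>x. reg_log (e n) (u t x) * \<phi> x)" if t: "t \<ge> 0" for n t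
  proof (rule Bochner_Integration.integrable_bound)
    show "integrable M (\<lambda>x. (u t x)\<^sup>2 * \<phi> x + (e n + \<bar>ln (e n)\<bar>) * \<phi> x)"
      by (intro Bochner_Integration.integrable_add u2_\<phi>_integrable t integrable_mult_right \<phi>_int)
    show "(\<lambda>x. reg_log (e n) (u t x) * \<phi> x) \<in> borel_measurable M"
      using um[OF t] \<phi>_meas unfolding reg_log_def by measurable
    show "AE x in M. norm (reg_log (e n) (u t x) * \<phi> x) \<le> norm ((u t x)\<^sup>2 * \<phi> x + (e n + \<bar>ln (e n)\<bar>) * \<phi> x)"
    proof (rule AE_I2)
      fix x assume "x \<in> space M"
      then have p: "0 < \<phi> x" using \<phi>_bounds(1) by simp
      have "\<bar>reg_log (e n) (u t x)\<bar> * \<phi> x \<le> ((u t x)\<^sup>2 + (e n + \<bar>ln (e n)\<bar>)) * \<phi> x"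
        using reg_log_abs_le[OF e, of n "u t x"] p by (intro mult_right_mono) auto
      also have "\<dots> = (u t x)\<^sup>2 * \<phi> x + (e n + \<bar>ln (e n)\<bar>) * \<phi> x" by (rule distrib_right)
      also have "\<dots> \<le> \<bar>(u t x)\<^sup>2 * \<phi> x + (e n + \<bar>ln (e n)\<bar>) * \<phi> x\<bar>" by (rule abs_ge_self)
      finally show "norm (reg_log (e n) (u t x) * \<phi> x) \<le> norm ((u t x)\<^sup>2 * \<phi> x + (e n + \<bar>ln (e n)\<bar>) * \<phi> x)"
        using p by (simp add: abs_mult)
    qed
  qed
  define L' where "L' n t = (\<integral>x. u t x / ((u t x)\<^sup>2 + e n) * ut t x * \<phi> x \<partial>M)" for n t
  have dL: "(L n has_real_derivative L' n t) (at t within {0..})" if t: "t \<ge> 0" for n t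
    unfolding L_def[abs_def] L'_def
    by (rule C1_L2_chain_deriv[OF u_C1_L2 t reg_log_deriv[OF e] reg_log_deriv_Lipschitz[OF e] _ \<phi>_meas \<phi>b Li]) auto
  have L'b: "\<bar>L' n t - flux t\<bar> \<le> \<eta> n" if t: "0 \<le> t" "t \<le> T" for n t
  proof -
    have F2: "(\<lambda>x. u t x / ((u t x)\<^sup>2 + e n)) \<in> L2 M"
    proof (rule L2_dominated[OF u_L2(1)[OF t(1)]])
      show "(\<lambda>x. u t x / ((u t x)\<^sup>2 + e n)) \<in> borel_measurable M" using um[OF t(1)] by measurable
      show "\<bar>u t x / ((u t x)\<^sup>2 + e n)\<bar> \<le> 1 / e n * \<bar>u t x\<bar>" for x
        using reg_log_deriv_Lipschitz[OF e, of "u t x" n 0] by simp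
    qed
    have i1: "integrable M (\<lambda>x. u t x / ((u t x)\<^sup>2 + e n) * ut t x * \<phi> x)"
      using L2_mult_integrable[OF L2_bounded_mult[OF F2 \<phi>_meas \<phi>b] u_L2(2)[OF t(1)]] by (simp add: mult_ac)
    have i2: "integrable M (\<lambda>x. 2 * (w t x * \<phi> x))"
      by (rule integrable_mult_right[OF L2_mult_integrable[OF w_L2[OF t(1)] \<phi>_L2]])
    have "L' n t - flux t = (\<integral>x. u t x / ((u t x)\<^sup>2 + e n) * ut t x * \<phi> x - 2 * (w t x * \<phi> x) \<partial>M)"
      unfolding L'_def flux_def using i1 i2 by simp
    also have "\<bar>\<dots>\<bar> \<le> (\<integral>x. H n x \<partial>M)"
    proof (rule abs_integral_le[OF Hi])
      have lower: "AE x in M. exp (- 4 * K * t) * (u 0 x)\<^sup>2 \<le> (u t x)\<^sup>2"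
        by (rule linear_growth_lower_bound[OF u_C1_L2 t(1) u_eq K(2)]) (use t in auto)
      show "AE x in M. \<bar>u t x / ((u t x)\<^sup>2 + e n) * ut t x * \<phi> x - 2 * (w t x * \<phi> x)\<bar> \<le> H n x"
        using u_eq[OF t(1)] K(2)[OF t] lower AE_space
      proof eventually_elim
        case (elim x)
        define y where "y = u t x"
        define v where "v = w t x"
        note p = square_add_pos[OF e[of n], of y]
        have x: "x \<in> box_dom a" using elim(4) by simp
        have "q \<le> exp (- 4 * K * t)" unfolding q_def using K(1) t by (simp add: mult_left_mono)
        from mult_right_mono[OF this, of "(u 0 x)\<^sup>2"] have qy: "q * (u 0 x)\<^sup>2 \<le> y\<^sup>2"
          using elim(3) by (simp add: y_def)
        have "y / (y\<^sup>2 + e n) * (2 * y * v) = 2 * v * (y\<^sup>2 / (y\<^sup>2 + e n))" by (simp add: power2_eq_square)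
        also have "y\<^sup>2 / (y\<^sup>2 + e n) = 1 - e n / (y\<^sup>2 + e n)"
          using p by (simp add: diff_divide_eq_iff)
        finally have eq0: "y / (y\<^sup>2 + e n) * (2 * y * v) = 2 * v * (1 - e n / (y\<^sup>2 + e n))" .
        have "2 * v * (1 - F) * s - 2 * (v * s) = - (2 * v * F * s)" for F s :: real by (simp add: algebra_simps)
        then have eq: "y / (y\<^sup>2 + e n) * (2 * y * v) * \<phi> x - 2 * (v * \<phi> x) = - (2 * v * (e n / (y\<^sup>2 + e n)) * \<phi> x)"
          unfolding eq0 .
        have "\<bar>2 * v * (e n / (y\<^sup>2 + e n)) * \<phi> x\<bar> = 2 * \<bar>v\<bar> * (e n / (y\<^sup>2 + e n)) * \<phi> x"
          using p e[of n] \<phi>_bounds(1)[OF x] by (simp add: abs_mult abs_divide)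
        also have "\<dots> \<le> 2 * K * (e n / (q * (u 0 x)\<^sup>2 + e n)) * \<phi> x"
        proof (intro mult_right_mono mult_mono)
          have "0 < q * (u 0 x)\<^sup>2 + e n" using q0 e[of n] by (intro add_nonneg_pos) auto
          then show "e n / (y\<^sup>2 + e n) \<le> e n / (q * (u 0 x)\<^sup>2 + e n)"
            using qy e[of n] by (intro divide_left_mono) (auto intro!: mult_pos_pos p)
        qed (use elim(2) K(1) p e[of n] \<phi>_bounds(1)[OF x] in \<open>auto simp: v_def\<close>)
        finally show ?case
          unfolding elim(1) y_def[symmetric] v_def[symmetric] eq H_def by simp
      qed
    qed
    finally show ?thesis by (simp add: \<eta>_def)
  qed
  have dF: "((\<lambda>t. integral {0..t} flux) has_real_derivative flux t) (at t within {0..})" if "t \<ge> 0" for t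
    by (rule integral_deriv_within[OF flux_continuous that])
  \<comment> \<open>The inequality L' \<ge> flux - \<eta> n, integrated from 0 to T.\<close>
  have low: "L n 0 + integral {0..T} flux - T * \<eta> n \<le> L n T" for n
  proof -
    have "L n 0 - integral {0..0} flux + \<eta> n * 0 \<le> L n T - integral {0..T} flux + \<eta> n * T"
    proof (rule nondecreasing_within[of T "\<lambda>t. L n t - integral {0..t} flux + \<eta> n * t" "\<lambda>t. L' n t - flux t + \<eta> n"])
      fix t assume t: "0 \<le> t" "t \<le> T"
      have "((\<lambda>t. \<eta> n * t) has_real_derivative \<eta> n) (at t within {0..})"
        using DERIV_cmult[OF DERIV_ident, of "\<eta> n"] by simp
      then show "((\<lambda>t. L n t - integral {0..t} flux + \<eta> n * t) has_real_derivative L' n t - flux t + \<eta> n) (at t within {0..})"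
        by (intro DERIV_add DERIV_diff dL dF t)
      show "0 \<le> L' n t - flux t + \<eta> n" using L'b[OF t, of n] by linarith
    qed (use T in auto)
    then show ?thesis by (simp add: mult.commute)
  qed
  have init: "(\<integral>x. ln (u0 x) * \<phi> x \<partial>M) \<le> L n 0" for n
    unfolding L_def
  proof (rule integral_mono_AE[OF A Li])
    show "AE x in M. ln (u0 x) * \<phi> x \<le> reg_log (e n) (u 0 x) * \<phi> x"
      using u0pos AE_space
    proof eventually_elim
      case (elim x)
      then have "ln ((u 0 x)\<^sup>2) \<le> ln ((u 0 x)\<^sup>2 + e n)" using e[of n] square_add_pos[OF e[of n], of "u 0 x"] by (subst ln_le_cancel_iff) auto
      moreover have "ln ((u 0 x)\<^sup>2) = 2 * ln (u 0 x)" using elim by (simp add: ln_realpow)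
      ultimately have "ln (u0 x) \<le> reg_log (e n) (u 0 x)" using elim by (simp add: reg_log_def)
      then show ?case using \<phi>_bounds(1)[of x] elim by (intro mult_right_mono) auto
    qed
  qed simp
  have up: "L n T \<le> exp (- 2 * k) / 2 * ((\<integral>x. (u T x)\<^sup>2 * \<phi> x \<partial>M) + e n * c) + (k - 1 / 2) * c" for n
  proof -
    have "L n T \<le> (\<integral>x. exp (- 2 * k) / 2 * ((u T x)\<^sup>2 * \<phi> x + e n * \<phi> x) + (k - 1 / 2) * \<phi> x \<partial>M)"
      unfolding L_def
    proof (rule integral_mono_AE[OF Li[OF T]])
      show "integrable M (\<lambda>x. exp (- 2 * k) / 2 * ((u T x)\<^sup>2 * \<phi> x + e n * \<phi> x) + (k - 1 / 2) * \<phi> x)"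
        by (intro Bochner_Integration.integrable_add integrable_mult_right u2_\<phi>_integrable T \<phi>_int)
      show "AE x in M. reg_log (e n) (u T x) * \<phi> x \<le> exp (- 2 * k) / 2 * ((u T x)\<^sup>2 * \<phi> x + e n * \<phi> x) + (k - 1 / 2) * \<phi> x"
      proof (rule AE_I2)
        fix x assume "x \<in> space M"
        then have "0 \<le> \<phi> x" using \<phi>_bounds(1)[of x] by simp
        from mult_right_mono[OF reg_log_tangent[OF e, of n "u T x" k] this]
        show "reg_log (e n) (u T x) * \<phi> x \<le> exp (- 2 * k) / 2 * ((u T x)\<^sup>2 * \<phi> x + e n * \<phi> x) + (k - 1 / 2) * \<phi> x"
          by (simp add: algebra_simps add_divide_distrib)
      qed
    qed
    also have "\<dots> = exp (- 2 * k) / 2 * ((\<integral>x. (u T x)\<^sup>2 * \<phi> x \<partial>M) + e n * c) + (k - 1 / 2) * c"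
      unfolding c_def using u2_\<phi>_integrable[OF T] \<phi>_int by simp
    finally show ?thesis .
  qed
  have "(\<integral>x. ln (u0 x) * \<phi> x \<partial>M) + integral {0..T} flux
      \<le> T * 0 + (exp (- 2 * k) / 2 * ((\<integral>x. (u T x)\<^sup>2 * \<phi> x \<partial>M) + 0 * c) + (k - 1 / 2) * c)"
  proof (rule LIMSEQ_le_const)
    show "(\<lambda>n. T * \<eta> n + (exp (- 2 * k) / 2 * ((\<integral>x. (u T x)\<^sup>2 * \<phi> x \<partial>M) + e n * c) + (k - 1 / 2) * c))
        \<longlonglongrightarrow> T * 0 + (exp (- 2 * k) / 2 * ((\<integral>x. (u T x)\<^sup>2 * \<phi> x \<partial>M) + 0 * c) + (k - 1 / 2) * c)"
      by (intro tendsto_intros \<eta>0 e0)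
    show "\<exists>N. \<forall>n\<ge>N. (\<integral>x. ln (u0 x) * \<phi> x \<partial>M) + integral {0..T} flux
        \<le> T * \<eta> n + (exp (- 2 * k) / 2 * ((\<integral>x. (u T x)\<^sup>2 * \<phi> x \<partial>M) + e n * c) + (k - 1 / 2) * c)"
    proof (intro exI[of _ 0] allI impI)
      fix n show "(\<integral>x. ln (u0 x) * \<phi> x \<partial>M) + integral {0..T} flux
        \<le> T * \<eta> n + (exp (- 2 * k) / 2 * ((\<integral>x. (u T x)\<^sup>2 * \<phi> x \<partial>M) + e n * c) + (k - 1 / 2) * c)"
        using low[of n] init[of n] up[of n] by linarith
    qed
  qed
  then show ?thesis by (simp add: c_def)
qed

lemma contradiction:
  assumes A: "(\<integral>x. ln (u0 x) * \<phi> x \<partial>M) > 0"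
    and B: "B = 2 * (\<integral>x. wd (mi_unit 3) \<psi>0 x * \<phi> x \<partial>M)" "B > 0"
    and r: "\<And>t. t \<ge> 0 \<Longrightarrow> 4 * (LINT y:dom_x a|lebesgue. cont_rep (box_dom a) (\<lambda>x. \<psi> t x - \<psi>0 x) (vec3 y 0)
        * (sin (pi * y$1 / a) * sin (pi * y$2 / a))) \<le> B / 2"
  shows False
proof -
  \<comment> \<open>An integral that does not exist has the value 0, so A > 0 contains the
    integrability of (log u0) phi.\<close>
  have Ai: "integrable M (\<lambda>x. ln (u0 x) * \<phi> x)" using A not_integrable_integral_eq by fastforce
  define c where "c = (\<integral>x. \<phi> x \<partial>M)"
  have c: "c > 0"
  proof (rule ccontr)
    assume "\<not> c > 0"
    have nn: "AE x in M. 0 \<le> \<phi> x" using \<phi>_bounds(1) by (intro AE_I2) (simp add: less_imp_le)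
    with \<open>\<not> c > 0\<close> have "(\<integral>x. \<phi> x \<partial>M) = 0" unfolding c_def using integral_nonneg_AE[OF nn] by linarith
    then have "AE x in M. \<phi> x = 0" using integral_nonneg_eq_0_iff_AE[OF \<phi>_int nn] by simp
    then have "AE x in M. ln (u0 x) * \<phi> x = 0" by eventually_elim simp
    then have "(\<integral>x. ln (u0 x) * \<phi> x \<partial>M) = 0" using Ai by (intro integral_eq_zero_AE)
    with A show False by simp
  qed
  define G where "G t = (\<integral>x. ln (u0 x) * \<phi> x \<partial>M) + integral {0..t} flux" for t
  define Z where "Z t = B / 2 + 2 / \<kappa> * (P t - P 0)" for t
  show False
  proof (rule no_global_supersolution[OF c, of G Z flux "\<lambda>t. 2 * (\<integral>x. (u t x)\<^sup>2 * \<phi> x \<partial>M)"])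
    show "G 0 > 0" "Z 0 > 0" using A B by (auto simp: G_def Z_def)
    fix t :: real assume t: "t \<ge> 0"
    show "(G has_real_derivative flux t) (at t within {0..})"
      unfolding G_def[abs_def] using DERIV_add[OF DERIV_const integral_deriv_within[OF flux_continuous t]] by simp
    show "Z t \<le> flux t"
      unfolding flux_identity[OF t] B(1)[symmetric] Z_def using r[OF t] by linarith
    have "(Z has_real_derivative 0 + 2 / \<kappa> * (\<kappa> * (\<integral>x. (u t x)\<^sup>2 * \<phi> x \<partial>M) - 0)) (at t within {0..})"
      unfolding Z_def[abs_def] by (intro DERIV_add DERIV_const DERIV_cmult DERIV_diff P_deriv t)
    then show "(Z has_real_derivative 2 * (\<integral>x. (u t x)\<^sup>2 * \<phi> x \<partial>M)) (at t within {0..})"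
      by (rule DERIV_cong) (use \<kappa>_pos in simp)
    define X where "X = (\<integral>x. (u t x)\<^sup>2 * \<phi> x \<partial>M)"
    \<comment> \<open>The optimal tangent: (k - 1/2) c = G t - c/2, so G t cancels and X \<ge> c exp
      (2 G t / c) remains.\<close>
    define k where "k = G t / c"
    have "G t \<le> exp (- 2 * k) / 2 * X + (k - 1 / 2) * c"
      unfolding G_def c_def X_def by (rule log_estimate[OF t Ai])
    moreover have "(k - 1 / 2) * c = G t - c / 2" using c by (simp add: k_def left_diff_distrib)
    ultimately have "c \<le> exp (- 2 * k) * X" by simp
    then have "exp (2 * k) * c \<le> exp (2 * k) * (exp (- 2 * k) * X)" by (intro mult_left_mono) auto
    also have "\<dots> = X" by (simp add: mult.assoc[symmetric] exp_add[symmetric])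
    finally show "2 * c * exp (2 * G t / c) \<le> 2 * (\<integral>x. (u t x)\<^sup>2 * \<phi> x \<partial>M)"
      by (simp add: X_def k_def mult.commute)
  qed
qed

end

section \<open>Finiteness of the largest existence time\<close>

theorem theorem5p1:
  fixes a \<alpha> A B :: real
    and u0 \<psi>0 :: "real^3 \<Rightarrow> real"
    and u \<psi> :: "real \<Rightarrow> real^3 \<Rightarrow> real"
    and T :: ereal
    and r :: "real \<Rightarrow> real"
  assumes "a > 0"
    and "u0 \<in> sobolev 2 (box_dom a)"
    and "vanishes_on (box_dom a) u0 (frontier (box_dom a))"
    and "positive_on (box_dom a) u0 (box_dom a)"
    and "\<psi>0 \<in> sobolev 3 (box_dom a)"
    and "boundary_cond a \<psi>0"
    and "largest_time a u0 \<psi>0 T"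
    and "solution_on a u0 \<psi>0 T u \<psi>"
    and "\<alpha> = pi / a"
    and "A = (LINT x:box_dom a|lebesgue. ln (u0 x) * weight a \<alpha> x)"
    and "B = 2 * (LINT x:box_dom a|lebesgue. weak_deriv (box_dom a) (mi_unit 3) \<psi>0 x * weight a \<alpha> x)"
    and "\<forall>t \<in> time_interval T.
           r t = 4 * (pi / a)\<^sup>2 / (2 * (pi / a)\<^sup>2 - \<alpha>\<^sup>2) *
             (LINT y:dom_x a|lebesgue.
                cont_rep (box_dom a) (\<lambda>x. \<psi> t x - \<psi>0 x) (vector [y$1, y$2, 0])
                  * sin (pi * y$1 / a) * sin (pi * y$2 / a))"
    and "A > 0"
    and "B > 0"
    and "\<forall>t \<in> time_interval T. r t \<le> B / 2"
  shows "finite_time_singularity a u0 \<psi>0"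
proof -
  \<comment> \<open>The largest time T is given with a solution on all of its interval, so only the
    value \<infinity> has to be excluded.\<close>
  have "T \<noteq> \<infinity>"
  proof
    assume T: "T = \<infinity>"
    have Ti: "time_interval T = {0..}" unfolding T by (auto simp: time_interval_def)
    obtain ut \<psi>t where sol: "C1_sobolev 2 (box_dom a) T u ut" "C1_sobolev 3 (box_dom a) T \<psi> \<psi>t"
      "\<forall>t \<in> time_interval T.
           (AE x in lebesgue. x \<in> box_dom a \<longrightarrow>
              ut t x = 2 * u t x * weak_deriv (box_dom a) (mi_unit 3) (\<psi> t) x) \<and>
           has_weak_deriv (box_dom a) (mi_unit 3)
              (\<lambda>x. (u t x)\<^sup>2) (\<lambda>x. - weak_laplacian (box_dom a) (\<psi>t t) x) \<and>
           boundary_cond a (\<psi> t)"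
      "AE x in lebesgue. x \<in> box_dom a \<longrightarrow> u 0 x = u0 x"
      "AE x in lebesgue. x \<in> box_dom a \<longrightarrow> \<psi> 0 x = \<psi>0 x"
      using assms(8) unfolding solution_on_def by blast
    interpret global_solution a u0 \<psi>0 u \<psi> ut \<psi>t \<alpha>
      by unfold_locales (use assms(1,3-6,9) sol Ti T in \<open>auto simp: AE_lebesgue_on_iff\<close>)
    \<comment> \<open>At \<alpha> = pi / a the denominator is (pi / a)^2, which leaves the factor 4
      that \<open>flux_identity\<close> produces.\<close>
    have coef: "4 * (pi / a)\<^sup>2 / (2 * (pi / a)\<^sup>2 - \<alpha>\<^sup>2) = 4" using assms(1,9) by simp
    show False
    proof (rule contradiction)
      show "(\<integral>x. ln (u0 x) * weight a \<alpha> x \<partial>dom_measure a) > 0"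
        using assms(10,13) by (simp add: set_integral_lebesgue_on)
      show "B = 2 * (\<integral>x. weak_deriv (box_dom a) (mi_unit 3) \<psi>0 x * weight a \<alpha> x \<partial>dom_measure a)"
        using assms(11) by (simp add: set_integral_lebesgue_on)
      fix t :: real assume "t \<ge> 0"
      then have t: "t \<in> time_interval T" by (simp add: Ti)
      have "4 * (LINT y:dom_x a|lebesgue.
                cont_rep (box_dom a) (\<lambda>x. \<psi> t x - \<psi>0 x) (vector [y$1, y$2, 0])
                  * sin (pi * y$1 / a) * sin (pi * y$2 / a)) \<le> B / 2"
        using bspec[OF assms(15) t] unfolding bspec[OF assms(12) t] coef .
      then show "4 * (LINT y:dom_x a|lebesgue. cont_rep (box_dom a) (\<lambda>x. \<psi> t x - \<psi>0 x) (vec3 y 0)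
        * (sin (pi * y$1 / a) * sin (pi * y$2 / a))) \<le> B / 2"
        by (simp only: vec3_def mult.assoc)
    qed (rule assms(14))
  qed
  then have "T < \<infinity>" by simp
  with assms(7) show ?thesis unfolding finite_time_singularity_def by blast
qed

end
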